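(* For the class of finite nilpotent groups, the partitions $P_1,\dots,P_6$ induced by the equivalence relations $\sim_1,\dots,\sim_6$ satisfy $$P_1<P_2=P_3=P_4=P_5<P_6.$$
   Context: For a finite group $G$, $\# G$ is its order, $1_G$ its identity and $\mathrm{ord}(g)$ the order of $g\in G$. - $\mathcal O(G)$ is the multiset $\{\mathrm{ord}(g): g\in G\}$ of orders of elements of $G$ (counted with multiplicity). - $\mathcal C_G$ is the set of all cyclic subgroups of $G$. $\Lambda(G)$ is the vertex-weighted digraph with vertex set $\mathcal C_G$, each vertex $C$ weighted by its order $\# C$, with a directed edge $C_1\to C_2$ whenever $C_2\subsetneq C_1$. - The power graph $\Gamma(G)$ is the undirected graph with vertex set $G$ in which $g,h$ are connected if $g\neq h$ and $g=h^k$ or $h=g^k$ for some integer $k$. - For $t\in\mathbb Z$, $\Gamma_t(G)$ is the directed graph with vertex set $G$ and edge set $\{g\to g^t: g\in G\}$ (loops allowed). Equivalence relations on finite groups $G,H$: (1) $G\sim_1 H$ if $G\cong H$ as groups; (2) $G\sim_2 H$ if there is a bijection $\varphi:G\to H$ with $\varphi(g^t)=\varphi(g)^t$ for all $g\in G$, $t\in\mathbb Z$; (3) $G\sim_3 H$ if $\Lambda(G)\cong\Lambda(H)$ as vertex-weighted digraphs; (4) $G\sim_4 H$ if $\Gamma(G)\cong\Gamma(H)$; (5) $G\sim_5 H$ if $\Gamma_t(G)\cong\Gamma_t(H)$ for every $t\in\mathbb Z$; (6) $G\sim_6 H$ if $\mathcal O(G)=\mathcal O(H)$. For a class of finite groups,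 $P_j$ is the partition of the set of isomorphism classes of groups in the class induced by $\sim_j$. $P_j\le P_k$ means that $G\sim_j H$ implies $G\sim_k H$ for all groups $G,H$ in the class considered; $P_j=P_k$ means the two relations coincide on the class; $P_j<P_k$ means $P_j\le P_k$ and $P_j\ne P_k$. *)

theory Defs
  imports
    "HOL-Algebra.Algebra"
    "HOL-Library.Multiset"
    "Graph_Theory.Pair_Digraph"
    "Graph_Theory.Digraph_Isomorphism"
begin

primrec lower_central_series :: "('a, 'm) monoid_scheme \<Rightarrow> nat \<Rightarrow> 'a set" where
  "lower_central_series G 0 = carrier G"
| "lower_central_series G (Suc n) =
     generate G (\<Union>x \<in> lower_central_series G n. \<Union>y \<in> carrier G.
       {x \<otimes>\<^bsub>G\<^esub> y \<otimes>\<^bsub>G\<^esub> inv\<^bsub>G\<^esub> x \<otimes>\<^bsub>G\<^esub> inv\<^bsub>G\<^esub> y})"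

definition finite_nilpotent_group :: "('a, 'm) monoid_scheme \<Rightarrow> bool" where
  "finite_nilpotent_group G \<longleftrightarrow>
     group G \<and> finite (carrier G) \<and> (\<exists>n. lower_central_series G n = {\<one>\<^bsub>G\<^esub>})"

definition order_multiset :: "('a, 'm) monoid_scheme \<Rightarrow> nat multiset" where
  "order_multiset G = image_mset (group.ord G) (mset_set (carrier G))"

definition cyclic_subgroups :: "('a, 'm) monoid_scheme \<Rightarrow> 'a set set" where
  "cyclic_subgroups G = {C. subgroup C G \<and> cyclic_group (G\<lparr>carrier := C\<rparr>)}"

text \<open>The vertex weights of this digraph, the orders of the subgroups, are given by \<^const>\<open>card\<close>.\<close>

definition cyclic_subgroup_digraph ::
  "('a, 'm) monoid_scheme \<Rightarrow> ('a set, 'a set \<times> 'a set) pre_digraph" where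
  "cyclic_subgroup_digraph G = with_proj
     \<lparr>pverts = cyclic_subgroups G,
      parcs = {(C1, C2). C1 \<in> cyclic_subgroups G \<and> C2 \<in> cyclic_subgroups G \<and> C2 \<subset> C1}\<rparr>"

definition vertex_weighted_digraph_iso ::
  "('a, 'b) pre_digraph \<Rightarrow> ('a \<Rightarrow> 'w) \<Rightarrow> ('c, 'd) pre_digraph \<Rightarrow> ('c \<Rightarrow> 'w) \<Rightarrow> bool" where
  "vertex_weighted_digraph_iso D w E w' \<longleftrightarrow>
     (\<exists>f. pre_digraph.digraph_isomorphism D f \<and> E = app_iso f D \<and>
          (\<forall>v \<in> verts D. w' (iso_verts f v) = w v))"

text \<open>As usual in \<^theory>\<open>Graph_Theory.Digraph\<close>, an undirected graph is a symmetric digraph.\<close>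

definition power_graph :: "('a, 'm) monoid_scheme \<Rightarrow> ('a, 'a \<times> 'a) pre_digraph" where
  "power_graph G = with_proj
     \<lparr>pverts = carrier G,
      parcs = {(g, h). g \<in> carrier G \<and> h \<in> carrier G \<and> g \<noteq> h \<and>
                 (\<exists>k::int. g = h [^]\<^bsub>G\<^esub> k \<or> h = g [^]\<^bsub>G\<^esub> k)}\<rparr>"

definition power_map_digraph :: "int \<Rightarrow> ('a, 'm) monoid_scheme \<Rightarrow> ('a, 'a \<times> 'a) pre_digraph" where
  "power_map_digraph t G = with_proj
     \<lparr>pverts = carrier G, parcs = (\<lambda>g. (g, g [^]\<^bsub>G\<^esub> t)) ` carrier G\<rparr>"

definition sim1 :: "'a monoid \<Rightarrow> 'b monoid \<Rightarrow> bool" where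
  "sim1 G H \<longleftrightarrow> G \<cong> H"

definition sim2 :: "'a monoid \<Rightarrow> 'b monoid \<Rightarrow> bool" where
  "sim2 G H \<longleftrightarrow>
     (\<exists>f. bij_betw f (carrier G) (carrier H) \<and>
          (\<forall>g \<in> carrier G. \<forall>t::int. f (g [^]\<^bsub>G\<^esub> t) = f g [^]\<^bsub>H\<^esub> t))"

definition sim3 :: "'a monoid \<Rightarrow> 'b monoid \<Rightarrow> bool" where
  "sim3 G H \<longleftrightarrow>
     vertex_weighted_digraph_iso (cyclic_subgroup_digraph G) card (cyclic_subgroup_digraph H) card"

definition sim4 :: "'a monoid \<Rightarrow> 'b monoid \<Rightarrow> bool" where
  "sim4 G H \<longleftrightarrow> digraph_iso (power_graph G) (power_graph H)"

definition sim5 :: "'a monoid \<Rightarrow> 'b monoid \<Rightarrow> bool" where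
  "sim5 G H \<longleftrightarrow> (\<forall>t. digraph_iso (power_map_digraph t G) (power_map_digraph t H))"

definition sim6 :: "'a monoid \<Rightarrow> 'b monoid \<Rightarrow> bool" where
  "sim6 G H \<longleftrightarrow> order_multiset G = order_multiset H"

text \<open>
  Comparison, on a class of groups, of the partitions induced by two relations. The two groups that
  are compared may live on different carrier types, so the class is given once for each type.
\<close>

definition partition_le ::
  "('a monoid \<Rightarrow> bool) \<Rightarrow> ('b monoid \<Rightarrow> bool) \<Rightarrow>
   ('a monoid \<Rightarrow> 'b monoid \<Rightarrow> bool) \<Rightarrow> ('a monoid \<Rightarrow> 'b monoid \<Rightarrow> bool) \<Rightarrow> bool" where
  "partition_le K L R S \<longleftrightarrow> (\<forall>G H. K G \<longrightarrow> L H \<longrightarrow> R G H \<longrightarrow> S G H)"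

definition partition_eq ::
  "('a monoid \<Rightarrow> bool) \<Rightarrow> ('b monoid \<Rightarrow> bool) \<Rightarrow>
   ('a monoid \<Rightarrow> 'b monoid \<Rightarrow> bool) \<Rightarrow> ('a monoid \<Rightarrow> 'b monoid \<Rightarrow> bool) \<Rightarrow> bool" where
  "partition_eq K L R S \<longleftrightarrow> (\<forall>G H. K G \<longrightarrow> L H \<longrightarrow> (R G H \<longleftrightarrow> S G H))"

definition partition_less ::
  "('a monoid \<Rightarrow> bool) \<Rightarrow> ('b monoid \<Rightarrow> bool) \<Rightarrow>
   ('a monoid \<Rightarrow> 'b monoid \<Rightarrow> bool) \<Rightarrow> ('a monoid \<Rightarrow> 'b monoid \<Rightarrow> bool) \<Rightarrow> bool" where
  "partition_less K L R S \<longleftrightarrow> partition_le K L R S \<and> \<not> partition_eq K L R S"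

end

theory Submission
  imports Defs "HOL-Number_Theory.Totient"
begin

text \<open>
  All relations are compared with one intermediate notion, a bijection \<open>f\<close> such that \<open>x\<close> is a power
  of \<open>y\<close> exactly if \<open>f x\<close> is a power of \<open>f y\<close> (\<open>directed_power_iso\<close>). A bijection that commutes with
  all power maps is one, and such an \<open>f\<close> carries cyclic subgroups to cyclic subgroups and preserves
  orders, so it induces isomorphisms of the cyclic subgroup digraphs and of the power graphs and
  preserves the multiset of orders. What has to be shown is that the coarser data give back \<open>f\<close>, and
  that \<open>f\<close>, or a family of isomorphisms of the power map digraphs, gives a bijection that commutes
  with all power maps.

  From the cyclic subgroup digraphs, \<open>f\<close> is obtained by matching the generators of corresponding
  cyclic subgroups, of which there are equally many.

  From the power graphs, the direction of the edges has to be recovered. In a group of prime power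
  order the elements with a given closed neighbourhood are the elements of a cyclic group \<open>\<langle>m\<rangle>\<close>
  whose orders exceed a bound, and both the order of \<open>m\<close> and the bound can be read off the graph
  (\<open>card_twins_prime_power\<close>); rearranging a graph isomorphism inside these classes makes it preserve
  orders, and then it preserves directions. If two primes divide the order of a nilpotent group,
  elements of coprime orders commute, and their products tell apart the neighbourhoods of elements
  that generate different cyclic subgroups (\<open>twins_same_cyc\<close>), except for the elements joined to all
  others, and these exist besides the identity in cyclic groups only. So a graph isomorphism
  preserves the number \<open>\<phi>(ord x)\<close> of generators of \<open>\<langle>x\<rangle>\<close>, which determines all directions, apart
  from an ambiguity between orders \<open>d\<close> and \<open>2d\<close> with \<open>d\<close> odd that an involution resolves.

  To get a bijection that commutes with all power maps, it is enough to have one on the elements of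
  \<open>p\<close>-power order for every prime \<open>p\<close>: since elements of coprime orders commute, these bijections can
  be multiplied (\<open>power_iso_on_mult\<close>). On the elements of \<open>p\<close>-power order, \<open>x \<mapsto> x\<^sup>p\<close> is the parent map of
  a tree with root \<open>\<one>\<close>. The isomorphism type of this tree is determined by a directed power
  isomorphism, by counting the elements in which \<open>x\<close> has index \<open>p\<close>, and also by the power map digraph
  for an exponent that is \<open>p\<close> modulo the \<open>p\<close>-part and \<open>1\<close> modulo the rest of the group order. Conversely,
  if the trees of \<open>G\<close> and \<open>H\<close> are isomorphic, a power-compatible bijection is built one cyclic
  subgroup at a time: a partial bijection that preserves the types of subtrees matches equal parts
  of the sets of \<open>p\<close>-th roots of \<open>x\<close> and of \<open>f x\<close>, so that what remains has equal types as well, and a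
  root \<open>y\<close> of \<open>x\<close> finds a partner \<open>y'\<close> to which it can be sent, together with all its powers
  (\<open>partial_power_iso_extend\<close>).

  Both strict inequalities are witnessed by groups \<open>\<int>/n \<times> \<int>/m\<close> with a multiplication twisted by a
  bilinear form. For an alternating form the power maps are those of the direct product, but the
  group need not be abelian; and \<open>\<int>/4 \<times> \<int>/4\<close> has the same orders as a semidirect product of two
  cyclic groups of order four, but more squares.
\<close>

(* Makes prime the number-theoretic notion. *)
hide_const (open) Divisibility.prime

section \<open>Cyclic subgroups of a finite group\<close>

text \<open>
  The cyclic subgroup generated by \<open>x\<close>, as a set of powers, so that membership can be
  used without group axioms.
\<close>

definition cyc :: "('a, 'm) monoid_scheme \<Rightarrow> 'a \<Rightarrow> 'a set" where
  "cyc G x = range (\<lambda>k::int. x [^]\<^bsub>G\<^esub> k)"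

locale fin_group = group G for G (structure) +
  assumes finite_carrier [simp]: "finite (carrier G)"
begin

lemma ord_pos [simp]: "x \<in> carrier G \<Longrightarrow> 0 < ord x"
  using ord_ge_1[OF finite_carrier, of x] by simp

lemma cyc_eq_generate: "x \<in> carrier G \<Longrightarrow> cyc G x = generate G {x}"
  by (auto simp: cyc_def generate_pow)

lemma cyc_carrier: "x \<in> carrier G \<Longrightarrow> cyc G x \<subseteq> carrier G"
  by (auto simp: cyc_def)

lemma in_cyc_carrier: "y \<in> cyc G x \<Longrightarrow> x \<in> carrier G \<Longrightarrow> y \<in> carrier G"
  using cyc_carrier by blast

lemma pow_in_cyc: "x [^] (k::int) \<in> cyc G x"
  by (auto simp: cyc_def)

lemma nat_pow_in_cyc: "x [^] (k::nat) \<in> cyc G x"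
  using pow_in_cyc[of x "int k"] by (simp add: int_pow_int)

lemma self_in_cyc: "x \<in> carrier G \<Longrightarrow> x \<in> cyc G x"
  using pow_in_cyc[of x 1] by simp

lemma one_in_cyc: "\<one> \<in> cyc G x"
  using pow_in_cyc[of x 0] by simp

lemma finite_cyc [simp]: "x \<in> carrier G \<Longrightarrow> finite (cyc G x)"
  using cyc_carrier finite_subset finite_carrier by blast

lemma cyc_mono: "x \<in> carrier G \<Longrightarrow> y \<in> cyc G x \<Longrightarrow> cyc G y \<subseteq> cyc G x"
  by (auto simp: cyc_def int_pow_pow)

lemma cyc_trans: "z \<in> cyc G y \<Longrightarrow> y \<in> cyc G x \<Longrightarrow> x \<in> carrier G \<Longrightarrow> z \<in> cyc G x"
  using cyc_mono by blast

lemma card_cyc: "x \<in> carrier G \<Longrightarrow> card (cyc G x) = ord x"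
  by (simp add: cyc_eq_generate generate_pow_card)

lemma in_cyc_nat:
  assumes "x \<in> carrier G" "y \<in> cyc G x"
  obtains k :: nat where "k < ord x" "y = x [^] k"
proof -
  obtain i :: int where i: "y = x [^] i" using assms by (auto simp: cyc_def)
  define k where "k = nat (i mod int (ord x))"
  have o: "0 < ord x" using assms by simp
  have "int (ord x) dvd i - i mod int (ord x)" by simp
  then have "x [^] (i mod int (ord x)) = x [^] i"
    using assms(1) int_pow_eq by blast
  then have "x [^] k = y"
    using o by (simp add: k_def i pow_nat)
  moreover have "k < ord x" using o by (simp add: k_def nat_less_iff)
  ultimately show ?thesis using that by blast
qed

lemma ord_dvd_of_in_cyc:
  assumes "x \<in> carrier G" "y \<in> cyc G x"
  shows "ord y dvd ord x"
  proof -
  obtain k :: nat where y: "y = x [^] k" using in_cyc_nat[OF assms] by blast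
  have "y [^] ord x = (x [^] ord x) [^] k"
    using assms(1) unfolding y by (simp only: nat_pow_pow mult.commute)
  then show ?thesis using assms in_cyc_carrier pow_eq_id[of y "ord x"] by simp
qed

lemma cyc_eqI:
  assumes "x \<in> carrier G" "y \<in> cyc G x" "ord x \<le> ord y"
  shows "cyc G y = cyc G x"
proof -
  have "y \<in> carrier G" using assms(2,1) by (rule in_cyc_carrier)
  then show ?thesis
    using card_seteq[OF finite_cyc[OF assms(1)] cyc_mono[OF assms(1,2)]] assms by (simp add: card_cyc)
qed

text \<open>
  A cyclic group has only one subgroup of each order: with \<open>b = x\<^sup>j\<close> and \<open>g
  = gcd (ord x) j\<close>, Bezout puts \<open>x\<^sup>g\<close> into the subgroup generated by
  \<open>b\<close>, and \<open>a\<close> is a power of \<open>x\<^sup>g\<close>.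
\<close>

lemma in_cyc_if_ord_dvd:
  assumes x: "x \<in> carrier G" and a: "a \<in> cyc G x" and b: "b \<in> cyc G x" and d: "ord a dvd ord b"
  shows "a \<in> cyc G b"
proof -
  obtain i where i: "a = x [^] (i::nat)" using in_cyc_nat[OF x a] by blast
  obtain j where j: "b = x [^] (j::nat)" using in_cyc_nat[OF x b] by blast
  have bc: "b \<in> carrier G" using b x in_cyc_carrier by blast
  define g where "g = gcd (ord x) j"
  have ox: "0 < ord x" using x by simp
  then have g0: "0 < g" by (simp add: g_def)
  have ob: "ord b * g = ord x"
    using ox x by (auto simp: j ord_pow_gen g_def)
  have "a \<in> carrier G" using a x by (rule in_cyc_carrier)
  then have "a [^] ord b = \<one>" using d pow_eq_id by blast
  then have "ord x dvd i * ord b" using x by (simp add: i nat_pow_pow pow_eq_id)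
  then have "g dvd i"
    using ord_pos[OF bc] unfolding ob[symmetric] by (simp add: mult.commute[of i])
  then obtain q where q: "i = g * q" by auto
  obtain u v where uv: "u * int (ord x) + v * int j = int g"
    using bezout_int[of "int (ord x)" "int j"] by (auto simp: g_def)
  have "b [^] (v * int q) = x [^] (int j * v * int q)"
    using x by (simp add: j flip: int_pow_int) (simp add: int_pow_pow mult.assoc)
  also have "\<dots> = x [^] (int i)"
  proof -
    have "int i - int j * v * int q = int (ord x) * (u * int q)"
      unfolding q of_nat_mult uv[symmetric] by (simp add: algebra_simps)
    then show ?thesis using x int_pow_eq by (metis dvd_triv_left)
  qed
  also have "\<dots> = a" by (simp add: i int_pow_int)
  finally show ?thesis using pow_in_cyc[of b "v * int q"] by simp
qed

lemma in_cyc_if_ord_le_prime_power: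
  assumes "x \<in> carrier G" "a \<in> cyc G x" "b \<in> cyc G x" "prime p" "ord x = p ^ n" "ord a \<le> ord b"
  shows "a \<in> cyc G b"
proof -
  have "ord a dvd p ^ n" "ord b dvd p ^ n"
    using ord_dvd_of_in_cyc[OF assms(1,2)] ord_dvd_of_in_cyc[OF assms(1,3)] assms(5) by auto
  then obtain i j where "ord a = p ^ i" "ord b = p ^ j"
    using \<open>prime p\<close> by (auto simp: divides_primepow_nat)
  moreover from this have "i \<le> j"
    using assms(6) power_le_imp_le_exp[OF prime_gt_1_nat[OF assms(4)]] by simp
  ultimately have "ord a dvd ord b" by (simp add: le_imp_power_dvd)
  then show ?thesis by (rule in_cyc_if_ord_dvd[OF assms(1-3)])
qed

lemma exists_ord_in_cyc:
  assumes "x \<in> carrier G" "d dvd ord x"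
  obtains z where "z \<in> cyc G x" "ord z = d"
proof -
  obtain k where k: "ord x = d * k" using assms by auto
  then have "ord (x [^] k) = d" "k \<noteq> 0"
    using assms ord_pos[of x] by (auto simp: ord_pow)
  then show ?thesis using that nat_pow_in_cyc by blast
qed

text \<open>
  Cauchy's theorem, read off from a subgroup of order \<open>p\<close> that Sylow's theorem
  provides.
\<close>

lemma exists_ord_prime:
  assumes p: "prime p" "p dvd order G"
  obtains z where "z \<in> carrier G" "ord z = p"
proof -
  obtain m where "order G = p ^ 1 * m" using p by auto
  then obtain H where H: "subgroup H G" "card H = p ^ 1"
    using sylow_thm[OF p(1) is_group _ finite_carrier] by blast
  have "\<exists>z\<in>H. z \<noteq> \<one>"
  proof (rule ccontr)
    assume "\<not> ?thesis"
    then have "H \<subseteq> {\<one>}" by auto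
    then have "card H \<le> 1" using card_mono[of "{\<one>}" H] by simp
    then show False using H p prime_gt_1_nat[of p] by simp
  qed
  then obtain z where z: "z \<in> H" "z \<noteq> \<one>" by blast
  have zc: "z \<in> carrier G" using z H subgroup.subset by blast
  have "z [^]\<^bsub>G\<lparr>carrier := H\<rparr>\<^esub> order (G\<lparr>carrier := H\<rparr>) = \<one>"
    using group.pow_order_eq_1[OF subgroup_imp_group[OF H(1)], of z] z by simp
  then have "z [^] p = \<one>"
    using H(2) by (simp add: order_def nat_pow_consistent[symmetric])
  then have "ord z dvd p" using zc pow_eq_id by simp
  moreover have "ord z \<noteq> 1" using z zc ord_eq_1 by blast
  ultimately have "ord z = p" using p(1) by (auto simp: prime_nat_iff)
  then show ?thesis using that zc by blast
qed

text \<open>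
  The right-hand side depends on the order of \<open>x\<close> only; this is how cyclic groups of
  equal order in two different groups are compared.
\<close>

lemma card_ord_in_cyc:
  assumes x: "x \<in> carrier G"
  shows "card {z \<in> cyc G x. ord z = k} = card {i. i < ord x \<and> ord x div gcd (ord x) i = k}"
proof -
  have o: "0 < ord x" using x by simp
  have ordi: "ord (x [^] i) = ord x div gcd (ord x) i" for i :: nat
    using x o by (simp add: ord_pow_gen)
  have "{z \<in> cyc G x. ord z = k} = (\<lambda>i::nat. x [^] i) ` {i. i < ord x \<and> ord x div gcd (ord x) i = k}"
    using ordi nat_pow_in_cyc by (auto elim!: in_cyc_nat[OF x])
  moreover have "inj_on (\<lambda>i::nat. x [^] i) {i. i < ord x \<and> ord x div gcd (ord x) i = k}"
    using ord_inj[OF x] by (rule inj_on_subset) (use o in auto)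
  ultimately show ?thesis by (simp add: card_image)
qed

lemma card_generators:
  assumes x: "x \<in> carrier G"
  shows "card {z \<in> carrier G. cyc G z = cyc G x} = totient (ord x)"
proof -
  have o: "0 < ord x" using x by simp
  have "{z \<in> carrier G. cyc G z = cyc G x} = {z \<in> cyc G x. ord z = ord x}"
  proof (rule Set.set_eqI)
    fix z
    show "z \<in> {z \<in> carrier G. cyc G z = cyc G x} \<longleftrightarrow> z \<in> {z \<in> cyc G x. ord z = ord x}"
      using self_in_cyc[of z] card_cyc[of z] card_cyc[OF x] cyc_eqI[OF x, of z] in_cyc_carrier[of z x] x
      by auto
  qed
  then have "card {z \<in> carrier G. cyc G z = cyc G x}
      = card {i. i < ord x \<and> ord x div gcd (ord x) i = ord x}"
    using card_ord_in_cyc[OF x] by simp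
  also have "\<dots> = totient (ord x)"
  proof (cases "ord x = 1")
    case False
    have "{i. i < ord x \<and> ord x div gcd (ord x) i = ord x} = totatives (ord x)"
      using o False by (auto simp: totatives_def div_eq_dividend_iff coprime_iff_gcd_eq_1 gcd.commute
          intro!: le_neq_trans gr0I)
    then show ?thesis by (simp add: totient_def)
  qed (auto simp: Collect_conv_if)
  finally show ?thesis .
qed

end

section \<open>Nilpotent groups\<close>

text \<open>A conjugate of a commutator is the commutator of the conjugates.\<close>

lemma (in group) lower_central_series_normal: "lower_central_series G n \<lhd> G"
proof (induction n)
  case 0
  show ?case by (simp add: normal_inv_iff subgroup_self)
next
  case (Suc n)
  interpret N: normal "lower_central_series G n" G by (rule Suc)
  show ?case unfolding lower_central_series.simps
  proof (rule normal_generateI)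
    show "(\<Union>x\<in>lower_central_series G n. \<Union>y\<in>carrier G. {x \<otimes> y \<otimes> inv x \<otimes> inv y}) \<subseteq> carrier G"
      using N.subset by auto
  next
    fix h g
    assume h: "h \<in> (\<Union>x\<in>lower_central_series G n. \<Union>y\<in>carrier G. {x \<otimes> y \<otimes> inv x \<otimes> inv y})"
      and g: "g \<in> carrier G"
    then obtain x y where xy: "x \<in> lower_central_series G n" "y \<in> carrier G"
      "h = x \<otimes> y \<otimes> inv x \<otimes> inv y" by auto
    have xc: "x \<in> carrier G" using xy N.subset by auto
    let ?x = "g \<otimes> x \<otimes> inv g" and ?y = "g \<otimes> y \<otimes> inv g"
    have c: "inv g \<otimes> (g \<otimes> z) = z" if "z \<in> carrier G" for z
      using g that by (simp add: m_assoc[symmetric])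
    have "?x \<otimes> ?y \<otimes> inv ?x \<otimes> inv ?y = g \<otimes> h \<otimes> inv g"
      using g xc xy(2) by (simp add: xy(3) inv_mult_group m_assoc c)
    moreover have "?x \<in> lower_central_series G n" using xy g N.inv_op_closed2 by blast
    moreover have "?y \<in> carrier G" using xy g by simp
    ultimately show "g \<otimes> h \<otimes> inv g \<in> (\<Union>x\<in>lower_central_series G n. \<Union>y\<in>carrier G. {x \<otimes> y \<otimes> inv x \<otimes> inv y})"
      by blast
  qed
qed

text \<open>
  If the commutator \<open>c\<close> of \<open>x\<close> and \<open>y\<close> commutes with both,
  then \<open>[x\<^sup>k, y] = c\<^sup>k = [x, y\<^sup>k]\<close>.
\<close>

lemma (in group) central_commutator_pow:
  assumes c: "x \<in> carrier G" "y \<in> carrier G" "c \<in> carrier G"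
    and eq: "x \<otimes> y = c \<otimes> (y \<otimes> x)" and cx: "c \<otimes> x = x \<otimes> c" and cy: "c \<otimes> y = y \<otimes> c"
  shows "x [^] (k::nat) \<otimes> y = c [^] k \<otimes> (y \<otimes> x [^] k)"
    and "x \<otimes> y [^] (k::nat) = c [^] k \<otimes> (y [^] k \<otimes> x)"
proof -
  have ckx: "c [^] k \<otimes> x = x \<otimes> c [^] k" for k :: nat
    using group_commutes_pow[OF cx] c by blast
  have cky: "c [^] k \<otimes> y = y \<otimes> c [^] k" for k :: nat
    using group_commutes_pow[OF cy] c by blast
  show "x [^] k \<otimes> y = c [^] k \<otimes> (y \<otimes> x [^] k)"
  proof (induction k)
    case (Suc k)
    have "x [^] Suc k \<otimes> y = x [^] k \<otimes> (x \<otimes> y)" using c by (simp add: m_assoc)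
    also have "\<dots> = x [^] k \<otimes> c \<otimes> (y \<otimes> x)" using c eq by (simp add: m_assoc)
    also have "x [^] k \<otimes> c = c \<otimes> x [^] k"
      using group_commutes_pow[OF cx[symmetric]] c by blast
    also have "c \<otimes> x [^] k \<otimes> (y \<otimes> x) = c \<otimes> (x [^] k \<otimes> y) \<otimes> x" using c by (simp add: m_assoc)
    also have "\<dots> = c \<otimes> c [^] k \<otimes> (y \<otimes> (x [^] k \<otimes> x))" unfolding Suc using c by (simp add: m_assoc)
    also have "c \<otimes> c [^] k = c [^] Suc k" using c by (metis nat_pow_Suc2)
    finally show ?case using c by simp
  qed (use c in simp)
  show "x \<otimes> y [^] k = c [^] k \<otimes> (y [^] k \<otimes> x)"
  proof (induction k)
    case (Suc k)
    have "x \<otimes> y [^] Suc k = (x \<otimes> y [^] k) \<otimes> y" using c by (simp add: m_assoc)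
    also have "\<dots> = c [^] k \<otimes> y [^] k \<otimes> (x \<otimes> y)" unfolding Suc using c by (simp add: m_assoc)
    also have "\<dots> = c [^] k \<otimes> (y [^] k \<otimes> c) \<otimes> (y \<otimes> x)" using c eq by (simp add: m_assoc)
    also have "y [^] k \<otimes> c = c \<otimes> y [^] k"
      using group_commutes_pow[OF cy[symmetric]] c by blast
    finally show ?case using c by (simp add: m_assoc)
  qed (use c in simp)
qed

text \<open>
  By the power laws for central commutators, the order of \<open>h c\<close> divides the orders of
  \<open>x\<close> and of \<open>y\<close>.
\<close>

lemma (in group_hom) commutator_in_kernel:
  assumes x: "x \<in> carrier G" and y: "y \<in> carrier G" and co: "coprime (G.ord x) (G.ord y)"
    and c: "c \<in> carrier G" "x \<otimes> y = c \<otimes> (y \<otimes> x)"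
    and comm: "h c \<otimes>\<^bsub>H\<^esub> h x = h x \<otimes>\<^bsub>H\<^esub> h c" "h c \<otimes>\<^bsub>H\<^esub> h y = h y \<otimes>\<^bsub>H\<^esub> h c"
  shows "h c = \<one>\<^bsub>H\<^esub>"
proof -
  have "h x \<otimes>\<^bsub>H\<^esub> h y = h c \<otimes>\<^bsub>H\<^esub> (h y \<otimes>\<^bsub>H\<^esub> h x)"
    using c x y by (metis hom_mult G.m_closed)
  note pw = H.central_commutator_pow[OF hom_closed[OF x] hom_closed[OF y] hom_closed[OF c(1)] this comm]
  have X: "h x [^]\<^bsub>H\<^esub> G.ord x = \<one>\<^bsub>H\<^esub>" "h y [^]\<^bsub>H\<^esub> G.ord y = \<one>\<^bsub>H\<^esub>"
    using x y by (simp_all flip: hom_nat_pow)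
  have "h c [^]\<^bsub>H\<^esub> G.ord x = \<one>\<^bsub>H\<^esub>"
    using pw(1)[of "G.ord x"] x y c by (simp add: X)
  moreover have "h c [^]\<^bsub>H\<^esub> G.ord y = \<one>\<^bsub>H\<^esub>"
    using pw(2)[of "G.ord y"] x y c by (simp add: X)
  ultimately have "H.ord (h c) dvd G.ord x" "H.ord (h c) dvd G.ord y"
    using H.pow_eq_id[OF hom_closed[OF c(1)]] by auto
  then have "H.ord (h c) = 1" using co by (metis coprime_common_divisor_nat)
  then show ?thesis using H.ord_eq_1[OF hom_closed[OF c(1)]] by simp
qed

locale nilpotent_fin_group = fin_group +
  assumes nilpotent: "\<exists>n. lower_central_series G n = {\<one>}"
begin

text \<open>
  The commutator \<open>c\<close> of \<open>x\<close> and \<open>y\<close> lies in every term of the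
  lower central series: if it lies in one term, then it is central modulo the next one, hence
  trivial there because the orders of \<open>x\<close> and \<open>y\<close> are coprime.
\<close>

lemma coprime_ord_commute:
  assumes x: "x \<in> carrier G" and y: "y \<in> carrier G" and co: "coprime (ord x) (ord y)"
  shows "x \<otimes> y = y \<otimes> x"
proof -
  define c where "c = x \<otimes> y \<otimes> inv x \<otimes> inv y"
  have cc: "c \<in> carrier G" using x y by (simp add: c_def)
  have xy: "x \<otimes> y = c \<otimes> (y \<otimes> x)"
  proof -
    have "c \<otimes> (y \<otimes> x) = x \<otimes> y \<otimes> inv x \<otimes> (inv y \<otimes> y) \<otimes> x"
      using x y by (simp only: c_def m_assoc m_closed inv_closed)
    also have "\<dots> = x \<otimes> y" using x y by (simp add: m_assoc)
    finally show ?thesis ..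
  qed
  have "c \<in> lower_central_series G n" for n
  proof (induction n)
    case (Suc n)
    define N where "N = lower_central_series G (Suc n)"
    interpret N: normal N G unfolding N_def by (rule lower_central_series_normal)
    interpret Q: group "G Mod N" by (rule N.factorgroup_is_group)
    define \<phi> where "\<phi> = (\<lambda>a. N #> a)"
    have hom: "\<phi> \<in> hom G (G Mod N)" unfolding \<phi>_def by (rule N.r_coset_hom_Mod)
    interpret h: group_hom G "G Mod N" \<phi>
      using hom by unfold_locales
    have ker: "\<phi> a = \<one>\<^bsub>G Mod N\<^esub> \<longleftrightarrow> a \<in> N" if "a \<in> carrier G" for a
      using that coset_join1[OF _ that N.is_subgroup] coset_join2[OF that N.is_subgroup]
      by (auto simp: \<phi>_def FactGroup_def)
    have comm: "\<phi> c \<otimes>\<^bsub>G Mod N\<^esub> \<phi> g = \<phi> g \<otimes>\<^bsub>G Mod N\<^esub> \<phi> c" if g: "g \<in> carrier G" for g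
    proof -
      define d where "d = c \<otimes> g \<otimes> inv c \<otimes> inv g"
      have d: "d \<in> carrier G" using g cc by (simp add: d_def)
      have "d \<in> N"
        using Suc g by (auto simp: N_def d_def intro!: generate.incl)
      then have d1: "\<phi> d = \<one>\<^bsub>G Mod N\<^esub>" using ker d by simp
      have "d \<otimes> (g \<otimes> c) = c \<otimes> g \<otimes> inv c \<otimes> (inv g \<otimes> g) \<otimes> c"
        using g cc by (simp only: d_def m_assoc m_closed inv_closed)
      also have "\<dots> = c \<otimes> g" using g cc by (simp add: m_assoc)
      finally have "\<phi> (c \<otimes> g) = \<phi> d \<otimes>\<^bsub>G Mod N\<^esub> \<phi> (g \<otimes> c)"
        using g cc d by (metis h.hom_mult m_closed)
      also have "\<dots> = \<phi> (g \<otimes> c)" unfolding d1 using g cc by (intro Q.l_one h.hom_closed) simp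
      finally show ?thesis using g cc by (metis h.hom_mult)
    qed
    have "\<phi> c = \<one>\<^bsub>G Mod N\<^esub>"
      by (rule h.commutator_in_kernel[OF x y co cc xy comm[OF x] comm[OF y]])
    then show ?case using ker cc N_def by blast
  qed (use cc in simp)
  then have "c = \<one>" using nilpotent by blast
  then show ?thesis using xy x y by simp
qed

end

section \<open>The relations in terms of bijections\<close>

text \<open>
  Bijections are found by counting: it suffices that every label occurs equally often.
\<close>

lemma bij_betw_matching_labels:
  assumes fin: "finite A" "finite B"
    and card: "\<And>l. card {x \<in> A. a x = l} = card {y \<in> B. b y = l}"
  obtains g where "bij_betw g A B" "\<And>x. x \<in> A \<Longrightarrow> b (g x) = a x"
proof -
  have "\<exists>h. bij_betw h {x \<in> A. a x = l} {y \<in> B. b y = l}" for l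
    using fin card by (intro finite_same_card_bij) auto
  then obtain h where h: "\<And>l. bij_betw (h l) {x \<in> A. a x = l} {y \<in> B. b y = l}" by metis
  define g where "g = (\<lambda>x. h (a x) x)"
  have g: "g x \<in> B" "b (g x) = a x" if "x \<in> A" for x
    using bij_betwE[OF h[of "a x"]] that by (auto simp: g_def)
  have "inj_on g A"
  proof (rule inj_onI)
    fix x y assume xy: "x \<in> A" "y \<in> A" "g x = g y"
    then have "a x = a y" using g by metis
    then show "x = y"
      using xy bij_betw_imp_inj_on[OF h[of "a x"]] by (auto simp: g_def inj_on_def)
  qed
  moreover have "y \<in> g ` A" if y: "y \<in> B" for y
  proof -
    have "y \<in> h (b y) ` {x \<in> A. a x = b y}"
      using y bij_betw_imp_surj_on[OF h[of "b y"]] by auto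
    then show ?thesis by (force simp: g_def)
  qed
  ultimately have "bij_betw g A B" using g by (auto simp: bij_betw_def)
  then show ?thesis using that g by blast
qed

text \<open>
  For digraphs whose arcs are pairs of vertices, the arc, head and tail maps of an isomorphism are
  determined by its vertex map. The predicate \<open>P\<close> leaves room for a condition on vertex
  weights.
\<close>

lemma with_proj_isomorphism_iff:
  assumes D: "parcs D \<subseteq> pverts D \<times> pverts D" and E: "parcs E \<subseteq> pverts E \<times> pverts E"
  shows "(\<exists>h. pre_digraph.digraph_isomorphism (with_proj D) h \<and> with_proj E = app_iso h (with_proj D) \<and>
            P (iso_verts h)) \<longleftrightarrow>
         (\<exists>f. bij_betw f (pverts D) (pverts E) \<and>
            (\<forall>u\<in>pverts D. \<forall>v\<in>pverts D. (u, v) \<in> parcs D \<longleftrightarrow> (f u, f v) \<in> parcs E) \<and> P f)"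
  (is "?L \<longleftrightarrow> ?R")
proof
  assume ?L
  then obtain h where h: "pre_digraph.digraph_isomorphism (with_proj D) h"
    "with_proj E = app_iso h (with_proj D)" "P (iso_verts h)" by blast
  let ?f = "iso_verts h"
  have E': "pverts E = ?f ` pverts D" "parcs E = iso_arcs h ` parcs D" "fst = iso_tail h" "snd = iso_head h"
    using h(2) by (auto simp: with_proj_def app_iso_def)
  have inj: "inj_on ?f (pverts D)"
    and arc: "\<And>a. a \<in> parcs D \<Longrightarrow> iso_arcs h a = (?f (fst a), ?f (snd a))"
    using h(1) by (auto simp: pre_digraph.digraph_isomorphism_def prod_eq_iff simp flip: E')
  have "(u, v) \<in> parcs D \<longleftrightarrow> (?f u, ?f v) \<in> parcs E" if "u \<in> pverts D" "v \<in> pverts D" for u v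
  proof
    assume "(u, v) \<in> parcs D"
    then show "(?f u, ?f v) \<in> parcs E" using arc[of "(u, v)"] by (force simp: E'(2))
  next
    assume "(?f u, ?f v) \<in> parcs E"
    then obtain a where a: "a \<in> parcs D" "(?f u, ?f v) = iso_arcs h a" by (auto simp: E'(2))
    then have "?f u = ?f (fst a)" "?f v = ?f (snd a)" using arc by auto
    moreover have "fst a \<in> pverts D" "snd a \<in> pverts D" using a D by auto
    ultimately have "a = (u, v)" using inj that by (simp add: inj_on_eq_iff prod_eq_iff)
    then show "(u, v) \<in> parcs D" using a by simp
  qed
  then show ?R using inj h(3) E'(1) by (auto simp: bij_betw_def intro!: exI[of _ ?f])
next
  assume ?R
  then obtain f where f: "bij_betw f (pverts D) (pverts E)" "P f"
    "\<And>u v. u \<in> pverts D \<Longrightarrow> v \<in> pverts D \<Longrightarrow> (u, v) \<in> parcs D \<longleftrightarrow> (f u, f v) \<in> parcs E" by blast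
  define h where "h = \<lparr>iso_verts = f, iso_arcs = map_prod f f, iso_head = snd, iso_tail = fst\<rparr>"
  have img: "f ` pverts D = pverts E" and inj: "inj_on f (pverts D)" using f(1) by (auto simp: bij_betw_def)
  have "inj_on (map_prod f f) (parcs D)"
    using D inj map_prod_inj_on[OF inj inj] inj_on_subset by blast
  moreover have "wf_digraph (with_proj D)" using D by unfold_locales auto
  ultimately have "pre_digraph.digraph_isomorphism (with_proj D) h"
    using inj by (simp add: pre_digraph.digraph_isomorphism_def h_def)
  moreover have "parcs E = map_prod f f ` parcs D"
  proof (intro equalityI subsetI)
    fix a assume a: "a \<in> parcs E"
    then have "fst a \<in> f ` pverts D" "snd a \<in> f ` pverts D" using E unfolding img by auto
    then obtain u v where uv: "u \<in> pverts D" "v \<in> pverts D" "fst a = f u" "snd a = f v" by blast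
    then have "(u, v) \<in> parcs D" using a f(3) by (metis prod.collapse)
    moreover have "a = map_prod f f (u, v)" using uv by (simp add: prod_eq_iff)
    ultimately show "a \<in> map_prod f f ` parcs D" by blast
  next
    fix a assume "a \<in> map_prod f f ` parcs D"
    then show "a \<in> parcs E" using D f(3) by auto
  qed
  then have "with_proj E = app_iso h (with_proj D)" by (simp add: with_proj_def app_iso_def h_def img)
  ultimately show ?L using f(2) by (auto simp: h_def intro!: exI[of _ h])
qed

lemma digraph_iso_with_proj_iff:
  assumes "A \<subseteq> V \<times> V" "B \<subseteq> W \<times> W"
  shows "digraph_iso (with_proj \<lparr>pverts = V, parcs = A\<rparr>) (with_proj \<lparr>pverts = W, parcs = B\<rparr>) \<longleftrightarrow>
    (\<exists>f. bij_betw f V W \<and> (\<forall>u\<in>V. \<forall>v\<in>V. (u, v) \<in> A \<longleftrightarrow> (f u, f v) \<in> B))"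
  using with_proj_isomorphism_iff[of "\<lparr>pverts = V, parcs = A\<rparr>" "\<lparr>pverts = W, parcs = B\<rparr>" "\<lambda>_. True"] assms
  by (simp add: digraph_iso_def)

lemma vertex_weighted_digraph_iso_with_proj_iff:
  assumes "A \<subseteq> V \<times> V" "B \<subseteq> W \<times> W"
  shows "vertex_weighted_digraph_iso (with_proj \<lparr>pverts = V, parcs = A\<rparr>) w
      (with_proj \<lparr>pverts = W, parcs = B\<rparr>) w' \<longleftrightarrow>
    (\<exists>f. bij_betw f V W \<and> (\<forall>u\<in>V. \<forall>v\<in>V. (u, v) \<in> A \<longleftrightarrow> (f u, f v) \<in> B) \<and> (\<forall>v\<in>V. w' (f v) = w v))"
  using with_proj_isomorphism_iff[of "\<lparr>pverts = V, parcs = A\<rparr>" "\<lparr>pverts = W, parcs = B\<rparr>"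
    "\<lambda>f. \<forall>v\<in>V. w' (f v) = w v"] assms
  by (simp add: vertex_weighted_digraph_iso_def)

definition directed_power_iso ::
  "('a \<Rightarrow> 'b) \<Rightarrow> ('a, 'm) monoid_scheme \<Rightarrow> ('b, 'n) monoid_scheme \<Rightarrow> bool" where
  "directed_power_iso f G H \<longleftrightarrow> bij_betw f (carrier G) (carrier H) \<and>
     (\<forall>x\<in>carrier G. \<forall>y\<in>carrier G. x \<in> cyc G y \<longleftrightarrow> f x \<in> cyc H (f y))"

lemma (in group) subgroup_int_pow:
  assumes "subgroup C G" "x \<in> C"
  shows "x [^]\<^bsub>G\<lparr>carrier := C\<rparr>\<^esub> (k::int) = x [^] k"
  using int_pow_consistent[OF assms] by simp

lemma (in fin_group) cyclic_subgroups_eq: "cyclic_subgroups G = cyc G ` carrier G"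
proof (intro equalityI subsetI)
  fix C assume "C \<in> cyclic_subgroups G"
  then have C: "subgroup C G" "cyclic_group (G\<lparr>carrier := C\<rparr>)" by (auto simp: cyclic_subgroups_def)
  then obtain x where x: "x \<in> C" "C = range (\<lambda>k::int. x [^]\<^bsub>G\<lparr>carrier := C\<rparr>\<^esub> k)"
    using group.cyclic_group[OF subgroup_imp_group[OF C(1)]] by auto
  have "C = cyc G x" using x subgroup_int_pow[OF C(1) x(1)] by (simp add: cyc_def)
  then show "C \<in> cyc G ` carrier G" using x C subgroup.subset by blast
next
  fix C assume "C \<in> cyc G ` carrier G"
  then obtain x where x: "x \<in> carrier G" "C = cyc G x" by blast
  then have sub: "subgroup C G" by (simp add: cyc_eq_generate generate_is_subgroup)
  have xC: "x \<in> C" using x self_in_cyc by blast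
  have "C = range (\<lambda>k::int. x [^]\<^bsub>G\<lparr>carrier := C\<rparr>\<^esub> k)"
    using x(2) subgroup_int_pow[OF sub xC] by (simp add: cyc_def)
  then have "cyclic_group (G\<lparr>carrier := C\<rparr>)"
    using group.cyclic_group[OF subgroup_imp_group[OF sub]] xC by auto
  then show "C \<in> cyclic_subgroups G" using sub by (simp add: cyclic_subgroups_def)
qed

locale fin_group_pair = G: fin_group G + H: fin_group H
  for G :: "'a monoid" and H :: "'b monoid"
begin

lemma sim3_iff:
  "sim3 G H \<longleftrightarrow> (\<exists>F. bij_betw F (cyclic_subgroups G) (cyclic_subgroups H) \<and>
     (\<forall>C\<in>cyclic_subgroups G. \<forall>D\<in>cyclic_subgroups G. D \<subset> C \<longleftrightarrow> F D \<subset> F C) \<and>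
     (\<forall>C\<in>cyclic_subgroups G. card (F C) = card C))"
  unfolding sim3_def cyclic_subgroup_digraph_def
proof (subst vertex_weighted_digraph_iso_with_proj_iff)
qed (auto simp add: bij_betw_apply simp del: psubset_eq cong: conj_cong)

lemma sim4_iff:
  "sim4 G H \<longleftrightarrow> (\<exists>f. bij_betw f (carrier G) (carrier H) \<and>
     (\<forall>x\<in>carrier G. \<forall>y\<in>carrier G. x \<in> cyc G y \<or> y \<in> cyc G x \<longleftrightarrow> f x \<in> cyc H (f y) \<or> f y \<in> cyc H (f x)))"
proof -
  have "(x \<noteq> y \<and> (x \<in> cyc G y \<or> y \<in> cyc G x) \<longleftrightarrow> f x \<noteq> f y \<and> (f x \<in> cyc H (f y) \<or> f y \<in> cyc H (f x)))
    \<longleftrightarrow> (x \<in> cyc G y \<or> y \<in> cyc G x \<longleftrightarrow> f x \<in> cyc H (f y) \<or> f y \<in> cyc H (f x))"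
    if "bij_betw f (carrier G) (carrier H)" "x \<in> carrier G" "y \<in> carrier G" for f x y
  proof -
    have "f x \<in> cyc H (f x)" using that bij_betw_apply H.self_in_cyc by metis
    moreover have "f x = f y \<longleftrightarrow> x = y" using that by (auto simp: bij_betw_def inj_on_eq_iff)
    ultimately show ?thesis using that(2) G.self_in_cyc by auto
  qed
  moreover have "sim4 G H \<longleftrightarrow> (\<exists>f. bij_betw f (carrier G) (carrier H) \<and>
     (\<forall>x\<in>carrier G. \<forall>y\<in>carrier G. x \<noteq> y \<and> (x \<in> cyc G y \<or> y \<in> cyc G x) \<longleftrightarrow>
        f x \<noteq> f y \<and> (f x \<in> cyc H (f y) \<or> f y \<in> cyc H (f x))))"
    unfolding sim4_def power_graph_def cyc_def
  proof (subst digraph_iso_with_proj_iff)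
  qed (auto simp: bij_betw_apply image_iff ex_disj_distrib simp del: ex_simps cong: conj_cong)
  ultimately show ?thesis by (simp cong: conj_cong)
qed

lemma sim5_iff:
  "sim5 G H \<longleftrightarrow> (\<forall>t::int. \<exists>f. bij_betw f (carrier G) (carrier H) \<and>
     (\<forall>x\<in>carrier G. f (x [^]\<^bsub>G\<^esub> t) = f x [^]\<^bsub>H\<^esub> t))"
proof -
  have "digraph_iso (power_map_digraph t G) (power_map_digraph t H) \<longleftrightarrow>
    (\<exists>f. bij_betw f (carrier G) (carrier H) \<and> (\<forall>x\<in>carrier G. f (x [^]\<^bsub>G\<^esub> t) = f x [^]\<^bsub>H\<^esub> t))" for t :: int
  proof -
    have "(\<forall>u\<in>carrier G. \<forall>v\<in>carrier G. (u, v) \<in> (\<lambda>g. (g, g [^]\<^bsub>G\<^esub> t)) ` carrier G \<longleftrightarrow>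
         (f u, f v) \<in> (\<lambda>g. (g, g [^]\<^bsub>H\<^esub> t)) ` carrier H) \<longleftrightarrow>
       (\<forall>x\<in>carrier G. f (x [^]\<^bsub>G\<^esub> t) = f x [^]\<^bsub>H\<^esub> t)"
      (is "?A \<longleftrightarrow> ?B") if f: "bij_betw f (carrier G) (carrier H)" for f
    proof -
      have "(u, v) \<in> (\<lambda>g. (g, g [^]\<^bsub>G\<^esub> t)) ` carrier G \<longleftrightarrow> v = u [^]\<^bsub>G\<^esub> t" if "u \<in> carrier G" for u v
        using that by auto
      moreover have "(f u, f v) \<in> (\<lambda>g. (g, g [^]\<^bsub>H\<^esub> t)) ` carrier H \<longleftrightarrow> f v = f u [^]\<^bsub>H\<^esub> t"
        if "u \<in> carrier G" for u v
        using that f bij_betw_apply[OF f] by auto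
      ultimately have "?A \<longleftrightarrow> (\<forall>u\<in>carrier G. \<forall>v\<in>carrier G. v = u [^]\<^bsub>G\<^esub> t \<longleftrightarrow> f v = f u [^]\<^bsub>H\<^esub> t)" by simp
      also have "\<dots> \<longleftrightarrow> ?B"
      proof (rule iffI; intro ballI)
        fix x assume "\<forall>u\<in>carrier G. \<forall>v\<in>carrier G. v = u [^]\<^bsub>G\<^esub> t \<longleftrightarrow> f v = f u [^]\<^bsub>H\<^esub> t" "x \<in> carrier G"
        then show "f (x [^]\<^bsub>G\<^esub> t) = f x [^]\<^bsub>H\<^esub> t" using G.int_pow_closed by blast
      next
        fix u v assume B: ?B and uv: "u \<in> carrier G" "v \<in> carrier G"
        have "inj_on f (carrier G)" using f by (simp add: bij_betw_def)
        then have "v = u [^]\<^bsub>G\<^esub> t \<longleftrightarrow> f v = f (u [^]\<^bsub>G\<^esub> t)" using uv by (simp add: inj_on_eq_iff)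
        then show "v = u [^]\<^bsub>G\<^esub> t \<longleftrightarrow> f v = f u [^]\<^bsub>H\<^esub> t" using B uv by simp
      qed
      finally show ?thesis .
    qed
    note * = this
    show ?thesis
      unfolding power_map_digraph_def
      using * by (subst digraph_iso_with_proj_iff) (auto cong: conj_cong)
  qed
  then show ?thesis by (simp add: sim5_def)
qed

lemma sim2_imp_directed_power_iso:
  assumes f: "bij_betw f (carrier G) (carrier H)"
    and pow: "\<And>x t. x \<in> carrier G \<Longrightarrow> f (x [^]\<^bsub>G\<^esub> (t::int)) = f x [^]\<^bsub>H\<^esub> t"
  shows "directed_power_iso f G H"
proof -
  have "x \<in> cyc G y \<longleftrightarrow> f x \<in> cyc H (f y)" if "x \<in> carrier G" "y \<in> carrier G" for x y
  proof -
    have "x = y [^]\<^bsub>G\<^esub> t \<longleftrightarrow> f x = f y [^]\<^bsub>H\<^esub> t" for t :: int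
      using that f pow[OF that(2), of t] inj_on_eq_iff[of f "carrier G" x "y [^]\<^bsub>G\<^esub> t"]
      by (auto simp: bij_betw_def)
    then show ?thesis by (auto simp: cyc_def image_iff)
  qed
  then show ?thesis using f by (simp add: directed_power_iso_def)
qed

lemma directed_power_iso_image_cyc:
  assumes f: "directed_power_iso f G H" and x: "x \<in> carrier G"
  shows "f ` cyc G x = cyc H (f x)"
proof -
  have bij: "bij_betw f (carrier G) (carrier H)" and
    iff: "\<And>y. y \<in> carrier G \<Longrightarrow> y \<in> cyc G x \<longleftrightarrow> f y \<in> cyc H (f x)"
    using f x by (auto simp: directed_power_iso_def)
  have "y \<in> f ` cyc G x" if "y \<in> cyc H (f x)" for y
  proof -
    have "y \<in> carrier H" using that H.in_cyc_carrier bij_betw_apply[OF bij x] by blast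
    then obtain z where "z \<in> carrier G" "y = f z" using bij by (auto simp: bij_betw_def)
    then show ?thesis using that iff by auto
  qed
  then show ?thesis using G.in_cyc_carrier[OF _ x] iff by auto
qed

lemma directed_power_iso_ord:
  assumes f: "directed_power_iso f G H" and x: "x \<in> carrier G"
  shows "H.ord (f x) = G.ord x"
proof -
  have bij: "bij_betw f (carrier G) (carrier H)" using f by (simp add: directed_power_iso_def)
  have "inj_on f (cyc G x)"
    using bij G.cyc_carrier[OF x] by (auto simp: bij_betw_def intro: inj_on_subset)
  then have "card (cyc H (f x)) = card (cyc G x)"
    using directed_power_iso_image_cyc[OF f x] card_image by metis
  then show ?thesis using G.card_cyc[OF x] H.card_cyc[OF bij_betw_apply[OF bij x]] by simp
qed

lemma directed_power_iso_imp_sim3: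
  assumes f: "directed_power_iso f G H"
  shows "sim3 G H"
proof -
  have bij: "bij_betw f (carrier G) (carrier H)" using f by (simp add: directed_power_iso_def)
  have sub: "C \<subseteq> carrier G" if "C \<in> cyclic_subgroups G" for C
    using that by (auto simp: cyclic_subgroups_def dest: subgroup.subset)
  have inj: "inj_on f (carrier G)" and img: "f ` carrier G = carrier H"
    using bij by (auto simp: bij_betw_def)
  have "image f ` cyclic_subgroups G = cyclic_subgroups H"
    unfolding G.cyclic_subgroups_eq H.cyclic_subgroups_eq img[symmetric] image_image
    using directed_power_iso_image_cyc[OF f] by (intro image_cong) auto
  moreover have "inj_on (image f) (cyclic_subgroups G)"
    using inj_on_image_Pow[OF inj] by (rule inj_on_subset) (use sub in blast)
  ultimately have "bij_betw (image f) (cyclic_subgroups G) (cyclic_subgroups H)"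
    by (simp add: bij_betw_def)
  moreover have "D \<subset> C \<longleftrightarrow> f ` D \<subset> f ` C" if "C \<in> cyclic_subgroups G" "D \<in> cyclic_subgroups G" for C D
  proof -
    have "D \<subseteq> C \<longleftrightarrow> f ` D \<subseteq> f ` C" "C \<subseteq> D \<longleftrightarrow> f ` C \<subseteq> f ` D"
      using inj sub[OF that(1)] sub[OF that(2)] unfolding inj_on_def by blast+
    then show ?thesis by (simp add: less_le_not_le)
  qed
  moreover have "card (f ` C) = card C" if "C \<in> cyclic_subgroups G" for C
    using sub[OF that] inj by (meson card_image inj_on_subset)
  ultimately show ?thesis unfolding sim3_iff by blast
qed

text \<open>
  Corresponding cyclic subgroups have equal order, hence equally many generators; a bijection that
  sends the generators of each subgroup to those of its image is directed, because \<open>x\<close>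
  is a power of \<open>y\<close> iff the subgroup of \<open>x\<close> is contained in that of
  \<open>y\<close>.
\<close>

lemma sim3_imp_directed_power_iso:
  assumes "sim3 G H"
  obtains f where "directed_power_iso f G H"
proof -
  obtain F where F': "bij_betw F (cyclic_subgroups G) (cyclic_subgroups H)"
    "\<forall>C\<in>cyclic_subgroups G. \<forall>D\<in>cyclic_subgroups G. D \<subset> C \<longleftrightarrow> F D \<subset> F C"
    "\<forall>C\<in>cyclic_subgroups G. card (F C) = card C"
    using assms unfolding sim3_iff by (elim exE conjE)
  note F = F'(1) F'(2)[rule_format] F'(3)[rule_format]
  have cG: "cyc G x \<in> cyclic_subgroups G" if "x \<in> carrier G" for x
    using that by (simp add: G.cyclic_subgroups_eq)
  have injF: "inj_on F (cyclic_subgroups G)" using F(1) by (simp add: bij_betw_def)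
  have "card {x \<in> carrier G. F (cyc G x) = l} = card {y \<in> carrier H. cyc H y = l}" for l
  proof (cases "l \<in> cyclic_subgroups H")
    case True
    then obtain C where C: "C \<in> cyclic_subgroups G" "l = F C" using F(1) by (auto simp: bij_betw_def)
    then obtain x0 where x0: "x0 \<in> carrier G" "C = cyc G x0" by (auto simp: G.cyclic_subgroups_eq)
    obtain y0 where y0: "y0 \<in> carrier H" "l = cyc H y0" using True by (auto simp: H.cyclic_subgroups_eq)
    have "G.ord x0 = H.ord y0"
      using F(3)[OF C(1)] C(2) x0(2) y0(2) G.card_cyc[OF x0(1)] H.card_cyc[OF y0(1)] by simp
    moreover have "{x \<in> carrier G. F (cyc G x) = l} = {x \<in> carrier G. cyc G x = cyc G x0}"
      using C x0 cG injF by (auto simp: inj_on_eq_iff)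
    ultimately show ?thesis using G.card_generators[OF x0(1)] H.card_generators[OF y0(1)] y0(2) by simp
  next
    case False
    have "F (cyc G x) \<noteq> l" if "x \<in> carrier G" for x
      using False cG[OF that] F(1) bij_betw_apply by metis
    moreover have "cyc H y \<noteq> l" if "y \<in> carrier H" for y
      using False that by (auto simp: H.cyclic_subgroups_eq)
    ultimately have "{x \<in> carrier G. F (cyc G x) = l} = {}" "{y \<in> carrier H. cyc H y = l} = {}"
      by blast+
    then show ?thesis by (simp only: card.empty)
  qed
  then obtain f where f: "bij_betw f (carrier G) (carrier H)"
    "\<And>x. x \<in> carrier G \<Longrightarrow> cyc H (f x) = F (cyc G x)"
    using bij_betw_matching_labels[OF G.finite_carrier H.finite_carrier, of "\<lambda>x. F (cyc G x)" "cyc H"] by metis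
  have "x \<in> cyc G y \<longleftrightarrow> f x \<in> cyc H (f y)" if x: "x \<in> carrier G" and y: "y \<in> carrier G" for x y
  proof -
    have fx: "f x \<in> carrier H" "f y \<in> carrier H" using x y f(1) bij_betw_apply by metis+
    have "x \<in> cyc G y \<longleftrightarrow> cyc G x \<subseteq> cyc G y" using x y G.cyc_mono G.self_in_cyc by blast
    also have "\<dots> \<longleftrightarrow> cyc G x \<subset> cyc G y \<or> cyc G x = cyc G y" by blast
    also have "\<dots> \<longleftrightarrow> cyc H (f x) \<subset> cyc H (f y) \<or> cyc H (f x) = cyc H (f y)"
      using F(2)[OF cG[OF y] cG[OF x]] inj_on_eq_iff[OF injF cG[OF x] cG[OF y]] f(2) x y by simp
    also have "\<dots> \<longleftrightarrow> cyc H (f x) \<subseteq> cyc H (f y)" by blast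
    also have "\<dots> \<longleftrightarrow> f x \<in> cyc H (f y)" using fx H.cyc_mono H.self_in_cyc by blast
    finally show ?thesis .
  qed
  then show ?thesis using that f(1) by (auto simp: directed_power_iso_def)
qed

lemma directed_power_iso_imp_sim4:
  assumes "directed_power_iso f G H" shows "sim4 G H"
  using assms unfolding sim4_iff directed_power_iso_def by blast

lemma sim2_imp_sim5: "sim2 G H \<Longrightarrow> sim5 G H"
  unfolding sim2_def sim5_iff by blast

lemma directed_power_iso_imp_sim6:
  assumes f: "directed_power_iso f G H" shows "sim6 G H"
proof -
  have bij: "bij_betw f (carrier G) (carrier H)" using f by (simp add: directed_power_iso_def)
  have "order_multiset H = image_mset H.ord (image_mset f (mset_set (carrier G)))"
    using bij by (simp add: order_multiset_def bij_betw_def image_mset_mset_set)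
  also have "\<dots> = order_multiset G"
    unfolding order_multiset_def multiset.map_comp
    by (rule image_mset_cong) (simp add: directed_power_iso_ord[OF f])
  finally show ?thesis by (simp add: sim6_def)
qed

lemma sim1_imp_sim2:
  assumes "sim1 G H" shows "sim2 G H"
proof -
  obtain f where f: "f \<in> iso G H" using assms by (auto simp: sim1_def is_iso_def)
  then have "f (g [^]\<^bsub>G\<^esub> t) = f g [^]\<^bsub>H\<^esub> t" if "g \<in> carrier G" for g and t :: int
    using that hom_int_pow[OF _ that G.group_axioms H.group_axioms] by (auto simp: iso_def)
  then show ?thesis using f by (auto simp: sim2_def iso_def)
qed

end

locale nilpotent_fin_group_pair = G: nilpotent_fin_group G + H: nilpotent_fin_group H
  for G :: "'a monoid" and H :: "'b monoid"

sublocale nilpotent_fin_group_pair \<subseteq> fin_group_pair by unfold_locales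

section \<open>Power graphs\<close>

lemma Collect_image_iff:
  assumes "\<And>z. z \<in> A \<Longrightarrow> Q (f z) \<longleftrightarrow> P z"
  shows "{w \<in> f ` A. Q w} = f ` {z \<in> A. P z}"
  using assms by auto

text \<open>
  The closed neighbourhood of \<open>x\<close> in the power graph. Twins are elements with the same
  closed neighbourhood.
\<close>

definition power_nbhd :: "('a, 'm) monoid_scheme \<Rightarrow> 'a \<Rightarrow> 'a set" where
  "power_nbhd G x = {z \<in> carrier G. z \<in> cyc G x \<or> x \<in> cyc G z}"

text \<open>
  If \<open>y\<close> is a power of \<open>x\<close> of smaller order, this yields an element of
  prime power order below \<open>x\<close> that is not below \<open>y\<close>.
\<close>

lemma proper_dvd_prime_power:
  fixes d m :: nat
  assumes "d dvd m" "d \<noteq> m" "0 < m"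
  obtains r v where "prime r" "r ^ v dvd m" "\<not> r ^ v dvd d"
proof -
  obtain k where k: "m = d * k" using assms by auto
  then have "k \<noteq> 1" "0 < d" using assms by auto
  then obtain r where r: "prime r" "r dvd k" using prime_factor_nat by blast
  define v where "v = multiplicity r m"
  have "\<not> r ^ v dvd d"
  proof
    assume "r ^ v dvd d"
    then have "r ^ v * r dvd m" using r k by (simp add: mult_dvd_mono)
    then have "r ^ Suc v dvd m" by (simp add: mult.commute)
    then have "Suc v \<le> multiplicity r m"
      using assms(3) r(1) by (intro multiplicity_geI) auto
    then show False by (simp add: v_def)
  qed
  then show ?thesis using that r(1) multiplicity_dvd[of r m] by (simp add: v_def)
qed

text \<open>
  The totient decreases along divisibility, and \<open>\<phi>(d) = \<phi>(m)\<close> for a proper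
  divisor \<open>d\<close> of \<open>m\<close> only if \<open>m = 2d\<close> with \<open>d\<close>
  odd. So the numbers of generators determine which of two comparable elements is a power of the
  other, up to this exception.
\<close>

lemma totient_le_imp_double:
  fixes d m :: nat
  assumes "d dvd m" "d \<noteq> m" "0 < m" and le: "totient m \<le> totient d"
  shows "m = 2 * d" "odd d"
proof -
  obtain k where k: "m = d * k" using assms by auto
  have d0: "0 < d" and k0: "0 < k" "k \<noteq> 1" using assms k by auto
  define g where "g = gcd d k"
  have g0: "0 < g" using d0 by (simp add: g_def)
  have "totient d * totient k * g = totient m * totient g"
    using totient_gcd[of d k] by (simp add: k g_def)
  also have "\<dots> \<le> totient d * g" using le totient_le[of g] by (rule mult_le_mono)
  finally have "totient k \<le> 1" using g0 d0 by simp
  then have "\<not> 2 < k" using totient_gt_1[of k] by auto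
  then have "k = 2" using k0 by simp
  then show m: "m = 2 * d" using k by simp
  show "odd d"
  proof
    assume "even d"
    then have "2 * totient d \<le> totient d" using le m totient_double[of d] by simp
    then show False using d0 by simp
  qed
qed

lemma prime_power_or_two_primes:
  fixes n :: nat
  assumes "0 < n"
  obtains (prime_power) p k where "prime p" "n = p ^ k"
    | (two_primes) p q where "prime p" "prime q" "p \<noteq> q" "p dvd n" "q dvd n"
proof (cases "n = 1")
  case True
  then show ?thesis using prime_power[of 2 0] by simp
next
  case False
  then obtain p where p: "prime p" "p dvd n" using prime_factor_nat by blast
  then obtain m where m: "n = p ^ multiplicity p n * m" "\<not> p dvd m"
    using assms multiplicity_decompose'[of n p] by (metis not_prime_unit neq0_conv)
  show ?thesis
  proof (cases "m = 1")
    case True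
    then show ?thesis using prime_power[OF p(1)] m by simp
  next
    case False
    then obtain q where q: "prime q" "q dvd m" using prime_factor_nat by blast
    then have "q \<noteq> p" "q dvd n" using m by (auto, metis dvd_mult)
    then show ?thesis using two_primes p q by metis
  qed
qed

context fin_group
begin

lemma power_nbhd_sym: "x \<in> carrier G \<Longrightarrow> y \<in> carrier G \<Longrightarrow> x \<in> power_nbhd G y \<longleftrightarrow> y \<in> power_nbhd G x"
  by (auto simp: power_nbhd_def)

lemma self_in_power_nbhd: "x \<in> carrier G \<Longrightarrow> x \<in> power_nbhd G x"
  by (simp add: power_nbhd_def self_in_cyc)

lemma power_nbhd_carrier: "power_nbhd G x \<subseteq> carrier G"
  by (auto simp: power_nbhd_def)

text \<open>
  A bijection that preserves the power graph and the orders therefore preserves directions.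
\<close>

lemma in_cyc_iff_nbhd:
  assumes "x \<in> carrier G" "y \<in> carrier G"
  shows "x \<in> cyc G y \<longleftrightarrow> x \<in> power_nbhd G y \<and> ord x \<le> ord y"
proof
  assume x: "x \<in> cyc G y"
  then have "ord x \<le> ord y" using ord_dvd_of_in_cyc[OF assms(2) x] assms by (auto intro: dvd_imp_le)
  then show "x \<in> power_nbhd G y \<and> ord x \<le> ord y" using x assms by (simp add: power_nbhd_def)
next
  assume "x \<in> power_nbhd G y \<and> ord x \<le> ord y"
  then consider "x \<in> cyc G y" | "y \<in> cyc G x" "ord x \<le> ord y" by (auto simp: power_nbhd_def)
  then show "x \<in> cyc G y"
  proof cases
    case 2
    then have "cyc G y = cyc G x" using cyc_eqI[OF assms(1)] by blast
    then show ?thesis using self_in_cyc[OF assms(1)] by blast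
  qed
qed

lemma power_nbhd_cong:
  assumes "x \<in> carrier G" "y \<in> carrier G" "cyc G x = cyc G y"
  shows "power_nbhd G x = power_nbhd G y"
proof -
  have "x \<in> cyc G z \<longleftrightarrow> y \<in> cyc G z" if "z \<in> carrier G" for z
  proof -
    have "x \<in> cyc G y" "y \<in> cyc G x" using assms self_in_cyc by blast+
    then show ?thesis using cyc_trans that by blast
  qed
  then show ?thesis using assms(3) by (auto simp: power_nbhd_def)
qed

lemma power_nbhd_one: "power_nbhd G \<one> = carrier G"
  by (auto simp: power_nbhd_def one_in_cyc)

text \<open>
  In a group of prime power order, the subgroups of a cyclic group form a chain, so the closed
  neighbourhood of an element is contained in those of its powers. Hence, for \<open>m\<close> of
  maximal order in the class \<open>T\<close> of the twins of \<open>x\<close>, the group generated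
  by \<open>m\<close> is the disjoint union of \<open>T\<close> and of the set \<open>D\<close> of
  the neighbours with a larger neighbourhood, where \<open>D\<close> consists of the elements of
  this group whose order is at most \<open>card D\<close>. So the orders that occur in
  \<open>T\<close> are determined by the cardinalities of two sets that are defined by the graph.
\<close>

lemma card_twins_prime_power:
  assumes pp: "prime p" "order G = p ^ n" and x: "x \<in> carrier G"
  defines "T \<equiv> {t \<in> carrier G. power_nbhd G t = power_nbhd G x}"
    and "D \<equiv> {z \<in> power_nbhd G x. power_nbhd G x \<subset> power_nbhd G z}"
  shows "card {t \<in> T. ord t = k} =
    (if k \<le> card D then 0
     else card {i. i < card T + card D \<and> (card T + card D) div gcd (card T + card D) i = k})"
proof -
  let ?nb = "power_nbhd G"
  have ordpp: "\<exists>i. ord y = p ^ i" if "y \<in> carrier G" for y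
    using ord_dvd_group_order[OF that] pp by (auto simp: divides_primepow_nat)
  have anti: "?nb y \<subseteq> ?nb u" if u: "u \<in> cyc G y" and y: "y \<in> carrier G" for u y
  proof
    fix z assume z: "z \<in> ?nb y"
    then have zc: "z \<in> carrier G" by (auto simp: power_nbhd_def)
    show "z \<in> ?nb u"
    proof (cases "y \<in> cyc G z")
      case True
      then show ?thesis using u cyc_trans zc by (auto simp: power_nbhd_def)
    next
      case False
      then have zy: "z \<in> cyc G y" using z by (auto simp: power_nbhd_def)
      obtain i where "ord y = p ^ i" using ordpp y by blast
      then have "z \<in> cyc G u \<or> u \<in> cyc G z"
        using in_cyc_if_ord_le_prime_power[OF y zy u pp(1)] in_cyc_if_ord_le_prime_power[OF y u zy pp(1)]
        by (meson nat_le_linear)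
      then show ?thesis using zc by (auto simp: power_nbhd_def)
    qed
  qed
  have finT: "finite T" "x \<in> T" using x by (auto simp: T_def)
  then have "Max (ord ` T) \<in> ord ` T" by (intro Max_in) auto
  then obtain m where m: "m \<in> T" "ord m = Max (ord ` T)" by force
  have max: "ord t \<le> ord m" if "t \<in> T" for t using that m finT by simp
  have mc: "m \<in> carrier G" and nbm: "?nb m = ?nb x" using m by (auto simp: T_def)
  have Tm: "t \<in> cyc G m" if t: "t \<in> T" for t
  proof -
    have tc: "t \<in> carrier G" "?nb t = ?nb m" using t nbm by (auto simp: T_def)
    then have "t \<in> ?nb m" using self_in_power_nbhd[of t] by simp
    then show ?thesis using in_cyc_iff_nbhd[OF tc(1) mc] max t by simp
  qed
  have Dm: "z \<in> cyc G m" if z: "z \<in> D" for z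
  proof -
    have "z \<in> carrier G" "z \<in> ?nb m" "\<not> ?nb z \<subseteq> ?nb m" using z nbm by (auto simp: D_def power_nbhd_def)
    then show ?thesis using anti[of m z] by (auto simp: power_nbhd_def)
  qed
  have mTD: "z \<in> T \<union> D" if z: "z \<in> cyc G m" for z
  proof -
    have zc: "z \<in> carrier G" using z mc in_cyc_carrier by blast
    then have "?nb x \<subseteq> ?nb z" "z \<in> ?nb x"
      using anti[OF z mc] nbm z by (auto simp: power_nbhd_def)
    then show ?thesis using zc by (auto simp: T_def D_def)
  qed
  have TD: "T \<union> D = cyc G m" using Tm Dm mTD by blast
  have disj: "T \<inter> D = {}" by (auto simp: T_def D_def)
  have finD: "finite D" using TD finite_cyc[OF mc] by (metis finite_Un)
  have ordm: "ord m = card T + card D"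
    using card_Un_disjoint[OF finT(1) finD disj] TD card_cyc[OF mc] by simp
  have big: "card D < ord t" if t: "t \<in> T" for t
  proof -
    have tc: "t \<in> carrier G" "?nb t = ?nb x" using t by (auto simp: T_def)
    obtain i where i: "ord m = p ^ i" using ordpp mc by blast
    have "D \<subseteq> cyc G t"
    proof
      fix d assume d: "d \<in> D"
      have dc: "d \<in> carrier G" using Dm[OF d] mc in_cyc_carrier by blast
      have "t \<notin> cyc G d" using anti[of t d] dc d tc by (auto simp: D_def)
      then have "ord d \<le> ord t"
        using in_cyc_if_ord_le_prime_power[OF mc Tm[OF t] Dm[OF d] pp(1) i] by linarith
      then show "d \<in> cyc G t"
        using in_cyc_if_ord_le_prime_power[OF mc Dm[OF d] Tm[OF t] pp(1) i] by simp
    qed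
    moreover have "t \<notin> D" "t \<in> cyc G t" using t disj tc self_in_cyc by auto
    ultimately have "card D < card (cyc G t)"
      using psubset_card_mono[OF finite_cyc[OF tc(1)]] by blast
    then show ?thesis using card_cyc tc by simp
  qed
  have small: "ord d \<le> card D" if d: "d \<in> D" for d
  proof -
    have dc: "d \<in> carrier G" using Dm[OF d] mc in_cyc_carrier by blast
    have "cyc G d \<subseteq> D"
    proof
      fix z assume z: "z \<in> cyc G d"
      then have "z \<in> cyc G m" using Dm[OF d] cyc_trans mc by blast
      then have "z \<in> ?nb x" using nbm in_cyc_carrier mc by (auto simp: power_nbhd_def)
      moreover have "?nb d \<subseteq> ?nb z" using anti[OF z dc] .
      ultimately show "z \<in> D" using d by (auto simp: D_def)
    qed
    then show ?thesis using card_cyc[OF dc] card_mono[OF finD] by metis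
  qed
  show ?thesis
  proof (cases "k \<le> card D")
    case True
    then have "{t \<in> T. ord t = k} = {}" using big by force
    then show ?thesis using True by (simp only: card.empty if_True)
  next
    case False
    then have "{t \<in> T. ord t = k} = {z \<in> cyc G m. ord z = k}"
      using small TD by (auto dest: Tm mTD)
    then show ?thesis using False card_ord_in_cyc[OF mc, of k] by (simp add: ordm)
  qed
qed

lemma commuting_coprime_in_cyc:
  assumes x: "x \<in> carrier G" and y: "y \<in> carrier G" and eq: "x \<otimes> y = y \<otimes> x" and co: "coprime (ord x) (ord y)"
  shows "x \<in> cyc G (x \<otimes> y)"
proof -
  obtain u v where uv: "u * int (ord x) + v * int (ord y) = 1"
    using bezout_int[of "int (ord x)" "int (ord y)"] co by (auto simp: coprime_iff_gcd_eq_1)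
  have "(x \<otimes> y) [^] (v * int (ord y)) = x [^] (v * int (ord y)) \<otimes> y [^] (v * int (ord y))"
    using int_pow_mult_distrib[OF eq x y] .
  also have "y [^] (v * int (ord y)) = \<one>" using y int_pow_eq_id by simp
  also have "x [^] (v * int (ord y)) = x [^] (1::int)"
  proof -
    have "1 - v * int (ord y) = int (ord x) * u" using uv by (simp add: algebra_simps)
    then show ?thesis using int_pow_eq[OF x] by simp
  qed
  finally have "(x \<otimes> y) [^] (v * int (ord y)) = x" using x by simp
  then show ?thesis using pow_in_cyc by metis
qed

end

text \<open>
  Let \<open>y\<close> be a twin of \<open>x\<close> with smaller order. An element of prime power
  order \<open>r ^ v\<close> that is a power of \<open>x\<close> but not of \<open>y\<close> is a
  neighbour of \<open>y\<close>, which forces \<open>y\<close> to have \<open>r\<close>-power order.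
  An element \<open>u\<close> of another prime order \<open>s\<close> then gives a contradiction: if
  \<open>s\<close> divides the order of \<open>x\<close>, a power \<open>u\<close> of
  \<open>x\<close> is not a neighbour of \<open>y\<close>; otherwise \<open>y \<otimes> u\<close> is
  a neighbour of \<open>y\<close> but not of \<open>x\<close>.
\<close>

lemma (in nilpotent_fin_group) twins_same_cyc:
  assumes pq: "prime p" "prime q" "p \<noteq> q" "p dvd order G" "q dvd order G"
    and x: "x \<in> carrier G" and y: "y \<in> cyc G x" "y \<noteq> \<one>"
    and nb: "power_nbhd G x = power_nbhd G y"
  shows "cyc G y = cyc G x"
proof (rule ccontr)
  assume ne: "cyc G y \<noteq> cyc G x"
  have yc: "y \<in> carrier G" using x y in_cyc_carrier by blast
  have dvd: "ord y dvd ord x" using ord_dvd_of_in_cyc x y by blast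
  have neq: "ord y \<noteq> ord x" using ne cyc_eqI[OF x y(1)] by auto
  obtain r v where r: "prime r" "r ^ v dvd ord x" "\<not> r ^ v dvd ord y"
    using proper_dvd_prime_power[OF dvd neq ord_pos[OF x]] .
  obtain z where z: "z \<in> cyc G x" "ord z = r ^ v" using exists_ord_in_cyc[OF x r(2)] .
  have zc: "z \<in> carrier G" using z x in_cyc_carrier by blast
  have "z \<in> power_nbhd G y" unfolding nb[symmetric] using z zc by (simp add: power_nbhd_def)
  moreover have "z \<notin> cyc G y" using ord_dvd_of_in_cyc[OF yc, of z] z r(3) by auto
  ultimately have "y \<in> cyc G z" by (simp add: power_nbhd_def)
  then have "ord y dvd r ^ v" using ord_dvd_of_in_cyc[OF zc] z by auto
  then obtain i where i: "ord y = r ^ i" using r(1) by (auto simp: divides_primepow_nat)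
  have y1: "ord y \<noteq> 1" using y(2) yc ord_eq_1 by blast
  then have ry: "r dvd ord y" using i by (cases i) auto
  obtain s where s: "prime s" "s \<noteq> r" "s dvd order G" using pq by (metis (full_types))
  have s_r: "\<not> s dvd ord y" using i s r(1) by (metis prime_dvd_power primes_dvd_imp_eq)
  have r_s: "\<not> ord y dvd s" using ry s r(1) by (metis dvd_trans primes_dvd_imp_eq)
  show False
  proof (cases "s dvd ord x")
    case True
    then obtain w where w: "w \<in> cyc G x" "ord w = s" using exists_ord_in_cyc[OF x] by blast
    have wc: "w \<in> carrier G" using w x in_cyc_carrier by blast
    have "w \<in> power_nbhd G y" unfolding nb[symmetric] using w wc by (simp add: power_nbhd_def)
    then show False
      using ord_dvd_of_in_cyc[OF yc, of w] ord_dvd_of_in_cyc[OF wc, of y] w s_r r_s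
      by (auto simp: power_nbhd_def)
  next
    case False
    obtain u where u: "u \<in> carrier G" "ord u = s" using exists_ord_prime[OF s(1,3)] .
    have co: "coprime (ord y) (ord u)" using s_r s(1) u by (metis coprime_commute prime_imp_coprime)
    have eq: "y \<otimes> u = u \<otimes> y" using coprime_ord_commute[OF yc u(1) co] .
    define w where "w = y \<otimes> u"
    have wc: "w \<in> carrier G" using yc u by (simp add: w_def)
    have yw: "y \<in> cyc G w" using commuting_coprime_in_cyc[OF yc u(1) eq co] by (simp add: w_def)
    have uw: "u \<in> cyc G w"
      using commuting_coprime_in_cyc[OF u(1) yc eq[symmetric]] co by (simp add: w_def eq ac_simps)
    have "w \<in> power_nbhd G x" using yw wc nb by (simp add: power_nbhd_def)
    moreover have "w \<notin> cyc G x"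
      using uw cyc_trans[OF uw _ x] ord_dvd_of_in_cyc[OF x, of u] False u by auto
    ultimately have "x \<in> cyc G w" by (simp add: power_nbhd_def)
    then have "ord x dvd ord w" using ord_dvd_of_in_cyc[OF wc] by blast
    also have "ord w dvd ord y * s" using ord_mul_divides[OF eq yc u(1)] u by (simp add: w_def)
    finally have "ord x dvd ord y * s" .
    moreover have "coprime (ord x) s" using False s(1) by (metis coprime_commute prime_imp_coprime)
    ultimately have "ord x dvd ord y" by (simp add: coprime_dvd_mult_left_iff)
    then show False using dvd neq by (simp add: dvd_antisym)
  qed
qed

text \<open>
  An element that is comparable to all others has an order divisible by every prime divisor of the
  group order. If it were a power of an element \<open>g\<close> of larger order, it would not be
  comparable to a suitable power of \<open>g\<close> of prime power order.
\<close>

lemma (in fin_group) dominating_imp_cyclic: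
  assumes pq: "prime p" "prime q" "p \<noteq> q" "p dvd order G" "q dvd order G"
    and x: "x \<in> carrier G" "x \<noteq> \<one>" and dom: "power_nbhd G x = carrier G"
  shows "carrier G = cyc G x"
proof (rule ccontr)
  assume "carrier G \<noteq> cyc G x"
  then obtain g where g: "g \<in> carrier G" "g \<notin> cyc G x" using cyc_carrier[OF x(1)] by blast
  then have xg: "x \<in> cyc G g" using dom by (auto simp: power_nbhd_def)
  have x1: "ord x \<noteq> 1" using x ord_eq_1 by blast
  have all: "r dvd ord x" if r: "prime r" "r dvd order G" for r
  proof -
    obtain z where z: "z \<in> carrier G" "ord z = r" using exists_ord_prime[OF r] .
    then have "z \<in> power_nbhd G x" using dom by simp
    then have "r dvd ord x \<or> ord x dvd r"
      using ord_dvd_of_in_cyc[OF x(1), of z] ord_dvd_of_in_cyc[OF z(1), of x] z by (auto simp: power_nbhd_def)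
    then show ?thesis using x1 r(1) by (auto simp: prime_nat_iff)
  qed
  have dvd: "ord x dvd ord g" using ord_dvd_of_in_cyc g xg by blast
  have "ord x \<noteq> ord g" using cyc_eqI[OF g(1) xg] g self_in_cyc by auto
  then obtain r v where r: "prime r" "r ^ v dvd ord g" "\<not> r ^ v dvd ord x"
    using proper_dvd_prime_power[OF dvd _ ord_pos[OF g(1)]] by blast
  obtain z where z: "z \<in> cyc G g" "ord z = r ^ v" using exists_ord_in_cyc[OF g(1) r(2)] .
  have zc: "z \<in> carrier G" using z g in_cyc_carrier by blast
  then have "z \<in> power_nbhd G x" using dom by simp
  moreover have "z \<notin> cyc G x" using ord_dvd_of_in_cyc[OF x(1), of z] z r(3) by auto
  ultimately have "x \<in> cyc G z" by (simp add: power_nbhd_def)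
  then have "ord x dvd r ^ v" using ord_dvd_of_in_cyc[OF zc] z by auto
  then have "p dvd r ^ v" "q dvd r ^ v" using all pq dvd_trans by blast+
  then have "p = r" "q = r" using pq(1,2) r(1) by (metis prime_dvd_power primes_dvd_imp_eq)+
  then show False using pq by simp
qed

context fin_group_pair
begin

lemma comparability_iso_image_nbhd:
  assumes f: "bij_betw f (carrier G) (carrier H)"
    and comp': "\<forall>x\<in>carrier G. \<forall>y\<in>carrier G. x \<in> power_nbhd G y \<longleftrightarrow> f x \<in> power_nbhd H (f y)"
    and x: "x \<in> carrier G"
  shows "power_nbhd H (f x) = f ` power_nbhd G x"
proof (intro equalityI subsetI)
  note comp = comp'[rule_format]
  fix y assume y: "y \<in> power_nbhd H (f x)"
  then have "y \<in> carrier H" by (simp add: power_nbhd_def)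
  then obtain z where z: "z \<in> carrier G" "y = f z" using f by (auto simp: bij_betw_def)
  then show "y \<in> f ` power_nbhd G x" using comp[OF z(1) x] y by blast
next
  note comp = comp'[rule_format]
  fix y assume "y \<in> f ` power_nbhd G x"
  then show "y \<in> power_nbhd H (f x)" using comp[OF _ x] G.power_nbhd_carrier by blast
qed

text \<open>
  The graph isomorphism \<open>f\<close> maps twin classes to twin classes in which the orders are
  distributed in the same way. So there is a bijection \<open>g\<close> that agrees with
  \<open>f\<close> up to twins and preserves orders.
\<close>

lemma prime_power_sim4:
  assumes pp: "prime p" "order G = p ^ n"
    and f: "bij_betw f (carrier G) (carrier H)"
    and comp': "\<forall>x\<in>carrier G. \<forall>y\<in>carrier G. x \<in> power_nbhd G y \<longleftrightarrow> f x \<in> power_nbhd H (f y)"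
  shows "\<exists>g. directed_power_iso g G H"
proof -
  note comp = comp'[rule_format]
  have ppH: "order H = p ^ n" using pp(2) bij_betw_same_card[OF f] by (simp add: order_def)
  have inj: "inj_on f (carrier G)" and img: "f ` carrier G = carrier H" using f by (auto simp: bij_betw_def)
  have fc: "f x \<in> carrier H" if "x \<in> carrier G" for x using that img by blast
  note nbf = comparability_iso_image_nbhd[OF f comp']
  have nbeq: "power_nbhd H (f x) = power_nbhd H (f y) \<longleftrightarrow> power_nbhd G x = power_nbhd G y"
    if "x \<in> carrier G" "y \<in> carrier G" for x y
    using that nbf inj_on_image_eq_iff[OF inj G.power_nbhd_carrier G.power_nbhd_carrier] by simp
  have nble: "power_nbhd H (f x) \<subset> power_nbhd H (f y) \<longleftrightarrow> power_nbhd G x \<subset> power_nbhd G y"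
    if "x \<in> carrier G" "y \<in> carrier G" for x y
  proof -
    have "f ` power_nbhd G x \<subseteq> f ` power_nbhd G y \<longleftrightarrow> power_nbhd G x \<subseteq> power_nbhd G y"
      using inj G.power_nbhd_carrier[of x] G.power_nbhd_carrier[of y] unfolding inj_on_def by blast
    then show ?thesis using nbeq[OF that] nbf that by (auto simp: psubset_eq)
  qed
  have count: "card {t \<in> carrier G. power_nbhd H (f t) = l \<and> G.ord t = k}
             = card {t \<in> carrier H. power_nbhd H t = l \<and> H.ord t = k}" for l k
  proof (cases "l \<in> power_nbhd H ` carrier H")
    case True
    then have "l \<in> power_nbhd H ` f ` carrier G" by (simp only: img)
    then obtain x where x: "x \<in> carrier G" "l = power_nbhd H (f x)" by blast
    define T D T' D' where "T = {t \<in> carrier G. power_nbhd G t = power_nbhd G x}"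
      and "D = {z \<in> power_nbhd G x. power_nbhd G x \<subset> power_nbhd G z}"
      and "T' = {t \<in> carrier H. power_nbhd H t = power_nbhd H (f x)}"
      and "D' = {z \<in> power_nbhd H (f x). power_nbhd H (f x) \<subset> power_nbhd H z}"
    have "T' = f ` T"
      unfolding T_def T'_def img[symmetric] by (rule Collect_image_iff) (rule nbeq[OF _ x(1)])
    then have cT: "card T' = card T"
      using inj by (simp add: card_image inj_on_subset T_def)
    have "{w \<in> f ` power_nbhd G x. power_nbhd H (f x) \<subset> power_nbhd H w} = f ` D"
      unfolding D_def using G.power_nbhd_carrier
      by (intro Collect_image_iff) (rule nble[OF x(1)], blast)
    then have "D' = f ` D" by (simp only: D'_def nbf[OF x(1)])
    moreover have Dsub: "D \<subseteq> carrier G" using G.power_nbhd_carrier[of x] by (auto simp: D_def)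
    ultimately have cD: "card D' = card D"
      using card_image[OF inj_on_subset[OF inj Dsub]] by simp
    have "{t \<in> carrier G. power_nbhd H (f t) = l \<and> G.ord t = k} = {t \<in> T. G.ord t = k}"
      using nbeq[OF _ x(1)] x(2) by (auto simp: T_def)
    moreover have "{t \<in> carrier H. power_nbhd H t = l \<and> H.ord t = k} = {t \<in> T'. H.ord t = k}"
      using x(2) by (auto simp: T'_def)
    ultimately show ?thesis
      using G.card_twins_prime_power[OF pp x(1), of k, folded T_def D_def]
        H.card_twins_prime_power[OF pp(1) ppH fc[OF x(1)], of k, folded T'_def D'_def] cT cD by simp
  next
    case False
    then have "{t \<in> carrier G. power_nbhd H (f t) = l \<and> G.ord t = k} = {}"
      "{t \<in> carrier H. power_nbhd H t = l \<and> H.ord t = k} = {}" using fc by blast+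
    then show ?thesis by (simp only: card.empty)
  qed
  obtain g where g: "bij_betw g (carrier G) (carrier H)"
    "\<And>x. x \<in> carrier G \<Longrightarrow> (power_nbhd H (g x), H.ord (g x)) = (power_nbhd H (f x), G.ord x)"
  proof (rule bij_betw_matching_labels[OF G.finite_carrier H.finite_carrier,
      of "\<lambda>x. (power_nbhd H (f x), G.ord x)" "\<lambda>y. (power_nbhd H y, H.ord y)"])
    fix l :: "'b set \<times> nat"
    show "card {x \<in> carrier G. (power_nbhd H (f x), G.ord x) = l} =
      card {y \<in> carrier H. (power_nbhd H y, H.ord y) = l}"
      using count[of "fst l" "snd l"] by (simp add: prod_eq_iff)
  qed blast
  have gc: "g x \<in> carrier H" if "x \<in> carrier G" for x using that g(1) bij_betw_apply by metis
  have "x \<in> cyc G y \<longleftrightarrow> g x \<in> cyc H (g y)" if x: "x \<in> carrier G" and y: "y \<in> carrier G" for x y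
  proof -
    have "x \<in> power_nbhd G y \<longleftrightarrow> f x \<in> power_nbhd H (g y)" using comp g(2) x y by simp
    also have "\<dots> \<longleftrightarrow> g x \<in> power_nbhd H (g y)"
      using H.power_nbhd_sym[OF fc[OF x] gc[OF y]] H.power_nbhd_sym[OF gc[OF x] gc[OF y]] g(2)[OF x] by simp
    finally show ?thesis
      using G.in_cyc_iff_nbhd[OF x y] H.in_cyc_iff_nbhd[OF gc[OF x] gc[OF y]] g(2) x y by simp
  qed
  then show ?thesis using g(1) by (auto simp: directed_power_iso_def)
qed

text \<open>
  In a cyclic group \<open>a\<close> is a power of \<open>b\<close> iff the order of
  \<open>a\<close> divides that of \<open>b\<close>, so it suffices to match orders.
\<close>

lemma cyclic_directed_power_iso:
  assumes x: "x \<in> carrier G" "carrier G = cyc G x" and y: "y \<in> carrier H" "carrier H = cyc H y"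
    and card: "order G = order H"
  shows "\<exists>g. directed_power_iso g G H"
proof -
  have ords: "G.ord x = H.ord y"
    using card G.card_cyc[OF x(1)] H.card_cyc[OF y(1)] x(2) y(2) by (simp add: order_def)
  obtain g where g: "bij_betw g (carrier G) (carrier H)" "\<And>z. z \<in> carrier G \<Longrightarrow> H.ord (g z) = G.ord z"
  proof (rule bij_betw_matching_labels[OF G.finite_carrier H.finite_carrier, of G.ord H.ord])
    show "card {z \<in> carrier G. G.ord z = l} = card {z \<in> carrier H. H.ord z = l}" for l
      using G.card_ord_in_cyc[OF x(1), of l] H.card_ord_in_cyc[OF y(1), of l] ords x(2) y(2) by simp
  qed blast
  have "a \<in> cyc G b \<longleftrightarrow> g a \<in> cyc H (g b)" if a: "a \<in> carrier G" and b: "b \<in> carrier G" for a b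
  proof -
    have c: "g a \<in> carrier H" "g b \<in> carrier H" using a b g(1) bij_betw_apply by metis+
    have "a \<in> cyc G b \<longleftrightarrow> G.ord a dvd G.ord b"
      using G.in_cyc_if_ord_dvd[OF x(1), of a b] G.ord_dvd_of_in_cyc[OF b, of a] a b x(2) by blast
    moreover have "g a \<in> cyc H (g b) \<longleftrightarrow> H.ord (g a) dvd H.ord (g b)"
      using H.in_cyc_if_ord_dvd[OF y(1), of "g a" "g b"] H.ord_dvd_of_in_cyc[OF c(2), of "g a"] c y(2) by blast
    ultimately show ?thesis using g(2) a b by simp
  qed
  then show ?thesis using g(1) by (auto simp: directed_power_iso_def)
qed

end

context nilpotent_fin_group_pair
begin

text \<open>
  Since only the identity is joined to all others, twins generate the same cyclic subgroup, so
  \<open>f\<close> preserves the totient of the order. If the direction of an edge from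
  \<open>x\<close> to its power \<open>y\<close> were reversed, the order of \<open>x\<close> would
  be twice the odd order of \<open>y\<close>. The involution \<open>z\<close> among the powers of
  \<open>x\<close> is not a neighbour of \<open>y\<close>, so \<open>f z\<close> is not a power of
  \<open>f x\<close>; then \<open>f x\<close> is a nontrivial power of \<open>f z\<close>, whose
  order is at most two, so that \<open>f z\<close> is a power of \<open>f x\<close> after all.
\<close>

lemma two_primes_sim4:
  assumes pq: "prime p" "prime q" "p \<noteq> q" "p dvd order G" "q dvd order G"
    and f: "bij_betw f (carrier G) (carrier H)"
    and comp': "\<forall>x\<in>carrier G. \<forall>y\<in>carrier G. x \<in> power_nbhd G y \<longleftrightarrow> f x \<in> power_nbhd H (f y)"
    and nodom: "\<And>x. x \<in> carrier G \<Longrightarrow> power_nbhd G x = carrier G \<Longrightarrow> x = \<one>\<^bsub>G\<^esub>"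
  shows "directed_power_iso f G H"
proof -
  note comp = comp'[rule_format]
  have card: "order H = order G" using bij_betw_same_card[OF f] by (simp add: order_def)
  have inj: "inj_on f (carrier G)" and img: "f ` carrier G = carrier H" using f by (auto simp: bij_betw_def)
  have fc: "f x \<in> carrier H" if "x \<in> carrier G" for x using that img by blast
  note nbf = comparability_iso_image_nbhd[OF f comp']
  have nbeq: "power_nbhd H (f x) = power_nbhd H (f y) \<longleftrightarrow> power_nbhd G x = power_nbhd G y"
    if "x \<in> carrier G" "y \<in> carrier G" for x y
    using that nbf inj_on_image_eq_iff[OF inj G.power_nbhd_carrier G.power_nbhd_carrier] by simp
  have f1: "x = \<one>\<^bsub>G\<^esub>" if x: "x \<in> carrier G" and dom: "power_nbhd H (f x) = carrier H" for x
  proof -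
    have "f ` power_nbhd G x = f ` carrier G" using nbf[OF x] dom img by simp
    then have "power_nbhd G x = carrier G"
      using inj_on_image_eq_iff[OF inj G.power_nbhd_carrier subset_refl] by blast
    then show ?thesis using nodom x by blast
  qed
  have f_one: "f \<one>\<^bsub>G\<^esub> = \<one>\<^bsub>H\<^esub>"
  proof -
    obtain x where x: "x \<in> carrier G" "f x = \<one>\<^bsub>H\<^esub>" using img H.one_closed by (metis imageE)
    then show ?thesis using f1[of x] H.power_nbhd_one by simp
  qed
  have nodomH: "y = \<one>\<^bsub>H\<^esub>" if "y \<in> carrier H" "power_nbhd H y = carrier H" for y
    using that f1 f_one img by (metis imageE)
  have cycG: "cyc G x = cyc G y \<longleftrightarrow> power_nbhd G x = power_nbhd G y"
    if x: "x \<in> carrier G" and y: "y \<in> carrier G" for x y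
  proof
    assume nb: "power_nbhd G x = power_nbhd G y"
    then have "x \<in> power_nbhd G y" using G.self_in_power_nbhd[OF x] by simp
    then consider "x = \<one>\<^bsub>G\<^esub> \<or> y = \<one>\<^bsub>G\<^esub>"
      | "x \<in> cyc G y" "x \<noteq> \<one>\<^bsub>G\<^esub>" | "y \<in> cyc G x" "y \<noteq> \<one>\<^bsub>G\<^esub>" by (auto simp: power_nbhd_def)
    then show "cyc G x = cyc G y"
    proof cases
      case 1
      then show ?thesis using nodom x y nb G.power_nbhd_one by metis
    next
      case 2
      then show ?thesis using G.twins_same_cyc[OF pq y] nb by simp
    next
      case 3
      then show ?thesis using G.twins_same_cyc[OF pq x] nb by simp
    qed
  qed (rule G.power_nbhd_cong[OF x y])
  have pqH: "p dvd order H" "q dvd order H" using pq card by auto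
  have cycH: "cyc H x = cyc H y \<longleftrightarrow> power_nbhd H x = power_nbhd H y"
    if x: "x \<in> carrier H" and y: "y \<in> carrier H" for x y
  proof
    assume nb: "power_nbhd H x = power_nbhd H y"
    then have "x \<in> power_nbhd H y" using H.self_in_power_nbhd[OF x] by simp
    then consider "x = \<one>\<^bsub>H\<^esub> \<or> y = \<one>\<^bsub>H\<^esub>"
      | "x \<in> cyc H y" "x \<noteq> \<one>\<^bsub>H\<^esub>" | "y \<in> cyc H x" "y \<noteq> \<one>\<^bsub>H\<^esub>" by (auto simp: power_nbhd_def)
    then show "cyc H x = cyc H y"
    proof cases
      case 1
      then show ?thesis using nodomH x y nb H.power_nbhd_one by metis
    next
      case 2
      then show ?thesis using H.twins_same_cyc[OF pq(1-3) pqH y] nb by simp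
    next
      case 3
      then show ?thesis using H.twins_same_cyc[OF pq(1-3) pqH x] nb by simp
    qed
  qed (rule H.power_nbhd_cong[OF x y])
  have cyc_f: "cyc H (f x) = cyc H (f y) \<longleftrightarrow> cyc G x = cyc G y" if "x \<in> carrier G" "y \<in> carrier G" for x y
    using that cycG cycH[OF fc fc] nbeq by simp
  have tot: "totient (H.ord (f x)) = totient (G.ord x)" if x: "x \<in> carrier G" for x
  proof -
    have "{z \<in> carrier H. cyc H z = cyc H (f x)} = f ` {z \<in> carrier G. cyc G z = cyc G x}"
      unfolding img[symmetric] by (rule Collect_image_iff) (rule cyc_f[OF _ x])
    then have "card {z \<in> carrier H. cyc H z = cyc H (f x)} = card {z \<in> carrier G. cyc G z = cyc G x}"
      using inj by (simp add: card_image inj_on_subset)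
    then show ?thesis using G.card_generators[OF x] H.card_generators[OF fc[OF x]] by simp
  qed
  have fwd: "f y \<in> cyc H (f x)" if x: "x \<in> carrier G" and y: "y \<in> cyc G x" for x y
  proof (rule ccontr)
    assume notin: "f y \<notin> cyc H (f x)"
    have yc: "y \<in> carrier G" using x y G.in_cyc_carrier by blast
    have compxy: "f z \<in> power_nbhd H (f w)" if "z \<in> cyc G w" "w \<in> carrier G" for z w
      using comp[of z w] G.in_cyc_carrier[OF that] that by (simp add: power_nbhd_def)
    have flip: "f x \<in> cyc H (f y)" using compxy[OF y x] notin by (simp add: power_nbhd_def)
    have y1: "y \<noteq> \<one>\<^bsub>G\<^esub>" using notin f_one H.one_in_cyc by metis
    then have x1: "x \<noteq> \<one>\<^bsub>G\<^esub>" using y by (auto simp: cyc_def)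
    have dvd: "G.ord y dvd G.ord x" using G.ord_dvd_of_in_cyc[OF x y] .
    have dvd': "H.ord (f x) dvd H.ord (f y)" using H.ord_dvd_of_in_cyc[OF fc[OF yc] flip] .
    have "totient (H.ord (f x)) \<le> totient (H.ord (f y))"
      using dvd' H.ord_pos[OF fc[OF yc]] by (intro dvd_imp_le totient_dvd) auto
    then have le: "totient (G.ord x) \<le> totient (G.ord y)" using tot x yc by simp
    have "G.ord y \<noteq> G.ord x"
    proof
      assume "G.ord y = G.ord x"
      then have "cyc G y = cyc G x" using G.cyc_eqI[OF x y] by simp
      then have "cyc H (f y) = cyc H (f x)" using cyc_f x yc by simp
      then show False using notin H.self_in_cyc[OF fc[OF yc]] by simp
    qed
    note dbl = totient_le_imp_double[OF dvd this G.ord_pos[OF x] le]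
    have "2 dvd G.ord x" using dbl(1) by simp
    then obtain z where z: "z \<in> cyc G x" "G.ord z = 2" using G.exists_ord_in_cyc[OF x] by blast
    have zc: "z \<in> carrier G" using z x G.in_cyc_carrier by blast
    have "z \<notin> power_nbhd G y"
    proof
      assume "z \<in> power_nbhd G y"
      then have "2 dvd G.ord y \<or> G.ord y dvd 2"
        using G.ord_dvd_of_in_cyc[OF yc, of z] G.ord_dvd_of_in_cyc[OF zc, of y] z by (auto simp: power_nbhd_def)
      moreover have "G.ord y \<noteq> 1" using y1 yc G.ord_eq_1 by blast
      moreover have "G.ord y = 1 \<or> G.ord y = 2" if "G.ord y dvd 2"
        using that two_is_prime_nat by (auto simp: prime_nat_iff)
      ultimately show False using dbl(2) by auto
    qed
    then have nz: "f z \<notin> power_nbhd H (f y)" using comp[OF zc yc] by simp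
    have nzx: "f z \<notin> cyc H (f x)"
      using nz H.cyc_trans[OF _ flip fc[OF yc]] fc[OF zc] by (auto simp: power_nbhd_def)
    then have xz: "f x \<in> cyc H (f z)" using compxy[OF z(1) x] by (simp add: power_nbhd_def)
    have "totient (H.ord (f z)) = 1" using tot[OF zc] z by simp
    then have le2: "H.ord (f z) \<le> 2" using totient_gt_1[of "H.ord (f z)"] by (metis leI less_irrefl)
    have "f x \<noteq> \<one>\<^bsub>H\<^esub>" using x1 f_one inj x G.one_closed by (metis inj_on_eq_iff)
    then have "H.ord (f x) \<noteq> 1" using H.ord_eq_1[OF fc[OF x]] by simp
    then have "H.ord (f z) \<le> H.ord (f x)" using le2 H.ord_pos[OF fc[OF x]] by linarith
    then have "cyc H (f x) = cyc H (f z)" using H.cyc_eqI[OF fc[OF zc] xz] by simp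
    then show False using nzx H.self_in_cyc[OF fc[OF zc]] by simp
  qed
  have "x \<in> cyc G y \<longleftrightarrow> f x \<in> cyc H (f y)" if x: "x \<in> carrier G" and y: "y \<in> carrier G" for x y
  proof
    assume fxy: "f x \<in> cyc H (f y)"
    then have "x \<in> power_nbhd G y" using comp[OF x y] fc[OF x] by (simp add: power_nbhd_def)
    then consider "x \<in> cyc G y" | "y \<in> cyc G x" by (auto simp: power_nbhd_def)
    then show "x \<in> cyc G y"
    proof cases
      case 2
      then have "f y \<in> cyc H (f x)" using fwd x by blast
      then have "cyc H (f x) = cyc H (f y)" using fxy H.cyc_mono fc x y by (metis subset_antisym)
      then show ?thesis using cyc_f[OF x y] G.self_in_cyc[OF x] by simp
    qed
  qed (rule fwd[OF y])
  then show ?thesis using f by (auto simp: directed_power_iso_def)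
qed

lemma sim4_imp_directed_power_iso:
  assumes "sim4 G H"
  shows "\<exists>g. directed_power_iso g G H"
proof -
  obtain f where f: "bij_betw f (carrier G) (carrier H)" and
    comp0: "\<And>x y. x \<in> carrier G \<Longrightarrow> y \<in> carrier G \<Longrightarrow>
      x \<in> cyc G y \<or> y \<in> cyc G x \<longleftrightarrow> f x \<in> cyc H (f y) \<or> f y \<in> cyc H (f x)"
    using assms unfolding sim4_iff by blast
  have comp: "\<forall>x\<in>carrier G. \<forall>y\<in>carrier G. x \<in> power_nbhd G y \<longleftrightarrow> f x \<in> power_nbhd H (f y)"
    using comp0 bij_betw_apply[OF f] by (simp add: power_nbhd_def)
  have card: "order G = order H" using bij_betw_same_card[OF f] by (simp add: order_def)
  have "0 < order G" using G.order_gt_0_iff_finite by simp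
  then show ?thesis
  proof (cases rule: prime_power_or_two_primes)
    case (prime_power p k)
    then show ?thesis using prime_power_sim4 f comp by blast
  next
    case (two_primes p q)
    show ?thesis
    proof (cases "\<exists>x\<in>carrier G. x \<noteq> \<one>\<^bsub>G\<^esub> \<and> power_nbhd G x = carrier G")
      case False
      then show ?thesis using two_primes_sim4[OF two_primes f comp] by blast
    next
      case True
      then obtain x where x: "x \<in> carrier G" "x \<noteq> \<one>\<^bsub>G\<^esub>" "power_nbhd G x = carrier G" by blast
      have dom: "power_nbhd H (f z) = carrier H" if "z \<in> carrier G" "power_nbhd G z = carrier G" for z
        using comparability_iso_image_nbhd[OF f comp that(1)] that(2) f by (simp add: bij_betw_def)
      have "f x \<noteq> f \<one>\<^bsub>G\<^esub>"
        using f x inj_on_eq_iff[of f "carrier G" x "\<one>\<^bsub>G\<^esub>"] by (simp add: bij_betw_def)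
      then obtain z where z: "z \<in> carrier G" "f z \<noteq> \<one>\<^bsub>H\<^esub>" "power_nbhd G z = carrier G"
        using x G.power_nbhd_one by (metis G.one_closed)
      have "carrier G = cyc G x" using G.dominating_imp_cyclic[OF two_primes x] .
      moreover have "carrier H = cyc H (f z)"
        using H.dominating_imp_cyclic[OF two_primes(1-3) _ _ bij_betw_apply[OF f z(1)] z(2) dom[OF z(1,3)]]
          two_primes card by simp
      ultimately show ?thesis
        using cyclic_directed_power_iso[OF x(1) _ bij_betw_apply[OF f z(1)] _ card] by blast
    qed
  qed
qed

end

section \<open>Trees of roots\<close>

text \<open>
  The children of \<open>x\<close> in the tree with parent map \<open>x \<mapsto> x\<^sup>p\<close>.
  The identity is excluded because it is its own parent.
\<close>

definition proper_roots :: "('a, 'm) monoid_scheme \<Rightarrow> nat \<Rightarrow> 'a \<Rightarrow> 'a set" where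
  "proper_roots G p x = {y \<in> carrier G. y \<noteq> \<one>\<^bsub>G\<^esub> \<and> y [^]\<^bsub>G\<^esub> p = x}"

text \<open>
  Isomorphism types of finite rooted trees: a tree is the multiset of its immediate subtrees.
\<close>

datatype tree = Node "tree multiset"

primrec root_tree :: "('a, 'm) monoid_scheme \<Rightarrow> nat \<Rightarrow> nat \<Rightarrow> 'a \<Rightarrow> tree" where
  "root_tree G p 0 x = Node {#}"
| "root_tree G p (Suc n) x = Node (image_mset (root_tree G p n) (mset_set (proper_roots G p x)))"

definition torsion :: "('a, 'm) monoid_scheme \<Rightarrow> nat \<Rightarrow> 'a set" where
  "torsion G n = {x \<in> carrier G. x [^]\<^bsub>G\<^esub> n = \<one>\<^bsub>G\<^esub>}"

lemma image_mset_mset_set_eqI: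
  assumes "bij_betw h A B" and "\<And>y. y \<in> A \<Longrightarrow> \<tau>' (h y) = \<tau> y"
  shows "image_mset \<tau>' (mset_set B) = image_mset \<tau> (mset_set A)"
proof -
  have "mset_set B = image_mset h (mset_set A)"
    using assms(1) by (simp add: bij_betw_def image_mset_mset_set)
  then have "image_mset \<tau>' (mset_set B) = image_mset (\<tau>' \<circ> h) (mset_set A)"
    by (simp add: multiset.map_comp)
  also have "\<dots> = image_mset \<tau> (mset_set A)"
    by (rule image_mset_cong) (metis assms(2) comp_apply elem_mset_set infinite_set_mset_mset_set
        empty_iff mset_set.infinite set_mset_empty)
  finally show ?thesis .
qed

lemma image_mset_mset_set_UNION:
  assumes "finite I" "\<And>i. i \<in> I \<Longrightarrow> finite (A i)" "\<And>i j. i \<in> I \<Longrightarrow> j \<in> I \<Longrightarrow> i \<noteq> j \<Longrightarrow> A i \<inter> A j = {}"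
    and "\<And>i. i \<in> I \<Longrightarrow> image_mset \<tau> (mset_set (A i)) = M"
  shows "image_mset \<tau> (mset_set (\<Union>i\<in>I. A i)) = repeat_mset (card I) M"
  using assms
proof (induction I)
  case (insert i I)
  have "A i \<inter> (\<Union>j\<in>I. A j) = {}" using insert.prems(2)[of i] insert.hyps by blast
  moreover have "finite (\<Union>j\<in>I. A j)" using insert by auto
  ultimately have "mset_set (\<Union>j\<in>insert i I. A j) = mset_set (A i) + mset_set (\<Union>j\<in>I. A j)"
    using insert.prems(1)[of i] mset_set_Union[of "A i" "\<Union>j\<in>I. A j"] by simp
  then show ?case using insert by simp
qed simp

context fin_group
begin

lemma finite_proper_roots [simp]: "finite (proper_roots G p x)"
  by (auto simp: proper_roots_def intro: finite_subset[OF _ finite_carrier])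

lemma int_pow_cong:
  assumes "x \<in> torsion G n" "int n dvd a - b"
  shows "x [^] (a::int) = x [^] (b::int)"
proof -
  have x: "x \<in> carrier G" "ord x dvd n" using assms(1) by (auto simp: torsion_def pow_eq_id)
  then have "int (ord x) dvd a - b" using assms(2) by (meson dvd_trans of_nat_dvd_iff)
  then have "int (ord x) dvd b - a" by (simp add: dvd_diff_commute)
  then show ?thesis using int_pow_eq[OF x(1)] by blast
qed

lemma torsion_iff_ord: "x \<in> torsion G n \<longleftrightarrow> x \<in> carrier G \<and> ord x dvd n"
  by (auto simp: torsion_def pow_eq_id)

lemma torsion_carrier: "x \<in> torsion G n \<Longrightarrow> x \<in> carrier G"
  by (simp add: torsion_def)

lemma one_in_torsion: "\<one> \<in> torsion G n"
  by (simp add: torsion_def)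

lemma torsion_pow: "x \<in> torsion G n \<Longrightarrow> x [^] (k::int) \<in> torsion G n"
  using ord_dvd_of_in_cyc[of x "x [^] k"] pow_in_cyc[of x k] dvd_trans by (auto simp: torsion_iff_ord)

lemma torsion_order: "torsion G (order G) = carrier G"
  by (auto simp: torsion_def pow_order_eq_1)

lemma in_torsion_int_iff: "x \<in> torsion G n \<longleftrightarrow> x \<in> carrier G \<and> x [^] (int n) = \<one>"
  by (simp add: torsion_def int_pow_int)

lemma int_pow_eq_one: "x \<in> torsion G n \<Longrightarrow> int n dvd a \<Longrightarrow> x [^] (a::int) = \<one>"
  using int_pow_cong[of x n a 0] by simp

lemma proper_root_torsion:
  assumes "x \<in> torsion G n" "y \<in> proper_roots G p x"
  shows "y \<in> torsion G (p * n)"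
  using assms by (auto simp: torsion_def proper_roots_def nat_pow_pow[symmetric])

lemma proper_root_int: "y \<in> proper_roots G p x \<Longrightarrow> y [^] (int p) = x"
  by (auto simp: proper_roots_def int_pow_int)

lemma ord_proper_root:
  assumes p: "prime p" and y: "y \<in> proper_roots G p x" and x: "ord x = p ^ j"
  shows "ord y = p ^ Suc j"
proof -
  have yc: "y \<in> carrier G" "y \<noteq> \<one>" "x = y [^] p" using y by (auto simp: proper_roots_def)
  then have xc: "x \<in> carrier G" by simp
  have "x \<in> torsion G (p ^ j)" using x xc by (simp add: torsion_iff_ord)
  then have "ord y dvd p ^ Suc j" using proper_root_torsion[OF _ y] by (auto simp: torsion_iff_ord)
  then obtain i where i: "ord y = p ^ i" using divides_primepow_nat[OF p, of "ord y" "Suc j"] by blast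
  moreover have "ord y \<noteq> 1" using ord_eq_1 yc by blast
  ultimately have "p dvd ord y" by (cases i) auto
  then have "ord x = ord y div p" using ord_pow[of y p] yc p by (auto simp: prime_gt_0_nat)
  then have "ord y = ord x * p" using \<open>p dvd ord y\<close> by simp
  then show ?thesis using x by simp
qed

lemma unit_inverse_mod_prime_power:
  assumes "prime (p::nat)" "coprime (u::int) (int p)"
  obtains v where "int (p ^ j) dvd u * v - 1" "coprime v (int p)"
proof (cases "j = 0")
  case True
  then show ?thesis using that[of 1] by simp
next
  case False
  have "coprime u (int (p ^ j))" using assms by simp
  then obtain v where v: "[u * v = 1] (mod int (p ^ j))" using cong_solve_coprime_int by blast
  then have d: "int (p ^ j) dvd u * v - 1" by (simp add: cong_iff_dvd_diff)
  have "int p dvd int (p ^ j)" using False by simp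
  then have "int p dvd u * v - 1" using d dvd_trans by blast
  then have "coprime v (int p)"
    by (metis cong_iff_dvd_diff coprime_cong_cong_left coprime_1_left coprime_mult_left_iff cong_sym cong_imp_coprime)
  then show ?thesis using that d by blast
qed

text \<open>
  Raising to a power prime to \<open>p\<close> is an automorphism of the tree of the elements of
  \<open>p\<close>-power order.
\<close>

lemma root_tree_unit_pow:
  assumes p: "prime p" and u: "coprime (u::int) (int p)"
  shows "x \<in> torsion G (p ^ j) \<Longrightarrow> root_tree G p n (x [^] u) = root_tree G p n x"
proof (induction n arbitrary: x j)
  case (Suc n)
  obtain v where v: "int (p ^ Suc j) dvd u * v - 1" "coprime v (int p)"
    using unit_inverse_mod_prime_power[OF p u] .
  have xc: "x \<in> carrier G" using Suc.prems torsion_carrier by blast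
  have inv1: "(w [^] u) [^] v = w" "(w [^] v) [^] u = w" if "w \<in> torsion G (p ^ Suc j)" for w
    using int_pow_cong[OF that, of "u * v" 1] v torsion_carrier[OF that]
    by (simp_all add: int_pow_pow mult.commute[of v])
  have tx: "x \<in> torsion G (p ^ Suc j)" using Suc.prems by (auto simp: torsion_iff_ord)
  have t1: "y \<in> torsion G (p ^ Suc j)" if "y \<in> proper_roots G p x" for y
    using proper_root_torsion[OF Suc.prems that] by simp
  have t2: "y \<in> torsion G (p ^ Suc j)" if "y \<in> proper_roots G p (x [^] u)" for y
    using proper_root_torsion[OF torsion_pow[OF Suc.prems] that] by simp
  have r: "w [^] a \<in> proper_roots G p (z [^] a)"
    if w: "w \<in> proper_roots G p z" and ne: "w [^] a \<noteq> \<one>" for w z and a :: int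
  proof -
    have wc: "w \<in> carrier G" using w by (simp add: proper_roots_def)
    have "(w [^] a) [^] (int p) = (w [^] (int p)) [^] a"
      using wc by (simp add: int_pow_pow mult.commute)
    then show ?thesis using w ne wc proper_root_int[OF w] by (simp add: proper_roots_def int_pow_int)
  qed
  have "bij_betw (\<lambda>y. y [^] u) (proper_roots G p x) (proper_roots G p (x [^] u))"
  proof (rule bij_betw_byWitness[where f' = "\<lambda>y. y [^] v"])
    show "\<forall>y\<in>proper_roots G p x. (y [^] u) [^] v = y" using inv1 t1 by blast
    show "\<forall>y\<in>proper_roots G p (x [^] u). (y [^] v) [^] u = y" using inv1 t2 by blast
    show "(\<lambda>y. y [^] u) ` proper_roots G p x \<subseteq> proper_roots G p (x [^] u)"
    proof (intro image_subsetI r)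
      fix y assume y: "y \<in> proper_roots G p x"
      show "y [^] u \<noteq> \<one>"
      proof
        assume "y [^] u = \<one>"
        then have "y = \<one>" using inv1(1)[OF t1[OF y]] by simp
        then show False using y by (simp add: proper_roots_def)
      qed
    qed
    show "(\<lambda>y. y [^] v) ` proper_roots G p (x [^] u) \<subseteq> proper_roots G p x"
    proof (intro image_subsetI)
      fix y assume y: "y \<in> proper_roots G p (x [^] u)"
      have "y [^] v \<noteq> \<one>"
      proof
        assume "y [^] v = \<one>"
        then have "y = \<one>" using inv1(2)[OF t2[OF y]] by simp
        then show False using y by (simp add: proper_roots_def)
      qed
      then have "y [^] v \<in> proper_roots G p ((x [^] u) [^] v)" using r[OF y] by blast
      then show "y [^] v \<in> proper_roots G p x" using inv1(1)[OF tx] by simp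
    qed
  qed
  then show ?case
    using Suc.IH[OF t1] by (auto intro!: image_mset_mset_set_eqI)
qed simp

lemma generator_is_unit_pow:
  assumes p: "prime p" and x: "x \<in> torsion G (p ^ j)" and y: "y \<in> carrier G" "cyc G y = cyc G x"
  obtains u :: int where "coprime u (int p)" "y = x [^] u"
proof (cases "ord x = 1")
  case True
  have xc: "x \<in> carrier G" using x torsion_carrier by blast
  have "ord y = ord x" using y card_cyc xc by metis
  then have "y = x" using True ord_eq_1 y(1) xc by metis
  then show ?thesis using that[of 1] xc by simp
next
  case False
  have xc: "x \<in> carrier G" using x torsion_carrier by blast
  obtain k :: nat where k: "y = x [^] k" using in_cyc_nat[OF xc] self_in_cyc[OF y(1)] y(2) by metis
  have "ord y = ord x" using y card_cyc xc by metis
  then have "coprime k (ord x)" using pow_ord_eq_ord_iff[OF finite_carrier xc] k by blast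
  moreover obtain i where "ord x = p ^ i" using x p by (auto simp: torsion_iff_ord divides_primepow_nat)
  then have "p dvd ord x" using False by (cases i) auto
  ultimately have "coprime k p" by (meson coprime_divisors dvd_refl)
  then have "coprime (int k) (int p)" by simp
  then show ?thesis using that[of "int k"] k by (simp add: int_pow_int)
qed

text \<open>
  A directed power isomorphism need not commute with \<open>x \<mapsto> x\<^sup>p\<close>, but it
  preserves the set of the elements in which \<open>x\<close> has index \<open>p\<close>. These are
  the \<open>p\<close>-th roots of all generators of the group of \<open>x\<close>, and every
  generator contributes the same types of trees, since generators are unit powers of each other. So
  the multiset of types can be recovered by division.
\<close>

lemma image_mset_index_p_roots:
  assumes p: "prime p" and x: "x \<in> torsion G (p ^ j)"
  shows "image_mset (root_tree G p n) (mset_set {y \<in> carrier G. x \<in> cyc G y \<and> ord y = p * ord x})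
    = repeat_mset (totient (ord x)) (image_mset (root_tree G p n) (mset_set (proper_roots G p x)))"
proof -
  have xc: "x \<in> carrier G" using x torsion_carrier by blast
  obtain i where i: "ord x = p ^ i" using x p by (auto simp: torsion_iff_ord divides_primepow_nat)
  let ?I = "{z \<in> carrier G. cyc G z = cyc G x}"
  have "{y \<in> carrier G. x \<in> cyc G y \<and> ord y = p * ord x} = (\<Union>z\<in>?I. proper_roots G p z)"
  proof (intro equalityI subsetI)
    fix y assume "y \<in> {y \<in> carrier G. x \<in> cyc G y \<and> ord y = p * ord x}"
    then have y: "y \<in> carrier G" "x \<in> cyc G y" "ord y = p * ord x" by auto
    define z where "z = y [^] p"
    have zc: "z \<in> carrier G" using y by (simp add: z_def)
    have oz: "ord z = ord x" using ord_pow[of y p] y p by (simp add: z_def prime_gt_0_nat)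
    have "z \<in> cyc G y" by (simp add: z_def nat_pow_in_cyc)
    then have "z \<in> cyc G x" using in_cyc_if_ord_dvd[OF y(1) _ y(2)] oz by simp
    then have "cyc G z = cyc G x" using cyc_eqI[OF xc] oz by simp
    moreover have "y \<noteq> \<one>"
    proof
      assume "y = \<one>"
      then show False using y(3) p by (auto simp: prime_nat_iff)
    qed
    ultimately show "y \<in> (\<Union>z\<in>?I. proper_roots G p z)"
      using y zc by (auto simp: proper_roots_def z_def)
  next
    fix y assume "y \<in> (\<Union>z\<in>?I. proper_roots G p z)"
    then obtain z where z: "z \<in> carrier G" "cyc G z = cyc G x" "y \<in> proper_roots G p z" by auto
    have oz: "ord z = ord x" using z card_cyc xc by metis
    have yc: "y \<in> carrier G" and zy: "z = y [^] p" using z(3) by (auto simp: proper_roots_def)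
    have "x \<in> cyc G z" using z(2) self_in_cyc[OF xc] by simp
    moreover have "z \<in> cyc G y" by (simp add: zy nat_pow_in_cyc)
    ultimately have "x \<in> cyc G y" using cyc_trans yc by blast
    moreover have "ord y = p * ord x" using ord_proper_root[OF p z(3)] oz i by simp
    ultimately show "y \<in> {y \<in> carrier G. x \<in> cyc G y \<and> ord y = p * ord x}" using yc by blast
  qed
  moreover have "image_mset (root_tree G p n) (mset_set (\<Union>z\<in>?I. proper_roots G p z))
    = repeat_mset (card ?I) (image_mset (root_tree G p n) (mset_set (proper_roots G p x)))"
  proof (rule image_mset_mset_set_UNION)
    fix z assume "z \<in> ?I"
    then have z: "z \<in> carrier G" "cyc G z = cyc G x" by auto
    obtain u :: int where "coprime u (int p)" "z = x [^] u"
      using generator_is_unit_pow[OF p x z] .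
    then have "root_tree G p (Suc n) z = root_tree G p (Suc n) x"
      using root_tree_unit_pow[OF p _ x] by blast
    then show "image_mset (root_tree G p n) (mset_set (proper_roots G p z))
      = image_mset (root_tree G p n) (mset_set (proper_roots G p x))" by simp
  qed (auto simp: proper_roots_def)
  ultimately show ?thesis using card_generators[OF xc] by simp
qed

end

context fin_group_pair
begin

lemma directed_power_iso_root_tree:
  assumes f: "directed_power_iso f G H" and p: "prime p"
  shows "x \<in> torsion G (p ^ j) \<Longrightarrow> root_tree H p n (f x) = root_tree G p n x"
proof (induction n arbitrary: x j)
  case (Suc n)
  have bij: "bij_betw f (carrier G) (carrier H)" and
    iff: "\<And>x y. x \<in> carrier G \<Longrightarrow> y \<in> carrier G \<Longrightarrow> x \<in> cyc G y \<longleftrightarrow> f x \<in> cyc H (f y)"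
    using f by (auto simp: directed_power_iso_def)
  note ordf = directed_power_iso_ord[OF f]
  have xc: "x \<in> carrier G" using Suc.prems G.torsion_carrier by blast
  have fxc: "f x \<in> carrier H" using bij xc bij_betw_apply by metis
  have fx: "f x \<in> torsion H (p ^ j)" using Suc.prems fxc ordf[OF xc] by (simp add: G.torsion_iff_ord H.torsion_iff_ord)
  let ?A = "{y \<in> carrier G. x \<in> cyc G y \<and> G.ord y = p * G.ord x}"
  let ?B = "{y \<in> carrier H. f x \<in> cyc H y \<and> H.ord y = p * H.ord (f x)}"
  have "?B = f ` ?A"
  proof (intro equalityI subsetI)
    fix y assume y: "y \<in> ?B"
    then obtain z where "z \<in> carrier G" "y = f z" using bij by (auto simp: bij_betw_def)
    then show "y \<in> f ` ?A" using y iff[OF xc] ordf xc by auto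
  next
    fix y assume "y \<in> f ` ?A"
    then show "y \<in> ?B" using iff[OF xc] ordf xc bij_betw_apply[OF bij] by auto
  qed
  then have "bij_betw f ?A ?B" using bij by (auto simp: bij_betw_def intro: inj_on_subset)
  moreover have "root_tree H p n (f y) = root_tree G p n y" if "y \<in> ?A" for y
  proof (rule Suc.IH)
    show "y \<in> torsion G (p ^ Suc j)"
      using that Suc.prems by (auto simp: G.torsion_iff_ord mult_dvd_mono)
  qed
  ultimately have "image_mset (root_tree H p n) (mset_set ?B) = image_mset (root_tree G p n) (mset_set ?A)"
    by (rule image_mset_mset_set_eqI)
  then have "repeat_mset (totient (G.ord x)) (image_mset (root_tree H p n) (mset_set (proper_roots H p (f x))))
    = repeat_mset (totient (G.ord x)) (image_mset (root_tree G p n) (mset_set (proper_roots G p x)))"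
    using G.image_mset_index_p_roots[OF p Suc.prems, of n] H.image_mset_index_p_roots[OF p fx, of n] ordf[OF xc] by simp
  moreover have "totient (G.ord x) \<noteq> 0" using G.ord_pos[OF xc] by simp
  ultimately show ?case by (simp add: repeat_mset_cancel1)
qed simp

text \<open>
  The closure conditions say that a \<open>p\<close>-th root of an element of the
  \<open>q\<close>-torsion is again \<open>q\<close>-torsion, so that the trees lie inside the
  domain and the range of \<open>f\<close>.
\<close>

lemma torsion_bij_root_tree:
  assumes p: "prime p" and f: "bij_betw f (torsion G q) (torsion H q)"
    and pow: "\<And>x. x \<in> torsion G q \<Longrightarrow> f (x [^]\<^bsub>G\<^esub> int p) = f x [^]\<^bsub>H\<^esub> int p"
    and one: "f \<one>\<^bsub>G\<^esub> = \<one>\<^bsub>H\<^esub>"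
    and closed: "\<And>x. x \<in> carrier G \<Longrightarrow> x [^]\<^bsub>G\<^esub> int p \<in> torsion G q \<Longrightarrow> x \<in> torsion G q"
      "\<And>x. x \<in> carrier H \<Longrightarrow> x [^]\<^bsub>H\<^esub> int p \<in> torsion H q \<Longrightarrow> x \<in> torsion H q"
  shows "x \<in> torsion G q \<Longrightarrow> root_tree H p n (f x) = root_tree G p n x"
proof (induction n arbitrary: x)
  case (Suc n)
  have fx: "f x \<in> torsion H q" using Suc.prems f bij_betw_apply by metis
  have inj: "inj_on f (torsion G q)" and img: "f ` torsion G q = torsion H q" using f by (auto simp: bij_betw_def)
  have tG: "y \<in> torsion G q" if "y \<in> proper_roots G p x" for y
    using that closed(1)[of y] Suc.prems G.proper_root_int[OF that] by (auto simp: proper_roots_def)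
  have tH: "y \<in> torsion H q" if "y \<in> proper_roots H p (f x)" for y
    using that closed(2)[of y] fx H.proper_root_int[OF that] by (auto simp: proper_roots_def)
  have iff: "f y \<in> proper_roots H p (f x) \<longleftrightarrow> y \<in> proper_roots G p x" if y: "y \<in> torsion G q" for y
  proof -
    have c: "y \<in> carrier G" "f y \<in> carrier H"
      using y bij_betw_apply[OF f] G.torsion_carrier H.torsion_carrier by blast+
    have "f y = \<one>\<^bsub>H\<^esub> \<longleftrightarrow> y = \<one>\<^bsub>G\<^esub>"
      using inj_on_eq_iff[OF inj y G.one_in_torsion] one by simp
    moreover have "f y [^]\<^bsub>H\<^esub> p = f x \<longleftrightarrow> y [^]\<^bsub>G\<^esub> p = x"
      using inj_on_eq_iff[OF inj G.torsion_pow[OF y, of "int p"] Suc.prems] pow[OF y] by (simp add: int_pow_int)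
    ultimately show ?thesis using c by (auto simp: proper_roots_def)
  qed
  have "proper_roots H p (f x) = f ` proper_roots G p x"
  proof (intro equalityI subsetI)
    fix y assume y: "y \<in> proper_roots H p (f x)"
    then obtain z where "z \<in> torsion G q" "y = f z" using tH img by blast
    then show "y \<in> f ` proper_roots G p x" using iff y by blast
  next
    fix y assume "y \<in> f ` proper_roots G p x"
    then show "y \<in> proper_roots H p (f x)" using iff tG by blast
  qed
  moreover have "proper_roots G p x \<subseteq> torsion G q" using tG by blast
  ultimately have "bij_betw f (proper_roots G p x) (proper_roots H p (f x))"
    using inj by (simp add: bij_betw_def inj_on_subset)
  then have "image_mset (root_tree H p n) (mset_set (proper_roots H p (f x)))
    = image_mset (root_tree G p n) (mset_set (proper_roots G p x))"
    by (rule image_mset_mset_set_eqI) (use Suc.IH tG in blast)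
  then show ?case by simp
qed simp

end

section \<open>Trees of roots from power map digraphs\<close>

context nilpotent_fin_group_pair
begin

text \<open>
  Write the group order as \<open>q * m\<close> with \<open>q\<close> the \<open>p\<close>-part, and
  choose the exponent \<open>t\<close> congruent to \<open>p\<close> modulo \<open>q\<close> and to
  \<open>1\<close> modulo \<open>m\<close>. An isomorphism \<open>f\<close> of the digraphs for
  \<open>t\<close> need not preserve the \<open>q\<close>-torsion, on which the map \<open>x
  \<mapsto> x\<^sup>t\<close> is \<open>x \<mapsto> x\<^sup>p\<close>: it maps it to the coset of
  \<open>z = f \<one>\<close>, which is a fixed point of order prime to \<open>p\<close>. Projecting
  to the \<open>p\<close>-part by an idempotent exponent \<open>e\<close> gives a bijection
  \<open>f'\<close> between the \<open>q\<close>-torsions that commutes with \<open>x \<mapsto>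
  x\<^sup>p\<close>. It is onto since \<open>z\<close> commutes with elements of
  \<open>p\<close>-power order.
\<close>

lemma sim5_root_tree_one:
  assumes s5: "sim5 G H" and p: "prime p"
  shows "root_tree H p n \<one>\<^bsub>H\<^esub> = root_tree G p n \<one>\<^bsub>G\<^esub>"
proof -
  have ord_eq: "order H = order G"
  proof -
    obtain f where "bij_betw f (carrier G) (carrier H)" using s5 unfolding sim5_iff by blast
    then show ?thesis by (simp add: order_def bij_betw_same_card)
  qed
  define N where "N = order G"
  have N0: "N \<noteq> 0" using G.order_gt_0_iff_finite by (simp add: N_def)
  define K where "K = multiplicity p N"
  define q where "q = p ^ K"
  obtain m where m: "N = q * m" "\<not> p dvd m"
    using multiplicity_decompose'[of N p] N0 p unfolding q_def K_def by (metis not_prime_unit)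
  have co: "coprime p m" using m(2) p by (simp add: prime_imp_coprime)
  then have coq: "coprime q m" by (simp add: q_def)
  obtain u v where uv: "u * int q + v * int m = 1"
    using bezout_int[of "int q" "int m"] coq by (auto simp: coprime_iff_gcd_eq_1)
  \<comment> \<open>\<open>e\<close> is the idempotent modulo \<open>N\<close> that projects onto the \<open>p\<close>-part\<close>
  define e where "e = v * int m"
  have e1: "1 - e = u * int q" using uv by (simp add: e_def)
  define t where "t = 1 + (int p - 1) * e"
  have Nint: "int N = int q * int m" by (simp add: m)
  have ee: "int N dvd e * (1 - e)"
    unfolding Nint e1 unfolding e_def by (simp add: mult.commute mult.left_commute)
  obtain f where f: "bij_betw f (carrier G) (carrier H)"
    and ft: "\<And>x. x \<in> carrier G \<Longrightarrow> f (x [^]\<^bsub>G\<^esub> t) = f x [^]\<^bsub>H\<^esub> t"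
    using s5 unfolding sim5_iff by blast
  have inj: "inj_on f (carrier G)" and img: "f ` carrier G = carrier H" using f by (auto simp: bij_betw_def)
  have fc: "f x \<in> carrier H" if "x \<in> carrier G" for x using that img by blast
  have GN: "x \<in> torsion G N" if "x \<in> carrier G" for x using that G.torsion_order by (simp add: N_def)
  have HN: "x \<in> torsion H N" if "x \<in> carrier H" for x using that H.torsion_order ord_eq by (simp add: N_def)
  have tp: "int q dvd t - int p"
  proof -
    have "t - int p = - (int p - 1) * (1 - e)" by (simp add: t_def algebra_simps)
    then show ?thesis unfolding e1 by simp
  qed
  define z where "z = f \<one>\<^bsub>G\<^esub>"
  have zc: "z \<in> carrier H" using fc by (simp add: z_def)
  have zt: "z [^]\<^bsub>H\<^esub> t = z" using ft[OF G.one_closed] by (simp add: z_def)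
  define f' where "f' = (\<lambda>x. f x [^]\<^bsub>H\<^esub> e)"
  have f'q: "f' x \<in> torsion H q" if "x \<in> carrier G" for x
  proof -
    have "int N dvd e * int q" by (simp add: Nint e_def)
    then have "f x [^]\<^bsub>H\<^esub> (e * int q) = \<one>\<^bsub>H\<^esub>" by (rule H.int_pow_eq_one[OF HN[OF fc[OF that]]])
    then show ?thesis using fc[OF that] by (simp add: H.in_torsion_int_iff f'_def H.int_pow_pow)
  qed
  have xt: "x [^]\<^bsub>G\<^esub> t = x [^]\<^bsub>G\<^esub> int p" if "x \<in> torsion G q" for x
    using G.int_pow_cong[OF that tp] .
  have xtH: "x [^]\<^bsub>H\<^esub> t = x [^]\<^bsub>H\<^esub> int p" if "x \<in> torsion H q" for x
    using H.int_pow_cong[OF that tp] .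
  have f'p: "f' (x [^]\<^bsub>G\<^esub> int p) = f' x [^]\<^bsub>H\<^esub> int p" if x: "x \<in> torsion G q" for x
  proof -
    have xc: "x \<in> carrier G" using x G.torsion_carrier by blast
    have "f' (x [^]\<^bsub>G\<^esub> int p) = f (x [^]\<^bsub>G\<^esub> t) [^]\<^bsub>H\<^esub> e" using xt[OF x] by (simp add: f'_def)
    also have "\<dots> = (f x [^]\<^bsub>H\<^esub> e) [^]\<^bsub>H\<^esub> t"
      using ft[OF xc] fc[OF xc] by (simp add: H.int_pow_pow mult.commute)
    also have "\<dots> = f' x [^]\<^bsub>H\<^esub> int p" using xtH[OF f'q[OF xc]] by (simp add: f'_def)
    finally show ?thesis .
  qed
  have pow_iter: "x [^]\<^bsub>G\<^esub> int p ^ i \<in> torsion G q" if "x \<in> torsion G q" for x i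
    using G.torsion_pow[OF that] .
  have rest: "f x [^]\<^bsub>H\<^esub> (1 - e) = z [^]\<^bsub>H\<^esub> (1 - e)" if x: "x \<in> torsion G q" for x
  proof -
    have step: "f (y [^]\<^bsub>G\<^esub> int p) [^]\<^bsub>H\<^esub> (1 - e) = f y [^]\<^bsub>H\<^esub> (1 - e)" if y: "y \<in> torsion G q" for y
    proof -
      have yc: "y \<in> carrier G" using y G.torsion_carrier by blast
      have "int N dvd t * (1 - e) - (1 - e)"
        using dvd_mult[OF ee, of "int p - 1"] by (simp add: t_def algebra_simps)
      then have "f y [^]\<^bsub>H\<^esub> (t * (1 - e)) = f y [^]\<^bsub>H\<^esub> (1 - e)"
        by (rule H.int_pow_cong[OF HN[OF fc[OF yc]]])
      then show ?thesis using ft[OF yc] fc[OF yc] xt[OF y] by (simp add: H.int_pow_pow)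
    qed
    have "f (x [^]\<^bsub>G\<^esub> (int p ^ i)) [^]\<^bsub>H\<^esub> (1 - e) = f x [^]\<^bsub>H\<^esub> (1 - e)" for i
    proof (induction i)
      case (Suc i)
      have "x [^]\<^bsub>G\<^esub> (int p ^ Suc i) = (x [^]\<^bsub>G\<^esub> (int p ^ i)) [^]\<^bsub>G\<^esub> int p"
        using G.torsion_carrier[OF x] by (simp add: G.int_pow_pow mult.commute)
      then show ?case using step[OF pow_iter[OF x]] Suc by simp
    qed (use G.torsion_carrier[OF x] in simp)
    from this[of K] show ?thesis
      using x by (simp add: z_def G.in_torsion_int_iff q_def)
  qed
  have split: "w [^]\<^bsub>H\<^esub> e \<otimes>\<^bsub>H\<^esub> w [^]\<^bsub>H\<^esub> (1 - e) = w" if "w \<in> carrier H" for w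
    using that H.int_pow_mult[OF that, of e "1 - e"] by simp
  have inj': "inj_on f' (torsion G q)"
  proof (rule inj_onI)
    fix x y assume xy: "x \<in> torsion G q" "y \<in> torsion G q" "f' x = f' y"
    have dec: "f w = f' w \<otimes>\<^bsub>H\<^esub> z [^]\<^bsub>H\<^esub> (1 - e)" if w: "w \<in> torsion G q" for w
      unfolding f'_def rest[OF w, symmetric] by (rule split[OF fc[OF G.torsion_carrier[OF w]], symmetric])
    have "f x = f y" using dec[OF xy(1)] dec[OF xy(2)] xy(3) by simp
    then show "x = y" using inj xy(1,2) G.torsion_carrier by (meson inj_onD)
  qed
  have one: "f' \<one>\<^bsub>G\<^esub> = \<one>\<^bsub>H\<^esub>"
  proof -
    let ?g = "f' \<one>\<^bsub>G\<^esub>"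
    have gc: "?g \<in> carrier H" using f'q[OF G.one_closed] H.torsion_carrier by blast
    have g: "?g [^]\<^bsub>H\<^esub> int p = ?g" using f'p[OF G.one_in_torsion] by simp
    have "?g [^]\<^bsub>H\<^esub> (int p ^ i) = ?g" for i
    proof (induction i)
      case (Suc i)
      have "?g [^]\<^bsub>H\<^esub> (int p ^ Suc i) = (?g [^]\<^bsub>H\<^esub> (int p ^ i)) [^]\<^bsub>H\<^esub> int p"
        using gc by (simp add: H.int_pow_pow mult.commute)
      then show ?case using Suc g by simp
    qed (use gc in simp)
    from this[of K] show ?thesis using f'q[OF G.one_closed] by (simp add: H.in_torsion_int_iff q_def)
  qed
  have ze: "z [^]\<^bsub>H\<^esub> e = \<one>\<^bsub>H\<^esub>" using one by (simp add: f'_def z_def)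
  have zm: "z \<in> torsion H m"
  proof -
    have "int m = u * int N + e * int m"
    proof -
      have "int m = (u * int q + v * int m) * int m" using uv by simp
      then show ?thesis by (simp add: Nint e_def algebra_simps)
    qed
    then have "int m - e * int m = u * int N" by linarith
    then have "int N dvd int m - e * int m" by (simp only: dvd_triv_right)
    then have "z [^]\<^bsub>H\<^esub> int m = z [^]\<^bsub>H\<^esub> (e * int m)" by (rule H.int_pow_cong[OF HN[OF zc]])
    also have "\<dots> = (z [^]\<^bsub>H\<^esub> e) [^]\<^bsub>H\<^esub> int m" using zc by (simp add: H.int_pow_pow)
    finally show ?thesis using zc ze by (simp add: H.in_torsion_int_iff)
  qed
  have "f' ` torsion G q = torsion H q"
  proof (intro equalityI subsetI)
    fix w assume "w \<in> f' ` torsion G q"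
    then show "w \<in> torsion H q" using f'q G.torsion_carrier by blast
  next
    fix w assume w: "w \<in> torsion H q"
    have wc: "w \<in> carrier H" using w H.torsion_carrier by blast
    have "coprime (H.ord w) (H.ord z)"
      using w zm coq by (auto simp: H.torsion_iff_ord intro: coprime_divisors)
    then have comm: "w \<otimes>\<^bsub>H\<^esub> z = z \<otimes>\<^bsub>H\<^esub> w" by (rule H.coprime_ord_commute[OF wc zc])
    have "w \<otimes>\<^bsub>H\<^esub> z \<in> f ` carrier G" using wc zc img by simp
    then obtain y where y: "y \<in> carrier G" "f y = w \<otimes>\<^bsub>H\<^esub> z" by force
    have ti: "f (y [^]\<^bsub>G\<^esub> (t ^ i)) = w [^]\<^bsub>H\<^esub> (int p ^ i) \<otimes>\<^bsub>H\<^esub> z" for i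
    proof (induction i)
      case (Suc i)
      have wi: "w [^]\<^bsub>H\<^esub> (int p ^ i) \<in> torsion H q" using H.torsion_pow[OF w] .
      have "coprime (H.ord (w [^]\<^bsub>H\<^esub> (int p ^ i))) (H.ord z)"
        using wi zm coq by (auto simp: H.torsion_iff_ord intro: coprime_divisors)
      then have comm: "w [^]\<^bsub>H\<^esub> (int p ^ i) \<otimes>\<^bsub>H\<^esub> z = z \<otimes>\<^bsub>H\<^esub> w [^]\<^bsub>H\<^esub> (int p ^ i)"
        using H.coprime_ord_commute H.torsion_carrier[OF wi] zc by blast
      have "f (y [^]\<^bsub>G\<^esub> (t ^ Suc i)) = f ((y [^]\<^bsub>G\<^esub> (t ^ i)) [^]\<^bsub>G\<^esub> t)"
        using y by (simp add: G.int_pow_pow mult.commute)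
      also have "\<dots> = (w [^]\<^bsub>H\<^esub> (int p ^ i) \<otimes>\<^bsub>H\<^esub> z) [^]\<^bsub>H\<^esub> t" using ft y Suc by simp
      also have "\<dots> = (w [^]\<^bsub>H\<^esub> (int p ^ i)) [^]\<^bsub>H\<^esub> int p \<otimes>\<^bsub>H\<^esub> z"
        using H.int_pow_mult_distrib[OF comm] H.torsion_carrier[OF wi] zc zt xtH[OF wi] by simp
      finally show ?case using wc by (simp add: H.int_pow_pow mult.commute)
    qed (use y wc zc in simp)
    have "w [^]\<^bsub>H\<^esub> (int p ^ K) = \<one>\<^bsub>H\<^esub>" using w by (simp add: H.in_torsion_int_iff q_def)
    then have "f (y [^]\<^bsub>G\<^esub> (t ^ K)) = f \<one>\<^bsub>G\<^esub>" using ti[of K] zc by (simp add: z_def)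
    then have "y [^]\<^bsub>G\<^esub> (t ^ K) = \<one>\<^bsub>G\<^esub>" using inj y by (simp add: inj_on_eq_iff)
    then have "int (G.ord y) dvd t ^ K" using G.int_pow_eq_id y by blast
    moreover have "coprime (t ^ K) (int m)"
    proof -
      have "[t = 1] (mod int m)" by (simp add: t_def e_def cong_iff_dvd_diff)
      then have "coprime t (int m)" using cong_imp_coprime[of 1 t "int m"] cong_sym by (metis coprime_1_left)
      then show ?thesis by simp
    qed
    ultimately have "coprime (int (G.ord y)) (int m)" by (meson coprime_divisors dvd_refl)
    then have "coprime (G.ord y) m" by simp
    moreover have "G.ord y dvd q * m" using GN[OF y(1)] m(1) by (simp add: G.torsion_iff_ord)
    ultimately have "y \<in> torsion G q" using y by (simp add: G.torsion_iff_ord coprime_dvd_mult_left_iff)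
    moreover have "f' y = w"
    proof -
      have "f' y = w [^]\<^bsub>H\<^esub> e \<otimes>\<^bsub>H\<^esub> z [^]\<^bsub>H\<^esub> e"
        using H.int_pow_mult_distrib[OF comm wc zc] y by (simp add: f'_def)
      moreover have "w [^]\<^bsub>H\<^esub> e = w [^]\<^bsub>H\<^esub> (1::int)"
        using e1 by (intro H.int_pow_cong[OF w]) (metis dvd_diff_commute dvd_triv_right)
      ultimately show ?thesis using ze wc by simp
    qed
    ultimately show "w \<in> f' ` torsion G q" by blast
  qed
  then have bij': "bij_betw f' (torsion G q) (torsion H q)" using inj' by (simp add: bij_betw_def)
  have closed: "d dvd q" if "d dvd p * q" "d dvd N" for d
  proof -
    have "d dvd gcd (q * p) (q * m)" using that m by (simp add: mult.commute)
    also have "gcd (q * p) (q * m) = q" using co by (simp add: gcd_mult_distrib_nat[symmetric])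
    finally show ?thesis .
  qed
  show ?thesis
  proof (rule torsion_bij_root_tree[OF p bij' f'p one _ _ G.one_in_torsion, unfolded one])
    fix x assume x: "x \<in> carrier G" "x [^]\<^bsub>G\<^esub> int p \<in> torsion G q"
    then have "x \<in> torsion G (p * q)"
      by (simp add: G.in_torsion_int_iff G.int_pow_pow)
    then show "x \<in> torsion G q" using closed[of "G.ord x"] GN[OF x(1)] by (simp add: G.torsion_iff_ord)
  next
    fix x assume x: "x \<in> carrier H" "x [^]\<^bsub>H\<^esub> int p \<in> torsion H q"
    then have "x \<in> torsion H (p * q)"
      by (simp add: H.in_torsion_int_iff H.int_pow_pow)
    then show "x \<in> torsion H q" using closed[of "H.ord x"] HN[OF x(1)] by (simp add: H.torsion_iff_ord)
  qed
qed

end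

section \<open>Power-compatible bijections from trees of roots\<close>

definition power_closed :: "('a, 'm) monoid_scheme \<Rightarrow> 'a set \<Rightarrow> bool" where
  "power_closed G S \<longleftrightarrow> \<one>\<^bsub>G\<^esub> \<in> S \<and> (\<forall>x\<in>S. \<forall>k::int. x [^]\<^bsub>G\<^esub> k \<in> S)"

text \<open>
  The last condition compares trees of depth \<open>K - j\<close> at elements of order \<open>p ^
  j\<close>. These are the full subtrees within the elements of order at most \<open>p ^ K\<close>,
  and one level is lost when passing to a root.
\<close>

definition partial_power_iso ::
  "nat \<Rightarrow> nat \<Rightarrow> ('a, 'm) monoid_scheme \<Rightarrow> ('b, 'n) monoid_scheme \<Rightarrow> 'a set \<Rightarrow> ('a \<Rightarrow> 'b) \<Rightarrow> bool" where
  "partial_power_iso p K G H S f \<longleftrightarrow>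
     S \<subseteq> torsion G (p ^ K) \<and> power_closed G S \<and> inj_on f S \<and> f ` S \<subseteq> torsion H (p ^ K) \<and>
     (\<forall>x\<in>S. \<forall>k::int. f (x [^]\<^bsub>G\<^esub> k) = f x [^]\<^bsub>H\<^esub> k) \<and>
     (\<forall>x\<in>S. \<forall>j n. group.ord G x = p ^ j \<longrightarrow> j + n = K \<longrightarrow> root_tree H p n (f x) = root_tree G p n x)"

lemma (in fin_group) exists_boundary:
  assumes p: "prime p" and S: "power_closed G S" and x: "x \<in> torsion G (p ^ K)" "x \<notin> S"
  obtains y where "y \<in> torsion G (p ^ K)" "y \<notin> S" "y [^] p \<in> S"
proof -
  have xc: "x \<in> carrier G" using x torsion_carrier by blast
  let ?P = "\<lambda>i. x [^] (p ^ i) \<in> S"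
  have "?P K" using x S by (simp add: torsion_def power_closed_def)
  moreover have "\<not> ?P 0" using x xc by simp
  ultimately obtain i where i: "\<not> ?P i" "?P (Suc i)"
    using ex_least_nat_less[of ?P K] by (metis less_irrefl order_refl)
  have "x [^] (p ^ i) \<in> torsion G (p ^ K)"
    using torsion_pow[OF x(1), of "int (p ^ i)"] by (simp only: int_pow_int)
  moreover have "(x [^] (p ^ i)) [^] p \<in> S" using i(2) xc by (simp add: nat_pow_pow mult.commute)
  ultimately show ?thesis using that i(1) by blast
qed

context fin_group_pair
begin

lemma partial_power_iso_one:
  assumes "partial_power_iso p K G H S f"
  shows "f \<one>\<^bsub>G\<^esub> = \<one>\<^bsub>H\<^esub>"
proof -
  have "f (\<one>\<^bsub>G\<^esub> [^]\<^bsub>G\<^esub> (0::int)) = f \<one>\<^bsub>G\<^esub> [^]\<^bsub>H\<^esub> (0::int)"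
    using assms unfolding partial_power_iso_def power_closed_def by blast
  then show ?thesis by simp
qed

lemma partial_power_iso_ord:
  assumes f: "partial_power_iso p K G H S f" and x: "x \<in> S"
  shows "H.ord (f x) = G.ord x"
proof -
  have xc: "x \<in> carrier G" "f x \<in> carrier H"
    using f x by (auto simp: partial_power_iso_def torsion_def)
  have "f x [^]\<^bsub>H\<^esub> k = \<one>\<^bsub>H\<^esub> \<longleftrightarrow> x [^]\<^bsub>G\<^esub> k = \<one>\<^bsub>G\<^esub>" for k :: nat
  proof -
    have S: "x [^]\<^bsub>G\<^esub> (int k) \<in> S" "\<one>\<^bsub>G\<^esub> \<in> S" "inj_on f S" "f (x [^]\<^bsub>G\<^esub> int k) = f x [^]\<^bsub>H\<^esub> int k"
      using f x by (auto simp: partial_power_iso_def power_closed_def)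
    show ?thesis using inj_on_eq_iff[OF S(3,1,2)] S(4) partial_power_iso_one[OF f] by (simp add: int_pow_int)
  qed
  then show ?thesis using H.ord_unique[OF xc(2)] G.pow_eq_id[OF xc(1)] by auto
qed

text \<open>
  The roots of \<open>x\<close> and of \<open>f x\<close> have the same multiset of types, and
  \<open>f\<close> matches those inside its domain with those inside its range. Cancelling these
  leaves an equality for the other roots.
\<close>

lemma partial_power_iso_missing_roots:
  assumes p: "prime p" and f: "partial_power_iso p K G H S f" and x: "x \<in> S"
    and ox: "G.ord x = p ^ j" and n: "Suc j + n = K"
  shows "image_mset (root_tree H p n) (mset_set (proper_roots H p (f x) - f ` S)) =
    image_mset (root_tree G p n) (mset_set (proper_roots G p x - S))"
proof -
  have closed: "\<And>x k. x \<in> S \<Longrightarrow> x [^]\<^bsub>G\<^esub> (k::int) \<in> S" and oneS: "\<one>\<^bsub>G\<^esub> \<in> S" and inj: "inj_on f S"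
    and pow: "\<And>x k. x \<in> S \<Longrightarrow> f (x [^]\<^bsub>G\<^esub> (k::int)) = f x [^]\<^bsub>H\<^esub> k"
    and tree: "\<And>x j n. x \<in> S \<Longrightarrow> G.ord x = p ^ j \<Longrightarrow> j + n = K \<Longrightarrow> root_tree H p n (f x) = root_tree G p n x"
    and car: "S \<subseteq> torsion G (p ^ K)" "f ` S \<subseteq> torsion H (p ^ K)"
    using f by (auto simp: partial_power_iso_def power_closed_def)
  let ?A = "proper_roots G p x" and ?B = "proper_roots H p (f x)"
  have "root_tree H p (Suc n) (f x) = root_tree G p (Suc n) x"
    using tree[OF x ox, of "Suc n"] n by simp
  then have all: "image_mset (root_tree H p n) (mset_set ?B) = image_mset (root_tree G p n) (mset_set ?A)"
    by simp
  have iff: "f y \<in> ?B \<longleftrightarrow> y \<in> ?A" if y: "y \<in> S" for y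
  proof -
    have c: "y \<in> carrier G" "f y \<in> carrier H" using y car G.torsion_carrier H.torsion_carrier by blast+
    have "f y = \<one>\<^bsub>H\<^esub> \<longleftrightarrow> y = \<one>\<^bsub>G\<^esub>"
      using inj_on_eq_iff[OF inj y oneS] partial_power_iso_one[OF f] by simp
    moreover have "f y [^]\<^bsub>H\<^esub> p = f x \<longleftrightarrow> y [^]\<^bsub>G\<^esub> p = x"
      using inj_on_eq_iff[OF inj closed[OF y, of "int p"] x] pow[OF y, of "int p"] by (simp add: int_pow_int)
    ultimately show ?thesis using c by (auto simp: proper_roots_def)
  qed
  have "f ` (?A \<inter> S) = ?B \<inter> f ` S" using iff by blast
  then have "bij_betw f (?A \<inter> S) (?B \<inter> f ` S)" using inj by (auto simp: bij_betw_def intro: inj_on_subset)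
  then have inS: "image_mset (root_tree H p n) (mset_set (?B \<inter> f ` S))
      = image_mset (root_tree G p n) (mset_set (?A \<inter> S))"
  proof (rule image_mset_mset_set_eqI)
    fix y assume "y \<in> ?A \<inter> S"
    then show "root_tree H p n (f y) = root_tree G p n y"
      using tree[of y "Suc j" n] G.ord_proper_root[OF p _ ox, of y] n by simp
  qed
  have split: "mset_set A = mset_set (A \<inter> T) + mset_set (A - T)" if "finite A" for A T :: "'x set"
    using that mset_set_Union[of "A \<inter> T" "A - T"] by (simp add: Int_Diff_Un Int_Diff_disjoint)
  have "image_mset (root_tree H p n) (mset_set (?B \<inter> f ` S)) + image_mset (root_tree H p n) (mset_set (?B - f ` S))
    = image_mset (root_tree G p n) (mset_set (?A \<inter> S)) + image_mset (root_tree G p n) (mset_set (?A - S))"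
    using all split[OF G.finite_proper_roots, of p x S] split[OF H.finite_proper_roots, of p "f x" "f ` S"]
    by (metis image_mset_union)
  then show ?thesis unfolding inS by simp
qed

end

context fin_group
begin

text \<open>
  If \<open>k\<close> is prime to \<open>p\<close>, then \<open>y\<close> is itself a power of
  \<open>y\<^sup>k\<close>. So the powers of \<open>y\<close> that lie in \<open>S\<close> are the
  powers of \<open>y\<^sup>p\<close>.
\<close>

lemma pow_prime_dvd_iff:
  assumes p: "prime p" and S: "power_closed G S" and y: "y \<in> torsion G (p ^ K)" "y \<notin> S" "y [^] p \<in> S"
  shows "y [^] (k::int) \<in> S \<longleftrightarrow> int p dvd k"
proof
  assume "int p dvd k"
  then obtain l where l: "k = int p * l" by auto
  have "(y [^] p) [^] l \<in> S" using S y(3) by (simp add: power_closed_def)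
  then show "y [^] k \<in> S"
    using torsion_carrier[OF y(1)] by (simp add: l int_pow_pow flip: int_pow_int)
next
  assume k: "y [^] k \<in> S"
  show "int p dvd k"
  proof (rule ccontr)
    assume "\<not> int p dvd k"
    then have "coprime k (int p)" using p by (metis coprime_commute prime_imp_coprime prime_nat_int_transfer)
    then obtain v where v: "int (p ^ K) dvd k * v - 1" using unit_inverse_mod_prime_power[OF p] by metis
    have "(y [^] k) [^] v = y"
      using int_pow_cong[OF y(1) v] torsion_carrier[OF y(1)] by (simp add: int_pow_pow)
    then show False using S k y(2) by (metis power_closed_def)
  qed
qed

end

context fin_group_pair
begin

text \<open>
  Choose \<open>y\<close> outside of \<open>S\<close> with \<open>x = y\<^sup>p\<close> in
  \<open>S\<close>, and a root \<open>y'\<close> of \<open>f x\<close> outside of the range of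
  \<open>f\<close> with the same type as \<open>y\<close>. Sending \<open>y\<^sup>k\<close> to
  \<open>y'\<^sup>k\<close> is well defined since \<open>y\<close> and \<open>y'\<close> have the
  same order, and it is consistent with \<open>f\<close> because only the powers of \<open>x\<close>
  are already in \<open>S\<close>.
\<close>

lemma partial_power_iso_extend:
  assumes p: "prime p" and f: "partial_power_iso p K G H S f" and ne: "S \<noteq> torsion G (p ^ K)"
  obtains S' f' where "partial_power_iso p K G H S' f'" "S \<subset> S'"
proof -
  have cl: "power_closed G S" and inj: "inj_on f S"
    and pow: "\<And>x k. x \<in> S \<Longrightarrow> f (x [^]\<^bsub>G\<^esub> (k::int)) = f x [^]\<^bsub>H\<^esub> k"
    and tree: "\<And>x j n. x \<in> S \<Longrightarrow> G.ord x = p ^ j \<Longrightarrow> j + n = K \<Longrightarrow> root_tree H p n (f x) = root_tree G p n x"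
    and car: "S \<subseteq> torsion G (p ^ K)" "f ` S \<subseteq> torsion H (p ^ K)"
    using f by (auto simp: partial_power_iso_def)
  have clS: "x [^]\<^bsub>G\<^esub> (k::int) \<in> S" if "x \<in> S" for x k using cl that by (simp add: power_closed_def)
  have cl': "power_closed H (f ` S)"
    using cl pow partial_power_iso_one[OF f] unfolding power_closed_def by (metis (no_types, opaque_lifting) imageE imageI)
  obtain y where y: "y \<in> torsion G (p ^ K)" "y \<notin> S" "y [^]\<^bsub>G\<^esub> p \<in> S"
    using G.exists_boundary[OF p cl] ne car by blast
  have yc: "y \<in> carrier G" using y G.torsion_carrier by blast
  define x where "x = y [^]\<^bsub>G\<^esub> p"
  have xS: "x \<in> S" using y by (simp add: x_def)
  have "y \<noteq> \<one>\<^bsub>G\<^esub>" using y cl by (auto simp: power_closed_def)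
  then have yr: "y \<in> proper_roots G p x - S" using y yc by (simp add: proper_roots_def x_def)
  obtain j where j: "G.ord x = p ^ j"
    using xS car G.torsion_iff_ord divides_primepow_nat[OF p] by (metis subsetD)
  have oy: "G.ord y = p ^ Suc j" using G.ord_proper_root[OF p _ j] yr by blast
  then have "p ^ Suc j dvd p ^ K" using y by (simp only: G.torsion_iff_ord)
  then have "Suc j \<le> K" using p power_dvd_imp_le prime_gt_1_nat by blast
  then obtain n where n: "Suc j + n = K" using le_Suc_ex by blast
  have "root_tree G p n y \<in># image_mset (root_tree G p n) (mset_set (proper_roots G p x - S))"
    using yr by simp
  then have "root_tree G p n y \<in># image_mset (root_tree H p n) (mset_set (proper_roots H p (f x) - f ` S))"
    unfolding partial_power_iso_missing_roots[OF p f xS j n] .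
  then obtain y' where y': "y' \<in> proper_roots H p (f x)" "y' \<notin> f ` S" "root_tree H p n y' = root_tree G p n y"
    by auto
  have yc': "y' \<in> carrier H" using y' by (simp add: proper_roots_def)
  have "H.ord (f x) = p ^ j" using partial_power_iso_ord[OF f xS] j by simp
  then have oy': "H.ord y' = p ^ Suc j" using H.ord_proper_root[OF p y'(1)] by blast
  then have ty': "y' \<in> torsion H (p ^ K)" using yc' \<open>p ^ Suc j dvd p ^ K\<close> by (simp only: H.torsion_iff_ord)
  have y'p: "y' [^]\<^bsub>H\<^esub> p \<in> f ` S" using y'(1) xS by (simp add: proper_roots_def)
  note yk = G.pow_prime_dvd_iff[OF p cl y]
  note yk' = H.pow_prime_dvd_iff[OF p cl' ty' y'(2) y'p]
  have same: "y [^]\<^bsub>G\<^esub> (a::int) = y [^]\<^bsub>G\<^esub> b \<longleftrightarrow> y' [^]\<^bsub>H\<^esub> a = y' [^]\<^bsub>H\<^esub> b" for a b :: int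
    unfolding G.int_pow_eq[OF yc] H.int_pow_eq[OF yc'] oy oy' by (rule refl)
  define f' where "f' = (\<lambda>g. if g \<in> S then f g else y' [^]\<^bsub>H\<^esub> (SOME k::int. g = y [^]\<^bsub>G\<^esub> k))"
  have f'S: "f' g = f g" if "g \<in> S" for g using that by (simp add: f'_def)
  have f'y: "f' (y [^]\<^bsub>G\<^esub> k) = y' [^]\<^bsub>H\<^esub> k" for k :: int
  proof (cases "int p dvd k")
    case True
    then obtain l where l: "k = int p * l" by auto
    have "y [^]\<^bsub>G\<^esub> k = x [^]\<^bsub>G\<^esub> l" using yc by (simp add: l x_def G.int_pow_pow flip: int_pow_int)
    then have "f' (y [^]\<^bsub>G\<^esub> k) = f x [^]\<^bsub>H\<^esub> l" using f'S[OF clS[OF xS]] pow[OF xS] by simp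
    also have "\<dots> = y' [^]\<^bsub>H\<^esub> k"
      using H.proper_root_int[OF y'(1)] yc' by (simp add: l flip: H.int_pow_pow)
    finally show ?thesis .
  next
    case False
    let ?l = "SOME l::int. y [^]\<^bsub>G\<^esub> k = y [^]\<^bsub>G\<^esub> l"
    have "y [^]\<^bsub>G\<^esub> k = y [^]\<^bsub>G\<^esub> ?l" by (rule someI) (rule refl)
    then show ?thesis using False yk same by (simp add: f'_def)
  qed
  define S' where "S' = S \<union> cyc G y"
  have cases: "\<exists>k. g = y [^]\<^bsub>G\<^esub> (k::int) \<and> \<not> int p dvd k" if "g \<in> S'" "g \<notin> S" for g
    using that yk by (auto simp: S'_def cyc_def)
  have S'pow: "g [^]\<^bsub>G\<^esub> (k::int) \<in> S' \<and> f' (g [^]\<^bsub>G\<^esub> k) = f' g [^]\<^bsub>H\<^esub> k" if g: "g \<in> S'" for g k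
  proof (cases "g \<in> S")
    case True
    then show ?thesis using clS pow f'S by (simp add: S'_def)
  next
    case False
    then obtain l where l: "g = y [^]\<^bsub>G\<^esub> (l::int)" using cases g by blast
    then have gk: "g [^]\<^bsub>G\<^esub> k = y [^]\<^bsub>G\<^esub> (l * k)" using yc by (simp add: G.int_pow_pow)
    then have "g [^]\<^bsub>G\<^esub> k \<in> S'" using G.pow_in_cyc by (simp add: S'_def)
    moreover have "f' (g [^]\<^bsub>G\<^esub> k) = f' g [^]\<^bsub>H\<^esub> k"
      unfolding gk f'y unfolding l f'y using yc' by (simp add: H.int_pow_pow)
    ultimately show ?thesis by blast
  qed
  have mixed: "f' g \<noteq> f' h" if g: "g \<in> S" and h: "h \<in> S'" "h \<notin> S" for g h
  proof -
    obtain k where k: "h = y [^]\<^bsub>G\<^esub> (k::int)" "\<not> int p dvd k" using cases[OF h] by blast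
    then have "f' h \<notin> f ` S" using yk' f'y by simp
    moreover have "f' g \<in> f ` S" using g f'S by simp
    ultimately show ?thesis by metis
  qed
  have "inj_on f' S'"
  proof (rule inj_onI)
    fix g h assume gh: "g \<in> S'" "h \<in> S'" "f' g = f' h"
    consider "g \<in> S" "h \<in> S" | "g \<notin> S" "h \<notin> S" using mixed gh by metis
    then show "g = h"
    proof cases
      case 1
      then show ?thesis using gh f'S inj by (simp add: inj_on_eq_iff)
    next
      case 2
      then obtain k l where "g = y [^]\<^bsub>G\<^esub> (k::int)" "h = y [^]\<^bsub>G\<^esub> (l::int)" using cases gh by meson
      then show ?thesis using gh(3) same f'y by simp
    qed
  qed
  moreover have "S' \<subseteq> torsion G (p ^ K)" using car G.torsion_pow[OF y(1)] by (auto simp: S'_def cyc_def)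
  moreover have "power_closed G S'" using S'pow cl by (auto simp: power_closed_def S'_def)
  moreover have "f' ` S' \<subseteq> torsion H (p ^ K)"
  proof (intro image_subsetI)
    fix g assume g: "g \<in> S'"
    show "f' g \<in> torsion H (p ^ K)"
    proof (cases "g \<in> S")
      case True
      then show ?thesis using car f'S by auto
    next
      case False
      then show ?thesis using cases[OF g] f'y H.torsion_pow[OF ty'] by auto
    qed
  qed
  moreover have "root_tree H p i (f' g) = root_tree G p i g"
    if g: "g \<in> S'" and og: "G.ord g = p ^ l" and i: "l + i = K" for g l i
  proof (cases "g \<in> S")
    case True
    then show ?thesis using tree[OF True og i] f'S by simp
  next
    case False
    then obtain k where k: "g = y [^]\<^bsub>G\<^esub> (k::int)" "\<not> int p dvd k" using cases g by blast
    have co: "coprime k (int p)"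
      using p k(2) by (metis coprime_commute prime_imp_coprime prime_nat_int_transfer)
    have "G.ord g = G.ord y"
    proof (rule dvd_antisym)
      show "G.ord g dvd G.ord y" using G.ord_dvd_of_in_cyc[OF yc] G.pow_in_cyc k by blast
      obtain v where v: "int (p ^ K) dvd k * v - 1" using G.unit_inverse_mod_prime_power[OF p co] by metis
      have "g [^]\<^bsub>G\<^esub> v = y" using G.int_pow_cong[OF y(1) v] yc k by (simp add: G.int_pow_pow)
      then have "y \<in> cyc G g" using G.pow_in_cyc by metis
      then show "G.ord y dvd G.ord g" using G.ord_dvd_of_in_cyc k yc by simp
    qed
    then have "l = Suc j" using og oy p by (metis power_inject_exp prime_gt_1_nat)
    then have "i = n" using i n by simp
    then show ?thesis
      using G.root_tree_unit_pow[OF p co y(1), of n] H.root_tree_unit_pow[OF p co ty', of n] y'(3) f'y k by simp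
  qed
  ultimately have "partial_power_iso p K G H S' f'"
    using S'pow by (simp add: partial_power_iso_def)
  moreover have "S \<subset> S'" using y(2) G.self_in_cyc[OF yc] by (auto simp: S'_def)
  ultimately show ?thesis using that by blast
qed

lemma partial_power_iso_total:
  assumes p: "prime p"
  shows "partial_power_iso p K G H S f \<Longrightarrow> \<exists>f'. partial_power_iso p K G H (torsion G (p ^ K)) f'"
proof (induction "card (torsion G (p ^ K) - S)" arbitrary: S f rule: less_induct)
  case less
  have fin: "finite (torsion G (p ^ K))"
    using finite_subset[OF _ G.finite_carrier] G.torsion_carrier by blast
  show ?case
  proof (cases "S = torsion G (p ^ K)")
    case True
    then show ?thesis using less by blast
  next
    case False
    obtain S' f' where S': "partial_power_iso p K G H S' f'" "S \<subset> S'"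
      using partial_power_iso_extend[OF p less.prems False] .
    have "S' \<subseteq> torsion G (p ^ K)" using S'(1) by (simp add: partial_power_iso_def)
    then have "torsion G (p ^ K) - S' \<subset> torsion G (p ^ K) - S" using S'(2) by blast
    then have "card (torsion G (p ^ K) - S') < card (torsion G (p ^ K) - S)"
      using fin by (intro psubset_card_mono) auto
    then show ?thesis using less.hyps S'(1) by blast
  qed
qed

text \<open>
  An element outside of the range could be chosen as a root of some \<open>f x\<close>, but all
  roots of \<open>x\<close> are in the domain, so no root of \<open>f x\<close> is missing.
\<close>

lemma partial_power_iso_surj:
  assumes p: "prime p" and f: "partial_power_iso p K G H (torsion G (p ^ K)) f"
  shows "f ` torsion G (p ^ K) = torsion H (p ^ K)"
proof (rule ccontr)
  let ?S = "torsion G (p ^ K)"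
  assume "f ` ?S \<noteq> torsion H (p ^ K)"
  moreover have sub: "f ` ?S \<subseteq> torsion H (p ^ K)" using f by (simp add: partial_power_iso_def)
  ultimately obtain z where z: "z \<in> torsion H (p ^ K)" "z \<notin> f ` ?S" by blast
  have pow: "\<And>x k. x \<in> ?S \<Longrightarrow> f (x [^]\<^bsub>G\<^esub> (k::int)) = f x [^]\<^bsub>H\<^esub> k"
    using f by (auto simp: partial_power_iso_def)
  have "power_closed H (f ` ?S)"
    unfolding power_closed_def
  proof (intro conjI ballI allI)
    show "\<one>\<^bsub>H\<^esub> \<in> f ` ?S" using partial_power_iso_one[OF f] G.one_in_torsion by (metis imageI)
    fix w and k :: int assume "w \<in> f ` ?S"
    then show "w [^]\<^bsub>H\<^esub> k \<in> f ` ?S" using pow[symmetric] G.torsion_pow by auto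
  qed
  then obtain y where y: "y \<in> torsion H (p ^ K)" "y \<notin> f ` ?S" "y [^]\<^bsub>H\<^esub> p \<in> f ` ?S"
    using H.exists_boundary[OF p _ z] by blast
  then obtain x where x: "x \<in> ?S" "y [^]\<^bsub>H\<^esub> p = f x" by blast
  have "y \<noteq> \<one>\<^bsub>H\<^esub>" using y(2) partial_power_iso_one[OF f] G.one_in_torsion by (metis imageI)
  then have yr: "y \<in> proper_roots H p (f x) - f ` ?S"
    using y x H.torsion_carrier by (simp add: proper_roots_def)
  obtain j where j: "G.ord x = p ^ j"
    using x G.torsion_iff_ord divides_primepow_nat[OF p] by metis
  have "H.ord (f x) = p ^ j" using partial_power_iso_ord[OF f x(1)] j by simp
  then have "H.ord y = p ^ Suc j" using H.ord_proper_root[OF p] yr by blast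
  then have dvd: "p ^ Suc j dvd p ^ K" using y by (simp only: H.torsion_iff_ord)
  then have "Suc j \<le> K" using p power_dvd_imp_le prime_gt_1_nat by blast
  then obtain n where n: "Suc j + n = K" using le_Suc_ex by blast
  have none: "proper_roots G p x - ?S = {}"
  proof -
    have "w \<in> ?S" if w: "w \<in> proper_roots G p x" for w
      using G.ord_proper_root[OF p w j] dvd w by (simp only: G.torsion_iff_ord) (simp add: proper_roots_def)
    then show ?thesis by blast
  qed
  then have "image_mset (root_tree H p n) (mset_set (proper_roots H p (f x) - f ` ?S)) = {#}"
    using partial_power_iso_missing_roots[OF p f x(1) j n] unfolding none by simp
  then have "proper_roots H p (f x) - f ` ?S = {}" by (simp add: mset_set_empty_iff)
  then show False using yr by blast
qed

definition power_iso_on :: "nat \<Rightarrow> ('a \<Rightarrow> 'b) \<Rightarrow> bool" where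
  "power_iso_on n f \<longleftrightarrow> bij_betw f (torsion G n) (torsion H n) \<and>
     (\<forall>x\<in>torsion G n. \<forall>t::int. f (x [^]\<^bsub>G\<^esub> t) = f x [^]\<^bsub>H\<^esub> t)"

lemma prime_power_iso_on:
  assumes p: "prime p" and tree: "root_tree H p K \<one>\<^bsub>H\<^esub> = root_tree G p K \<one>\<^bsub>G\<^esub>"
  shows "\<exists>f. power_iso_on (p ^ K) f"
proof -
  have j0: "j = 0" if "Suc 0 = p ^ j" for j
    using that[symmetric] prime_gt_1_nat[OF p] by simp
  have "partial_power_iso p K G H {\<one>\<^bsub>G\<^esub>} (\<lambda>_. \<one>\<^bsub>H\<^esub>)"
    using tree G.one_in_torsion H.one_in_torsion
    by (auto simp: partial_power_iso_def power_closed_def dest: j0)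
  then obtain f where f: "partial_power_iso p K G H (torsion G (p ^ K)) f"
    using partial_power_iso_total[OF p] by blast
  then have "power_iso_on (p ^ K) f"
    using partial_power_iso_surj[OF p f] by (auto simp: power_iso_on_def bij_betw_def partial_power_iso_def)
  then show ?thesis by blast
qed

end

section \<open>Gluing the primary parts\<close>

context nilpotent_fin_group_pair
begin

text \<open>
  With \<open>r + s = 1\<close>, where \<open>a\<close> divides \<open>r\<close> and
  \<open>b\<close> divides \<open>s\<close>, every \<open>g\<close> is the product of its
  \<open>a\<close>-part \<open>g\<^sup>s\<close> and its \<open>b\<close>-part
  \<open>g\<^sup>r\<close>, and \<open>f\<close> acts by \<open>fa\<close> and \<open>fb\<close> on
  the parts. That any \<open>a\<close>-torsion and \<open>b\<close>-torsion elements commute makes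
  every product of such elements an \<open>a * b\<close>-torsion element with these parts.
\<close>

lemma power_iso_on_mult:
  assumes co: "coprime a b" and fa: "power_iso_on a fa" and fb: "power_iso_on b fb"
  shows "\<exists>f. power_iso_on (a * b) f"
proof -
  obtain u v where uv: "u * int a + v * int b = 1"
    using bezout_int[of "int a" "int b"] co by (auto simp: coprime_iff_gcd_eq_1)
  define s where "s = v * int b"
  define r where "r = u * int a"
  have rs: "r + s = 1" using uv by (simp add: r_def s_def)
  have sa: "int a dvd s - 1" using rs by (metis add_diff_cancel_right' diff_add_cancel dvd_minus_iff dvd_triv_right minus_diff_eq r_def diff_add_eq add.commute)
  have rb: "int b dvd r - 1" using rs by (metis add_diff_cancel_right' diff_add_cancel dvd_minus_iff dvd_triv_right minus_diff_eq s_def diff_add_eq add.commute)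
  have ra: "int a dvd r" and sb: "int b dvd s" by (simp_all add: r_def s_def)
  note ba = fa[unfolded power_iso_on_def, THEN conjunct1] and pa = fa[unfolded power_iso_on_def, THEN conjunct2, rule_format]
  note bb = fb[unfolded power_iso_on_def, THEN conjunct1] and pb = fb[unfolded power_iso_on_def, THEN conjunct2, rule_format]
  have Gs: "g [^]\<^bsub>G\<^esub> s \<in> torsion G a" and Gr: "g [^]\<^bsub>G\<^esub> r \<in> torsion G b" if g: "g \<in> torsion G (a * b)" for g
  proof -
    have gc: "g \<in> carrier G" using g G.torsion_carrier by blast
    have "g [^]\<^bsub>G\<^esub> (s * int a) = \<one>\<^bsub>G\<^esub>" by (rule G.int_pow_eq_one[OF g]) (simp add: s_def)
    moreover have "g [^]\<^bsub>G\<^esub> (r * int b) = \<one>\<^bsub>G\<^esub>" by (rule G.int_pow_eq_one[OF g]) (simp add: r_def)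
    ultimately show "g [^]\<^bsub>G\<^esub> s \<in> torsion G a" "g [^]\<^bsub>G\<^esub> r \<in> torsion G b"
      using gc by (simp_all add: G.in_torsion_int_iff G.int_pow_pow)
  qed
  have Hs: "h [^]\<^bsub>H\<^esub> s \<in> torsion H a" and Hr: "h [^]\<^bsub>H\<^esub> r \<in> torsion H b" if h: "h \<in> torsion H (a * b)" for h
  proof -
    have hc: "h \<in> carrier H" using h H.torsion_carrier by blast
    have "h [^]\<^bsub>H\<^esub> (s * int a) = \<one>\<^bsub>H\<^esub>" by (rule H.int_pow_eq_one[OF h]) (simp add: s_def)
    moreover have "h [^]\<^bsub>H\<^esub> (r * int b) = \<one>\<^bsub>H\<^esub>" by (rule H.int_pow_eq_one[OF h]) (simp add: r_def)
    ultimately show "h [^]\<^bsub>H\<^esub> s \<in> torsion H a" "h [^]\<^bsub>H\<^esub> r \<in> torsion H b"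
      using hc by (simp_all add: H.in_torsion_int_iff H.int_pow_pow)
  qed
  have commG: "x \<otimes>\<^bsub>G\<^esub> y = y \<otimes>\<^bsub>G\<^esub> x" if "x \<in> torsion G a" "y \<in> torsion G b" for x y
    using that co by (auto simp: G.torsion_iff_ord intro!: G.coprime_ord_commute intro: coprime_divisors)
  have commH: "x \<otimes>\<^bsub>H\<^esub> y = y \<otimes>\<^bsub>H\<^esub> x" if "x \<in> torsion H a" "y \<in> torsion H b" for x y
    using that co by (auto simp: H.torsion_iff_ord intro!: H.coprime_ord_commute intro: coprime_divisors)
  have multG: "x \<otimes>\<^bsub>G\<^esub> y \<in> torsion G (a * b)" "(x \<otimes>\<^bsub>G\<^esub> y) [^]\<^bsub>G\<^esub> s = x" "(x \<otimes>\<^bsub>G\<^esub> y) [^]\<^bsub>G\<^esub> r = y"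
    if xy: "x \<in> torsion G a" "y \<in> torsion G b" for x y
  proof -
    have c: "x \<in> carrier G" "y \<in> carrier G" using xy G.torsion_carrier by blast+
    note d = G.int_pow_mult_distrib[OF commG[OF xy] c]
    show "x \<otimes>\<^bsub>G\<^esub> y \<in> torsion G (a * b)"
      using d[of "int (a * b)"] G.int_pow_eq_one[OF xy(1), of "int (a * b)"] G.int_pow_eq_one[OF xy(2), of "int (a * b)"] c
      by (simp add: G.in_torsion_int_iff)
    show "(x \<otimes>\<^bsub>G\<^esub> y) [^]\<^bsub>G\<^esub> s = x"
      using d[of s] G.int_pow_cong[OF xy(1) sa] G.int_pow_eq_one[OF xy(2) sb] c by simp
    show "(x \<otimes>\<^bsub>G\<^esub> y) [^]\<^bsub>G\<^esub> r = y"
      using d[of r] G.int_pow_cong[OF xy(2) rb] G.int_pow_eq_one[OF xy(1) ra] c by simp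
  qed
  have multH: "x \<otimes>\<^bsub>H\<^esub> y \<in> torsion H (a * b)" "(x \<otimes>\<^bsub>H\<^esub> y) [^]\<^bsub>H\<^esub> s = x" "(x \<otimes>\<^bsub>H\<^esub> y) [^]\<^bsub>H\<^esub> r = y"
    if xy: "x \<in> torsion H a" "y \<in> torsion H b" for x y
  proof -
    have c: "x \<in> carrier H" "y \<in> carrier H" using xy H.torsion_carrier by blast+
    note d = H.int_pow_mult_distrib[OF commH[OF xy] c]
    show "x \<otimes>\<^bsub>H\<^esub> y \<in> torsion H (a * b)"
      using d[of "int (a * b)"] H.int_pow_eq_one[OF xy(1), of "int (a * b)"] H.int_pow_eq_one[OF xy(2), of "int (a * b)"] c
      by (simp add: H.in_torsion_int_iff)
    show "(x \<otimes>\<^bsub>H\<^esub> y) [^]\<^bsub>H\<^esub> s = x"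
      using d[of s] H.int_pow_cong[OF xy(1) sa] H.int_pow_eq_one[OF xy(2) sb] c by simp
    show "(x \<otimes>\<^bsub>H\<^esub> y) [^]\<^bsub>H\<^esub> r = y"
      using d[of r] H.int_pow_cong[OF xy(2) rb] H.int_pow_eq_one[OF xy(1) ra] c by simp
  qed
  have splitG: "g [^]\<^bsub>G\<^esub> s \<otimes>\<^bsub>G\<^esub> g [^]\<^bsub>G\<^esub> r = g" if "g \<in> carrier G" for g
    using that G.int_pow_mult[OF that, of s r] rs by (simp add: add.commute)
  have splitH: "h [^]\<^bsub>H\<^esub> s \<otimes>\<^bsub>H\<^esub> h [^]\<^bsub>H\<^esub> r = h" if "h \<in> carrier H" for h
    using that H.int_pow_mult[OF that, of s r] rs by (simp add: add.commute)
  define f where "f = (\<lambda>g. fa (g [^]\<^bsub>G\<^esub> s) \<otimes>\<^bsub>H\<^esub> fb (g [^]\<^bsub>G\<^esub> r))"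
  have fab: "fa (g [^]\<^bsub>G\<^esub> s) \<in> torsion H a" "fb (g [^]\<^bsub>G\<^esub> r) \<in> torsion H b" if "g \<in> torsion G (a * b)" for g
    using Gs[OF that] Gr[OF that] ba bb bij_betw_apply by metis+
  have "inj_on f (torsion G (a * b))"
  proof (rule inj_onI)
    fix g h assume gh: "g \<in> torsion G (a * b)" "h \<in> torsion G (a * b)" "f g = f h"
    have "fa (g [^]\<^bsub>G\<^esub> s) = fa (h [^]\<^bsub>G\<^esub> s)" "fb (g [^]\<^bsub>G\<^esub> r) = fb (h [^]\<^bsub>G\<^esub> r)"
      using multH(2,3)[OF fab[OF gh(1)]] multH(2,3)[OF fab[OF gh(2)]] gh(3) by (simp_all add: f_def)
    then have "g [^]\<^bsub>G\<^esub> s = h [^]\<^bsub>G\<^esub> s" "g [^]\<^bsub>G\<^esub> r = h [^]\<^bsub>G\<^esub> r"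
      using ba bb Gs Gr gh(1,2) by (metis bij_betw_imp_inj_on inj_onD)+
    then show "g = h" using splitG gh(1,2) G.torsion_carrier by metis
  qed
  moreover have "f ` torsion G (a * b) = torsion H (a * b)"
  proof (intro equalityI subsetI)
    fix h assume "h \<in> f ` torsion G (a * b)"
    then show "h \<in> torsion H (a * b)" using multH(1) fab by (auto simp: f_def)
  next
    fix h assume h: "h \<in> torsion H (a * b)"
    obtain x where x: "x \<in> torsion G a" "fa x = h [^]\<^bsub>H\<^esub> s" using Hs[OF h] ba by (metis bij_betw_imp_surj_on imageE)
    obtain y where y: "y \<in> torsion G b" "fb y = h [^]\<^bsub>H\<^esub> r" using Hr[OF h] bb by (metis bij_betw_imp_surj_on imageE)
    have "f (x \<otimes>\<^bsub>G\<^esub> y) = h"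
      using multG(2,3)[OF x(1) y(1)] x y splitH[OF H.torsion_carrier[OF h]] by (simp add: f_def)
    then show "h \<in> f ` torsion G (a * b)" using multG(1)[OF x(1) y(1)] by blast
  qed
  moreover have "f (g [^]\<^bsub>G\<^esub> t) = f g [^]\<^bsub>H\<^esub> t" if g: "g \<in> torsion G (a * b)" for g and t :: int
  proof -
    have gc: "g \<in> carrier G" using g G.torsion_carrier by blast
    have "(g [^]\<^bsub>G\<^esub> t) [^]\<^bsub>G\<^esub> s = (g [^]\<^bsub>G\<^esub> s) [^]\<^bsub>G\<^esub> t" "(g [^]\<^bsub>G\<^esub> t) [^]\<^bsub>G\<^esub> r = (g [^]\<^bsub>G\<^esub> r) [^]\<^bsub>G\<^esub> t"
      using gc by (simp_all add: G.int_pow_pow mult.commute)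
    then have "f (g [^]\<^bsub>G\<^esub> t) = fa (g [^]\<^bsub>G\<^esub> s) [^]\<^bsub>H\<^esub> t \<otimes>\<^bsub>H\<^esub> fb (g [^]\<^bsub>G\<^esub> r) [^]\<^bsub>H\<^esub> t"
      using pa[OF Gs[OF g]] pb[OF Gr[OF g]] by (simp add: f_def)
    also have "\<dots> = f g [^]\<^bsub>H\<^esub> t"
      using H.int_pow_mult_distrib[OF commH[OF fab[OF g]], of t] fab[OF g] H.torsion_carrier by (simp add: f_def)
    finally show ?thesis .
  qed
  ultimately have "power_iso_on (a * b) f" by (simp add: power_iso_on_def bij_betw_def)
  then show ?thesis by blast
qed

lemma power_iso_on_all:
  assumes tree: "\<And>p n. prime p \<Longrightarrow> root_tree H p n \<one>\<^bsub>H\<^esub> = root_tree G p n \<one>\<^bsub>G\<^esub>"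
  shows "0 < n \<Longrightarrow> \<exists>f. power_iso_on n f"
proof (induction n rule: less_induct)
  case (less n)
  show ?case
  proof (cases "n = 1")
    case True
    then show ?thesis using prime_power_iso_on[OF two_is_prime_nat tree[OF two_is_prime_nat], of 0] by simp
  next
    case False
    then obtain p where p: "prime p" "p dvd n" using prime_factor_nat by blast
    define k where "k = multiplicity p n"
    obtain m where m: "n = p ^ k * m" "\<not> p dvd m"
      using multiplicity_decompose'[of n p] less.prems p unfolding k_def by (metis not_prime_unit neq0_conv)
    have "k \<noteq> 0" using m p by (intro notI) simp
    then have "1 < p ^ k" using prime_gt_1_nat[OF p(1)] by (intro one_less_power) simp_all
    moreover have "0 < m" using m less.prems by (intro gr0I) simp
    ultimately have "m < n" using m(1) by simp
    then obtain g where g: "power_iso_on m g" using less.IH \<open>0 < m\<close> by blast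
    obtain h where h: "power_iso_on (p ^ k) h" using prime_power_iso_on[OF p(1) tree[OF p(1)]] by blast
    have "coprime (p ^ k) m" using m(2) p(1) by (simp add: prime_imp_coprime)
    then show ?thesis using power_iso_on_mult[OF _ h g] m(1) by simp
  qed
qed

lemma root_trees_imp_sim2:
  assumes tree: "\<And>p n. prime p \<Longrightarrow> root_tree H p n \<one>\<^bsub>H\<^esub> = root_tree G p n \<one>\<^bsub>G\<^esub>"
    and card: "order G = order H"
  shows "sim2 G H"
proof -
  have "0 < order G" using G.order_gt_0_iff_finite by simp
  then obtain f where "power_iso_on (order G) f" using power_iso_on_all tree by blast
  then show ?thesis
    using G.torsion_order H.torsion_order card by (auto simp: power_iso_on_def sim2_def)
qed

lemma sim5_imp_sim2:
  assumes "sim5 G H" shows "sim2 G H"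
proof (rule root_trees_imp_sim2)
  show "root_tree H p n \<one>\<^bsub>H\<^esub> = root_tree G p n \<one>\<^bsub>G\<^esub>" if "prime p" for p n
    using sim5_root_tree_one[OF assms that] .
  obtain f where "bij_betw f (carrier G) (carrier H)" using assms unfolding sim5_iff by blast
  then show "order G = order H" by (simp add: order_def bij_betw_same_card)
qed

lemma directed_power_iso_imp_sim2:
  assumes f: "directed_power_iso f G H" shows "sim2 G H"
proof (rule root_trees_imp_sim2)
  have bij: "bij_betw f (carrier G) (carrier H)" using f by (simp add: directed_power_iso_def)
  then show "order G = order H" by (simp add: order_def bij_betw_same_card)
  have "H.ord (f \<one>\<^bsub>G\<^esub>) = 1" using directed_power_iso_ord[OF f G.one_closed] by simp
  then have one: "f \<one>\<^bsub>G\<^esub> = \<one>\<^bsub>H\<^esub>" using H.ord_eq_1 bij_betw_apply[OF bij G.one_closed] by blast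
  show "root_tree H p n \<one>\<^bsub>H\<^esub> = root_tree G p n \<one>\<^bsub>G\<^esub>" if "prime p" for p n
    using directed_power_iso_root_tree[OF f that G.one_in_torsion[of "p ^ 0"], of n] one by simp
qed

end

section \<open>Groups of class two that separate the relations\<close>

definition bilinear_pair_mult :: "int \<Rightarrow> int \<Rightarrow> int \<Rightarrow> int \<Rightarrow> int \<times> int \<Rightarrow> int \<times> int \<Rightarrow> int \<times> int" where
  "bilinear_pair_mult n m k l x y =
     ((fst x + fst y + k * snd x * fst y + l * fst x * snd y) mod n, (snd x + snd y) mod m)"

text \<open>
  The multiplication on \<open>\<int>/n \<times> \<int>/m\<close> that adds the bilinear form
  \<open>k b a' + l a b'\<close> to the first component of \<open>(a, b) + (a', b')\<close>,
  transported to the natural numbers.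
\<close>

definition bilinear_mod_group :: "int \<Rightarrow> int \<Rightarrow> int \<Rightarrow> int \<Rightarrow> nat monoid" where
  "bilinear_mod_group n m k l =
     \<lparr>carrier = to_nat ` ({0..<n} \<times> {0..<m}),
      monoid.mult = (\<lambda>x y. to_nat (bilinear_pair_mult n m k l (from_nat x) (from_nat y))),
      monoid.one = to_nat (0 :: int, 0 :: int)\<rparr>"

text \<open>
  The divisibilities by \<open>n\<close> of \<open>k * m\<close> and \<open>l * m\<close> make the
  form well defined on residues modulo \<open>m\<close>, the others make it vanish if one argument
  is a value of the form, placed in the first component; this gives associativity and central
  commutators.
\<close>

locale bilinear_group =
  fixes n m k l :: int
  assumes pos: "0 < n" "0 < m"
    and dvd: "n dvd k * m" "n dvd l * m" "n dvd k * k" "n dvd k * l" "n dvd l * l"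
begin

abbreviation "B \<equiv> bilinear_mod_group n m k l"
abbreviation el :: "int \<Rightarrow> int \<Rightarrow> nat" where "el a b \<equiv> to_nat (a mod n, b mod m)"

lemma mod_eqI: "n dvd a - b \<Longrightarrow> a mod n = b mod n"
  by (simp add: mod_eq_dvd_iff)

lemma el_in_carrier [simp]: "el a b \<in> carrier B"
  using pos by (auto simp: bilinear_mod_group_def)

lemma carrierE:
  assumes "x \<in> carrier B"
  obtains a b where "x = el a b" "0 \<le> a" "a < n" "0 \<le> b" "b < m"
proof -
  obtain a b where "x = to_nat (a, b)" "0 \<le> a" "a < n" "0 \<le> b" "b < m"
    using assms by (auto simp: bilinear_mod_group_def)
  then show ?thesis using that[of a b] by simp
qed

lemma one_eq: "\<one>\<^bsub>B\<^esub> = el 0 0"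
  by (simp add: bilinear_mod_group_def)

lemma el_eq_iff: "el a b = el a' b' \<longleftrightarrow> n dvd a - a' \<and> m dvd b - b'"
  by (simp add: mod_eq_dvd_iff)

lemma mult_el: "el a b \<otimes>\<^bsub>B\<^esub> el a' b' = el (a + a' + k * b * a' + l * a * b') (b + b')"
proof -
  have 1: "n dvd k * (b mod m - b) * c" for b c
  proof -
    have "b mod m - b = - (m * (b div m))" by (simp add: minus_div_mult_eq_mod[symmetric])
    then have "k * (b mod m - b) * c = k * m * (- (b div m) * c)" by (simp only: mult_ac mult_minus_left mult_minus_right)
    then show ?thesis using dvd(1) by (simp only: dvd_mult2)
  qed
  have 2: "n dvd l * (b mod m - b) * c" for b c
  proof -
    have "b mod m - b = - (m * (b div m))" by (simp add: minus_div_mult_eq_mod[symmetric])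
    then have "l * (b mod m - b) * c = l * m * (- (b div m) * c)" by (simp only: mult_ac mult_minus_left mult_minus_right)
    then show ?thesis using dvd(2) by (simp only: dvd_mult2)
  qed
  have n: "n dvd (a mod n - a)" for a by (simp add: mod_eq_dvd_iff[symmetric])
  have "(a mod n + a' mod n + k * (b mod m) * (a' mod n) + l * (a mod n) * (b' mod m))
      - (a + a' + k * b * a' + l * a * b') =
    (a mod n - a) * (1 + l * (b' mod m)) + (a' mod n - a') * (1 + k * (b mod m))
      + k * (b mod m - b) * a' + l * (b' mod m - b') * a"
    by (simp add: algebra_simps)
  also have "n dvd \<dots>" using 1 2 by (intro dvd_add dvd_mult2[OF n])
  finally have "(a mod n + a' mod n + k * (b mod m) * (a' mod n) + l * (a mod n) * (b' mod m)) mod n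
      = (a + a' + k * b * a' + l * a * b') mod n" by (rule mod_eqI)
  then show ?thesis by (simp add: bilinear_mod_group_def bilinear_pair_mult_def mod_add_eq)
qed

lemma dvd_mult_coeff: "n dvd k * k * c" "n dvd k * l * c" "n dvd l * l * c"
  using dvd by auto

lemma group: "group B"
proof (rule groupI)
  fix x y assume "x \<in> carrier B" "y \<in> carrier B"
  then show "x \<otimes>\<^bsub>B\<^esub> y \<in> carrier B" by (elim carrierE) (simp only: mult_el el_in_carrier)
next
  show "\<one>\<^bsub>B\<^esub> \<in> carrier B" by (simp only: one_eq el_in_carrier)
next
  fix x y z assume "x \<in> carrier B" "y \<in> carrier B" "z \<in> carrier B"
  then obtain a b a' b' a'' b'' where e: "x = el a b" "y = el a' b'" "z = el a'' b''" by (metis carrierE)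
  have "(a + a' + k * b * a' + l * a * b') + a'' + k * (b + b') * a'' + l * (a + a' + k * b * a' + l * a * b') * b''
      - (a + (a' + a'' + k * b' * a'' + l * a' * b'') + k * b * (a' + a'' + k * b' * a'' + l * a' * b'') + l * a * (b' + b''))
    = l * l * (a * b' * b'') - k * k * (b * b' * a'')"
    by (simp add: algebra_simps)
  also have "n dvd \<dots>" using dvd_mult_coeff by (intro dvd_diff) auto
  finally show "x \<otimes>\<^bsub>B\<^esub> y \<otimes>\<^bsub>B\<^esub> z = x \<otimes>\<^bsub>B\<^esub> (y \<otimes>\<^bsub>B\<^esub> z)"
    unfolding e mult_el el_eq_iff by simp
next
  fix x assume "x \<in> carrier B"
  then obtain a b where e: "x = el a b" by (metis carrierE)
  then show "\<one>\<^bsub>B\<^esub> \<otimes>\<^bsub>B\<^esub> x = x" unfolding one_eq mult_el e by simp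
  \<comment> \<open>the first component of the inverse of the element (a, b) is a correction of - a\<close>
  have "(- a + k * b * a + l * a * b) + a + k * (- b) * a + l * (- a + k * b * a + l * a * b) * b
     = k * l * (a * b * b) + l * l * (a * b * b)"
    by (simp add: algebra_simps)
  also have "n dvd \<dots>" using dvd_mult_coeff by (intro dvd_add)
  finally have "el (- a + k * b * a + l * a * b) (- b) \<otimes>\<^bsub>B\<^esub> x = \<one>\<^bsub>B\<^esub>"
    unfolding e mult_el one_eq el_eq_iff by simp
  then show "\<exists>y\<in>carrier B. y \<otimes>\<^bsub>B\<^esub> x = \<one>\<^bsub>B\<^esub>" using el_in_carrier by blast
qed

lemma fin_group: "fin_group B"
proof -
  have "finite (carrier B)" by (simp add: bilinear_mod_group_def)
  then show ?thesis using group by (simp add: fin_group_def fin_group_axioms_def)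
qed

lemma commutator:
  assumes x: "x \<in> carrier B" and y: "y \<in> carrier B"
  shows "\<exists>c. x \<otimes>\<^bsub>B\<^esub> y \<otimes>\<^bsub>B\<^esub> inv\<^bsub>B\<^esub> x \<otimes>\<^bsub>B\<^esub> inv\<^bsub>B\<^esub> y = el ((k - l) * c) 0"
proof -
  interpret group B by (rule group)
  obtain a b a' b' where e: "x = el a b" "y = el a' b'" using x y by (metis carrierE)
  define c where "c = b * a' - a * b'"
  have kl: "(k - l) * c + (a' + a + k * b' * a + l * a' * b) + l * ((k - l) * c) * (b' + b)
      - (a + a' + k * b * a' + l * a * b') = k * l * (c * (b' + b)) - l * l * (c * (b' + b))"
    by (simp add: c_def algebra_simps)
  have "n dvd k * l * (c * (b' + b)) - l * l * (c * (b' + b))" using dvd_mult_coeff by (intro dvd_diff)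
  then have "el ((k - l) * c) 0 \<otimes>\<^bsub>B\<^esub> (y \<otimes>\<^bsub>B\<^esub> x) = x \<otimes>\<^bsub>B\<^esub> y"
    unfolding e mult_el el_eq_iff using kl by (simp add: add.commute)
  moreover have "x \<otimes>\<^bsub>B\<^esub> y \<otimes>\<^bsub>B\<^esub> inv\<^bsub>B\<^esub> x \<otimes>\<^bsub>B\<^esub> inv\<^bsub>B\<^esub> y = x \<otimes>\<^bsub>B\<^esub> y \<otimes>\<^bsub>B\<^esub> inv\<^bsub>B\<^esub> (y \<otimes>\<^bsub>B\<^esub> x)"
    using x y by (simp add: inv_mult_group m_assoc)
  ultimately have "x \<otimes>\<^bsub>B\<^esub> y \<otimes>\<^bsub>B\<^esub> inv\<^bsub>B\<^esub> x \<otimes>\<^bsub>B\<^esub> inv\<^bsub>B\<^esub> y = el ((k - l) * c) 0"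
    using x y inv_solve_right[of "el ((k - l) * c) 0" "x \<otimes>\<^bsub>B\<^esub> y" "y \<otimes>\<^bsub>B\<^esub> x"] el_in_carrier by (metis m_closed)
  then show ?thesis by blast
qed

lemma central:
  assumes "y \<in> carrier B"
  shows "el ((k - l) * c) 0 \<otimes>\<^bsub>B\<^esub> y = y \<otimes>\<^bsub>B\<^esub> el ((k - l) * c) 0"
proof -
  obtain a b where e: "y = el a b" using assms by (metis carrierE)
  have "(k - l) * c + a + l * ((k - l) * c) * b - (a + (k - l) * c + k * b * ((k - l) * c))
      = k * l * (2 * c * b) - l * l * (c * b) - k * k * (c * b)"
    by (simp add: algebra_simps)
  also have "n dvd \<dots>" using dvd_mult_coeff by (intro dvd_diff)
  finally show ?thesis unfolding e mult_el el_eq_iff by simp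
qed

text \<open>
  Commutators are multiples of \<open>k - l\<close> in the first component and hence central, so the
  class is at most two.
\<close>

lemma finite_nilpotent_group: "finite_nilpotent_group B"
proof -
  interpret fin_group B by (rule fin_group)
  define Z where "Z = {z \<in> carrier B. \<forall>y\<in>carrier B. z \<otimes>\<^bsub>B\<^esub> y = y \<otimes>\<^bsub>B\<^esub> z}"
  have "subgroup Z B"
  proof (rule subgroupI)
    show "Z \<subseteq> carrier B" "Z \<noteq> {}" by (auto simp: Z_def)
    fix z assume z: "z \<in> Z"
    have "inv\<^bsub>B\<^esub> z \<otimes>\<^bsub>B\<^esub> y = y \<otimes>\<^bsub>B\<^esub> inv\<^bsub>B\<^esub> z" if "y \<in> carrier B" for y
    proof -
      have c: "z \<in> carrier B" "z \<otimes>\<^bsub>B\<^esub> y = y \<otimes>\<^bsub>B\<^esub> z" using z that by (auto simp: Z_def)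
      have "y = y \<otimes>\<^bsub>B\<^esub> z \<otimes>\<^bsub>B\<^esub> inv\<^bsub>B\<^esub> z" using c that by (simp add: m_assoc)
      also have "y \<otimes>\<^bsub>B\<^esub> z = z \<otimes>\<^bsub>B\<^esub> y" using c by simp
      also have "z \<otimes>\<^bsub>B\<^esub> y \<otimes>\<^bsub>B\<^esub> inv\<^bsub>B\<^esub> z = z \<otimes>\<^bsub>B\<^esub> (y \<otimes>\<^bsub>B\<^esub> inv\<^bsub>B\<^esub> z)"
        using c(1) that by (intro m_assoc) auto
      finally have "y = z \<otimes>\<^bsub>B\<^esub> (y \<otimes>\<^bsub>B\<^esub> inv\<^bsub>B\<^esub> z)" .
      then have "inv\<^bsub>B\<^esub> z \<otimes>\<^bsub>B\<^esub> y = inv\<^bsub>B\<^esub> z \<otimes>\<^bsub>B\<^esub> (z \<otimes>\<^bsub>B\<^esub> (y \<otimes>\<^bsub>B\<^esub> inv\<^bsub>B\<^esub> z))"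
        by (rule arg_cong)
      moreover have "inv\<^bsub>B\<^esub> z \<otimes>\<^bsub>B\<^esub> (z \<otimes>\<^bsub>B\<^esub> w) = w" if "w \<in> carrier B" for w
        using c(1) that by (simp add: m_assoc[symmetric])
      then have "inv\<^bsub>B\<^esub> z \<otimes>\<^bsub>B\<^esub> (z \<otimes>\<^bsub>B\<^esub> (y \<otimes>\<^bsub>B\<^esub> inv\<^bsub>B\<^esub> z)) = y \<otimes>\<^bsub>B\<^esub> inv\<^bsub>B\<^esub> z"
        using c(1) that by simp
      ultimately show ?thesis by (rule trans)
    qed
    then show "inv\<^bsub>B\<^esub> z \<in> Z" using z by (simp add: Z_def)
  next
    fix z w assume "z \<in> Z" "w \<in> Z"
    then have zw: "z \<in> carrier B" "w \<in> carrier B"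
      and comm: "\<And>y. y \<in> carrier B \<Longrightarrow> z \<otimes>\<^bsub>B\<^esub> y = y \<otimes>\<^bsub>B\<^esub> z"
        "\<And>y. y \<in> carrier B \<Longrightarrow> w \<otimes>\<^bsub>B\<^esub> y = y \<otimes>\<^bsub>B\<^esub> w" by (auto simp: Z_def)
    have "z \<otimes>\<^bsub>B\<^esub> w \<otimes>\<^bsub>B\<^esub> y = y \<otimes>\<^bsub>B\<^esub> (z \<otimes>\<^bsub>B\<^esub> w)" if y: "y \<in> carrier B" for y
    proof -
      have "z \<otimes>\<^bsub>B\<^esub> w \<otimes>\<^bsub>B\<^esub> y = z \<otimes>\<^bsub>B\<^esub> (w \<otimes>\<^bsub>B\<^esub> y)" by (rule m_assoc[OF zw y])
      also have "w \<otimes>\<^bsub>B\<^esub> y = y \<otimes>\<^bsub>B\<^esub> w" by (rule comm(2)[OF y])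
      also have "z \<otimes>\<^bsub>B\<^esub> (y \<otimes>\<^bsub>B\<^esub> w) = z \<otimes>\<^bsub>B\<^esub> y \<otimes>\<^bsub>B\<^esub> w" by (rule m_assoc[OF zw(1) y zw(2), symmetric])
      also have "z \<otimes>\<^bsub>B\<^esub> y = y \<otimes>\<^bsub>B\<^esub> z" by (rule comm(1)[OF y])
      also have "y \<otimes>\<^bsub>B\<^esub> z \<otimes>\<^bsub>B\<^esub> w = y \<otimes>\<^bsub>B\<^esub> (z \<otimes>\<^bsub>B\<^esub> w)" by (rule m_assoc[OF y zw])
      finally show ?thesis .
    qed
    then show "z \<otimes>\<^bsub>B\<^esub> w \<in> Z" using zw by (simp add: Z_def)
  qed
  moreover have "(\<Union>x\<in>carrier B. \<Union>y\<in>carrier B. {x \<otimes>\<^bsub>B\<^esub> y \<otimes>\<^bsub>B\<^esub> inv\<^bsub>B\<^esub> x \<otimes>\<^bsub>B\<^esub> inv\<^bsub>B\<^esub> y}) \<subseteq> Z"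
  proof clarify
    fix x y assume "x \<in> carrier B" "y \<in> carrier B"
    then obtain c where "x \<otimes>\<^bsub>B\<^esub> y \<otimes>\<^bsub>B\<^esub> inv\<^bsub>B\<^esub> x \<otimes>\<^bsub>B\<^esub> inv\<^bsub>B\<^esub> y = el ((k - l) * c) 0" using commutator by blast
    then show "x \<otimes>\<^bsub>B\<^esub> y \<otimes>\<^bsub>B\<^esub> inv\<^bsub>B\<^esub> x \<otimes>\<^bsub>B\<^esub> inv\<^bsub>B\<^esub> y \<in> Z"
      using central el_in_carrier[of "(k - l) * c" 0] by (simp add: Z_def)
  qed
  ultimately have Z1: "lower_central_series B (Suc 0) \<subseteq> Z"
    by (simp add: generate_subgroup_incl)
  have "x \<otimes>\<^bsub>B\<^esub> y \<otimes>\<^bsub>B\<^esub> inv\<^bsub>B\<^esub> x \<otimes>\<^bsub>B\<^esub> inv\<^bsub>B\<^esub> y = \<one>\<^bsub>B\<^esub>" if "x \<in> Z" "y \<in> carrier B" for x y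
  proof -
    have c: "x \<in> carrier B" "x \<otimes>\<^bsub>B\<^esub> y = y \<otimes>\<^bsub>B\<^esub> x" using that by (auto simp: Z_def)
    then show ?thesis using that(2) by (simp add: m_assoc)
  qed
  then have "(\<Union>x\<in>lower_central_series B (Suc 0). \<Union>y\<in>carrier B. {x \<otimes>\<^bsub>B\<^esub> y \<otimes>\<^bsub>B\<^esub> inv\<^bsub>B\<^esub> x \<otimes>\<^bsub>B\<^esub> inv\<^bsub>B\<^esub> y}) \<subseteq> {\<one>\<^bsub>B\<^esub>}"
    using Z1 by blast
  then have "lower_central_series B (Suc (Suc 0)) \<subseteq> {\<one>\<^bsub>B\<^esub>}"
    unfolding lower_central_series.simps(2)[of B "Suc 0"]
    by (rule generate_subgroup_incl) (rule triv_subgroup)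
  moreover have "\<one>\<^bsub>B\<^esub> \<in> lower_central_series B (Suc (Suc 0))"
    by (simp add: generate.one)
  ultimately have "\<exists>i. lower_central_series B i = {\<one>\<^bsub>B\<^esub>}" by blast
  then show ?thesis using group finite_carrier unfolding finite_nilpotent_group_def by blast
qed

lemma square_el: "el a b [^]\<^bsub>B\<^esub> (2::nat) = el (2 * a + (k + l) * (a * b)) (2 * b)"
proof -
  interpret group B by (rule group)
  have "el a b [^]\<^bsub>B\<^esub> (2::nat) = el a b \<otimes>\<^bsub>B\<^esub> el a b"
    by (simp add: numeral_2_eq_2 del: One_nat_def)
  then show ?thesis unfolding mult_el by (simp add: algebra_simps)
qed

text \<open>
  For \<open>l = - k\<close> the form is alternating, so it vanishes on pairs of powers of one
  element and powers are computed as in the direct product.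
\<close>

lemma pow_el:
  assumes "l = - k"
  shows "el a b [^]\<^bsub>B\<^esub> (t::int) = el (t * a) (t * b)"
proof -
  interpret group B by (rule group)
  have nat: "el a b [^]\<^bsub>B\<^esub> i = el (int i * a) (int i * b)" for i :: nat
  proof (induction i)
    case 0
    then show ?case by (simp add: one_eq)
  next
    case (Suc i)
    have "el a b [^]\<^bsub>B\<^esub> Suc i = el (int i * a) (int i * b) \<otimes>\<^bsub>B\<^esub> el a b" using Suc by simp
    then show ?case unfolding mult_el by (simp add: assms algebra_simps)
  qed
  show ?thesis
  proof (cases t rule: int_cases2)
    case (nonneg i)
    then show ?thesis using nat by (simp add: int_pow_int)
  next
    case (nonpos i)
    have "el (t * a) (t * b) \<otimes>\<^bsub>B\<^esub> el (int i * a) (int i * b) = \<one>\<^bsub>B\<^esub>"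
      unfolding mult_el one_eq by (simp add: nonpos assms algebra_simps)
    then have "inv\<^bsub>B\<^esub> (el (int i * a) (int i * b)) = el (t * a) (t * b)"
      using inv_equality el_in_carrier by blast
    then show ?thesis using nat by (simp add: nonpos int_pow_neg_int)
  qed
qed

end

lemma fin_group_exponent4_ord:
  assumes "fin_group G" and x: "x \<in> carrier G" and "x [^]\<^bsub>G\<^esub> (4::nat) = \<one>\<^bsub>G\<^esub>"
  shows "group.ord G x = (if x = \<one>\<^bsub>G\<^esub> then 1 else if x [^]\<^bsub>G\<^esub> (2::nat) = \<one>\<^bsub>G\<^esub> then 2 else 4)"
proof -
  interpret fin_group G by fact
  have "ord x dvd 2 ^ 2" using assms(3) x pow_eq_id by simp
  then obtain i where "i \<le> 2" "ord x = 2 ^ i" using divides_primepow_nat[of 2 "ord x" 2] two_is_prime_nat by blast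
  then have "ord x \<in> {1, 2, 4}" by (auto simp: le_Suc_eq numeral_2_eq_2)
  moreover have "x = \<one>\<^bsub>G\<^esub> \<longleftrightarrow> ord x = 1" "x [^]\<^bsub>G\<^esub> (2::nat) = \<one>\<^bsub>G\<^esub> \<longleftrightarrow> ord x dvd 2"
    using x ord_eq_1 pow_eq_id by auto
  ultimately show ?thesis by auto
qed

text \<open>
  The direct product of cyclic groups of orders 9 and 3, and the group on the same set with the
  alternating form \<open>3 (b a' - a b')\<close>: the identity map commutes with all power maps,
  but only the first group is abelian.
\<close>

lemma sim2_not_sim1:
  "\<exists>(G :: nat monoid) (H :: nat monoid). finite_nilpotent_group G \<and> finite_nilpotent_group H \<and> sim2 G H \<and> \<not> sim1 G H"
proof -
  interpret A: bilinear_group 9 3 0 0 by unfold_locales auto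
  interpret M: bilinear_group 9 3 3 "-3" by unfold_locales auto
  have car: "carrier A.B = carrier M.B" by (simp add: bilinear_mod_group_def)
  have "x [^]\<^bsub>A.B\<^esub> t = x [^]\<^bsub>M.B\<^esub> t" if "x \<in> carrier A.B" for x and t :: int
    using that A.pow_el M.pow_el by (metis A.carrierE minus_zero)
  then have "sim2 A.B M.B" unfolding sim2_def using car by (auto intro!: exI[of _ id])
  moreover have "\<not> sim1 A.B M.B"
  proof
    assume "sim1 A.B M.B"
    then obtain h where h: "h \<in> iso A.B M.B" by (auto simp: sim1_def is_iso_def)
    then have hom: "h (x \<otimes>\<^bsub>A.B\<^esub> y) = h x \<otimes>\<^bsub>M.B\<^esub> h y" if "x \<in> carrier A.B" "y \<in> carrier A.B" for x y
      using that by (auto simp: iso_def hom_def)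
    have comm: "x \<otimes>\<^bsub>A.B\<^esub> y = y \<otimes>\<^bsub>A.B\<^esub> x" if xc: "x \<in> carrier A.B" and yc: "y \<in> carrier A.B" for x y
    proof -
      obtain a b where x: "x = A.el a b" using xc by (rule A.carrierE)
      obtain a' b' where y: "y = A.el a' b'" using yc by (rule A.carrierE)
      show ?thesis unfolding x y A.mult_el by (simp add: add.commute)
    qed
    have img: "h ` carrier A.B = carrier M.B" using h by (auto simp: iso_def bij_betw_def)
    have "M.el 1 0 \<in> h ` carrier A.B" "M.el 0 1 \<in> h ` carrier A.B"
      by (simp_all only: img M.el_in_carrier)
    then obtain x y where "x \<in> carrier A.B" "M.el 1 0 = h x" "y \<in> carrier A.B" "M.el 0 1 = h y"
      by (elim imageE)
    then have "M.el 1 0 \<otimes>\<^bsub>M.B\<^esub> M.el 0 1 = M.el 0 1 \<otimes>\<^bsub>M.B\<^esub> M.el 1 0"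
      using hom comm by metis
    then show False unfolding M.mult_el M.el_eq_iff by simp
  qed
  ultimately show ?thesis using A.finite_nilpotent_group M.finite_nilpotent_group by blast
qed

text \<open>
  The direct product of two cyclic groups of order 4 against their semidirect product, in which
  \<open>b\<close> acts as \<open>a' \<mapsto> a' + 2 b a' = (-1)\<^sup>b a'\<close>. The identity
  map preserves orders. But the square of \<open>(a, b)\<close> in the second group is \<open>(2 a
  (1 + b), 2 b)\<close>, which is never \<open>(2, 2)\<close>, so the power map digraphs for
  exponent 2 have different numbers of vertices with an incoming edge.
\<close>

lemma sim6_not_sim5:
  "\<exists>(G :: nat monoid) (H :: nat monoid). finite_nilpotent_group G \<and> finite_nilpotent_group H \<and> sim6 G H \<and> \<not> sim5 G H"
proof -
  interpret A: bilinear_group 4 4 0 0 by unfold_locales auto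
  interpret S: bilinear_group 4 4 2 0 by unfold_locales auto
  interpret A': fin_group A.B by (rule A.fin_group)
  interpret S': fin_group S.B by (rule S.fin_group)
  interpret P: fin_group_pair A.B S.B by unfold_locales
  have car: "carrier A.B = carrier S.B" by (simp add: bilinear_mod_group_def)
  have sqA: "A.el a b [^]\<^bsub>A.B\<^esub> (2::nat) = A.el (2 * a) (2 * b)" for a b
    using A.square_el[of a b] by simp
  have sqS: "S.el a b [^]\<^bsub>S.B\<^esub> (2::nat) = S.el (2 * a + 2 * (a * b)) (2 * b)" for a b
    using S.square_el[of a b] by simp
  have four: "x [^]\<^bsub>A.B\<^esub> (4::nat) = (x [^]\<^bsub>A.B\<^esub> (2::nat)) [^]\<^bsub>A.B\<^esub> (2::nat)"
    "x [^]\<^bsub>S.B\<^esub> (4::nat) = (x [^]\<^bsub>S.B\<^esub> (2::nat)) [^]\<^bsub>S.B\<^esub> (2::nat)" if "x \<in> carrier A.B" for x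
    using that car by (simp_all add: A'.nat_pow_pow S'.nat_pow_pow)
  have ord: "S'.ord x = A'.ord x" if x: "x \<in> carrier A.B" for x
  proof -
    obtain a b where e: "x = A.el a b" using x by (rule A.carrierE)
    have A4: "x [^]\<^bsub>A.B\<^esub> (4::nat) = \<one>\<^bsub>A.B\<^esub>"
      by (subst four(1)[OF x]) (simp only: e sqA A.one_eq A.el_eq_iff, simp)
    have S4: "x [^]\<^bsub>S.B\<^esub> (4::nat) = \<one>\<^bsub>S.B\<^esub>"
      by (subst four(2)[OF x]) (simp only: e sqS S.one_eq S.el_eq_iff, simp add: algebra_simps)
    have "x [^]\<^bsub>S.B\<^esub> (2::nat) = \<one>\<^bsub>S.B\<^esub> \<longleftrightarrow> x [^]\<^bsub>A.B\<^esub> (2::nat) = \<one>\<^bsub>A.B\<^esub>"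
    proof -
      have "4 dvd 2 * a + 2 * (a * b) \<and> 4 dvd 2 * b \<longleftrightarrow> 4 dvd 2 * a \<and> 4 dvd 2 * b"
        for a b :: int
      proof -
        have "4 dvd 2 * c \<longleftrightarrow> even c" for c :: int by presburger
        from this[of "a + a * b"] this[of a] this[of b] show ?thesis by (auto simp: distrib_left)
      qed
      then show ?thesis unfolding e sqA sqS A.one_eq S.one_eq A.el_eq_iff by simp
    qed
    moreover have "\<one>\<^bsub>S.B\<^esub> = \<one>\<^bsub>A.B\<^esub>" by (simp add: A.one_eq S.one_eq)
    ultimately show ?thesis
      using fin_group_exponent4_ord[OF A.fin_group x A4] fin_group_exponent4_ord[OF S.fin_group _ S4] x car by simp
  qed
  have "sim6 A.B S.B"
    unfolding sim6_def order_multiset_def car[symmetric] using ord by (intro image_mset_cong) simp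
  moreover have "\<not> sim5 A.B S.B"
  proof
    assume "sim5 A.B S.B"
    then obtain f where f: "bij_betw f (carrier A.B) (carrier S.B)"
      "\<And>x. x \<in> carrier A.B \<Longrightarrow> f (x [^]\<^bsub>A.B\<^esub> (2::int)) = f x [^]\<^bsub>S.B\<^esub> (2::int)"
      unfolding P.sim5_iff by blast
    have f2: "f (x [^]\<^bsub>A.B\<^esub> (2::nat)) = f x [^]\<^bsub>S.B\<^esub> (2::nat)" if "x \<in> carrier A.B" for x
      using f(2)[OF that] int_pow_int[of A.B x 2] int_pow_int[of S.B "f x" 2] by simp
    let ?QA = "(\<lambda>x. x [^]\<^bsub>A.B\<^esub> (2::nat)) ` carrier A.B" and ?QS = "(\<lambda>x. x [^]\<^bsub>S.B\<^esub> (2::nat)) ` carrier S.B"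
    have "f ` ?QA \<subseteq> ?QS" using f2 bij_betw_apply[OF f(1)] by auto
    then have "card (f ` ?QA) \<le> card ?QS" by (intro card_mono) auto
    moreover have "card (f ` ?QA) = card ?QA"
      using f(1) by (intro card_image) (auto simp: bij_betw_def intro: inj_on_subset)
    moreover have "card ?QS \<le> 3"
    proof -
      have "?QS \<subseteq> {S.el 0 0, S.el 2 0, S.el 0 2}"
      proof
        fix y assume "y \<in> ?QS"
        then obtain x where x: "x \<in> carrier S.B" "y = x [^]\<^bsub>S.B\<^esub> (2::nat)" by blast
        obtain a b where e: "x = S.el a b" using x(1) by (rule S.carrierE)
        have y: "y = S.el (2 * a + 2 * (a * b)) (2 * b)" unfolding x(2) e sqS ..
        show "y \<in> {S.el 0 0, S.el 2 0, S.el 0 2}"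
        proof (cases "even b")
          case True
          then obtain c where c: "b = 2 * c" by auto
          show ?thesis
          proof (cases "even a")
            case True
            then obtain d where d: "a = 2 * d" by auto
            have "y = S.el 0 0" unfolding y S.el_eq_iff by (simp add: c d)
            then show ?thesis by simp
          next
            case False
            then obtain d where d: "a = 2 * d + 1" by (rule oddE)
            have "2 * a + 2 * (a * b) - 2 = 4 * (d + a * c)" "2 * b - 0 = 4 * c"
              by (simp_all add: c d algebra_simps)
            then have "y = S.el 2 0" unfolding y S.el_eq_iff by (simp only: dvd_triv_left)
            then show ?thesis by simp
          qed
        next
          case False
          then obtain c where c: "b = 2 * c + 1" by (rule oddE)
          have "2 * a + 2 * (a * b) - 0 = 4 * (a * (c + 1))" "2 * b - 2 = 4 * c"
            by (simp_all add: c algebra_simps)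
          then have "y = S.el 0 2" unfolding y S.el_eq_iff by (simp only: dvd_triv_left)
          then show ?thesis by simp
        qed
      qed
      then have "card ?QS \<le> card {S.el 0 0, S.el 2 0, S.el 0 2}" by (intro card_mono) auto
      also have "\<dots> \<le> 3" by (simp add: card_insert_if)
      finally show ?thesis .
    qed
    moreover have "4 \<le> card ?QA"
    proof -
      have "{A.el 0 0, A.el 2 0, A.el 0 2, A.el 2 2} \<subseteq> ?QA"
      proof -
        have "A.el (2 * a) (2 * b) \<in> ?QA" for a b
          unfolding sqA[symmetric] by (intro imageI A.el_in_carrier)
        from this[of 0 0] this[of 1 0] this[of 0 1] this[of 1 1] show ?thesis by simp
      qed
      then have "card {A.el 0 0, A.el 2 0, A.el 0 2, A.el 2 2} \<le> card ?QA"
        by (intro card_mono) auto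
      moreover have "card {A.el 0 0, A.el 2 0, A.el 0 2, A.el 2 2} = 4" by simp
      ultimately show ?thesis by simp
    qed
    ultimately show False by simp
  qed
  ultimately show ?thesis using A.finite_nilpotent_group S.finite_nilpotent_group by blast
qed

section \<open>Comparison of the partitions\<close>

lemma nilpotent_fin_groupI: "finite_nilpotent_group G \<Longrightarrow> nilpotent_fin_group G"
  by (simp add: finite_nilpotent_group_def nilpotent_fin_group_def nilpotent_fin_group_axioms_def
      fin_group_def fin_group_axioms_def)

lemma nilpotent_comparison:
  assumes "finite_nilpotent_group G" "finite_nilpotent_group H"
  shows "sim1 G H \<Longrightarrow> sim2 G H" and "sim2 G H \<longleftrightarrow> sim3 G H" and "sim2 G H \<longleftrightarrow> sim4 G H"
    and "sim2 G H \<longleftrightarrow> sim5 G H" and "sim2 G H \<Longrightarrow> sim6 G H"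
proof -
  interpret G: nilpotent_fin_group G by (rule nilpotent_fin_groupI) fact
  interpret H: nilpotent_fin_group H by (rule nilpotent_fin_groupI) fact
  interpret nilpotent_fin_group_pair G H by unfold_locales
  have sim2: "sim2 G H \<longleftrightarrow> (\<exists>f. directed_power_iso f G H)"
    using directed_power_iso_imp_sim2 sim2_imp_directed_power_iso unfolding sim2_def by metis
  show "sim1 G H \<Longrightarrow> sim2 G H" by (rule sim1_imp_sim2)
  show "sim2 G H \<longleftrightarrow> sim3 G H"
    unfolding sim2 using directed_power_iso_imp_sim3 sim3_imp_directed_power_iso by metis
  show "sim2 G H \<longleftrightarrow> sim4 G H"
    unfolding sim2 using directed_power_iso_imp_sim4 sim4_imp_directed_power_iso by metis
  show "sim2 G H \<longleftrightarrow> sim5 G H" using sim2_imp_sim5 sim5_imp_sim2 by metis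
  show "sim2 G H \<Longrightarrow> sim6 G H" unfolding sim2 using directed_power_iso_imp_sim6 by metis
qed

(* The inclusions and equalities are stated for groups on arbitrary carrier types 'a and 'b.
   Strictness fails on a small finite type, so it is stated for groups on nat, where every finite
   group has an isomorphic copy. *)
theorem theorem1p8:
  shows "(partition_le finite_nilpotent_group finite_nilpotent_group
            (sim1 :: 'a monoid \<Rightarrow> 'b monoid \<Rightarrow> bool) sim2 \<and>
          partition_eq finite_nilpotent_group finite_nilpotent_group
            (sim2 :: 'a monoid \<Rightarrow> 'b monoid \<Rightarrow> bool) sim3 \<and>
          partition_eq finite_nilpotent_group finite_nilpotent_group
            (sim3 :: 'a monoid \<Rightarrow> 'b monoid \<Rightarrow> bool) sim4 \<and>
          partition_eq finite_nilpotent_group finite_nilpotent_group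
            (sim4 :: 'a monoid \<Rightarrow> 'b monoid \<Rightarrow> bool) sim5 \<and>
          partition_le finite_nilpotent_group finite_nilpotent_group
            (sim5 :: 'a monoid \<Rightarrow> 'b monoid \<Rightarrow> bool) sim6) \<and>
         (partition_less finite_nilpotent_group finite_nilpotent_group
            (sim1 :: nat monoid \<Rightarrow> nat monoid \<Rightarrow> bool) sim2 \<and>
          partition_less finite_nilpotent_group finite_nilpotent_group
            (sim5 :: nat monoid \<Rightarrow> nat monoid \<Rightarrow> bool) sim6)"
proof (intro conjI)
  show "partition_le finite_nilpotent_group finite_nilpotent_group
      (sim1 :: 'a monoid \<Rightarrow> 'b monoid \<Rightarrow> bool) sim2"
    using nilpotent_comparison(1) unfolding partition_le_def by blast
  show "partition_eq finite_nilpotent_group finite_nilpotent_group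
      (sim2 :: 'a monoid \<Rightarrow> 'b monoid \<Rightarrow> bool) sim3"
    using nilpotent_comparison(2) unfolding partition_eq_def by blast
  show "partition_eq finite_nilpotent_group finite_nilpotent_group
      (sim3 :: 'a monoid \<Rightarrow> 'b monoid \<Rightarrow> bool) sim4"
    using nilpotent_comparison(2,3) unfolding partition_eq_def by blast
  show "partition_eq finite_nilpotent_group finite_nilpotent_group
      (sim4 :: 'a monoid \<Rightarrow> 'b monoid \<Rightarrow> bool) sim5"
    using nilpotent_comparison(3,4) unfolding partition_eq_def by blast
  show "partition_le finite_nilpotent_group finite_nilpotent_group
      (sim5 :: 'a monoid \<Rightarrow> 'b monoid \<Rightarrow> bool) sim6"
    using nilpotent_comparison(4,5) unfolding partition_le_def by blast
  show "partition_less finite_nilpotent_group finite_nilpotent_group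
      (sim1 :: nat monoid \<Rightarrow> nat monoid \<Rightarrow> bool) sim2"
    using nilpotent_comparison(1) sim2_not_sim1
    unfolding partition_less_def partition_le_def partition_eq_def by blast
  show "partition_less finite_nilpotent_group finite_nilpotent_group
      (sim5 :: nat monoid \<Rightarrow> nat monoid \<Rightarrow> bool) sim6"
    using nilpotent_comparison(4,5) sim6_not_sim5
    unfolding partition_less_def partition_le_def partition_eq_def by blast
qed

end
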